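(* Let $f\in PD(\mathbb{T})$, let $\Omega\subset\mathbb{T}$ be the finite set of its jump-discontinuities, and let $\beta\in\mathbb{C}$ with $|\beta|<1$. Then $$\log\det\big(I_N-\beta H_N(f)\big) = -\frac{\gamma_f(\beta)}{2\pi^2}\,\log N + o(\log N)\qquad\text{as } N\to\infty,$$ where $$\gamma_f(\beta):=\pi\big(\arcsin(-i\beta\kappa_1(f))+\arcsin(-i\beta\kappa_{-1}(f))\big)+\sum_{z\in\Omega}\arcsin^2\!\big(-i\beta\,(\kappa_z(f)\kappa_{\overline z}(f))^{1/2}\big).$$
   Context: $\mathbb{T}=\{v\in\mathbb{C}:|v|=1\}$, $\mathbb{Z}_+=\{0,1,2,\dots\}$. For a bounded function $f$ on $\mathbb{T}$ and $k\in\mathbb{Z}_+$ set $\widehat f(k)=\frac{1}{2\pi}\int_0^{2\pi}f(e^{it})e^{-ikt}\,dt$. $H_N(f)$ is the $N\times N$ matrix with entries $\widehat f(n+m)$, $0\le n,m\le N-1$ (the truncation of the Hankel matrix $H(f)=\{\widehat f(n+m)\}_{n,m\in\mathbb{Z}_+}$ on $\ell^2(\mathbb{Z}_+)$), and $I_N$ is the $N\times N$ identity matrix. The class $PD(\mathbb{T})$ consists of the functions $f:\mathbb{T}\to\mathbb{C}$ satisfying: (A) for every $z\in\mathbb{T}$ the limits $f(z^+):=\lim_{\varepsilon\searrow0}f(e^{i\varepsilon}z)$ and $f(z^-):=\lim_{\varepsilon\searrow0}f(e^{-i\varepsilon}z)$ exist; the points where they differ are called jump-discontinuities, and there are only finitely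 many of them, forming the set $\Omega$; (B) for some $1/2<\gamma\le1$, $f\in C^\gamma(\mathbb{T}\setminus\Omega)$, i.e. $f$ is Hölder continuous of exponent $\gamma$ (uniformly, with respect to arc length along the arc) on each connected component of $\mathbb{T}\setminus\Omega$, and for some $C>0$, all $\delta>0$ and all $z\in\Omega$, $|f(z^+)-f(e^{i\delta}z)|\le C\delta^\gamma$ and $|f(z^-)-f(e^{-i\delta}z)|\le C\delta^\gamma$; (C) $\sup_{v\in\mathbb{T}}|f(v)|\le1$. For $z\in\mathbb{T}$ the height of the jump is $\kappa_z(f):=\frac{f(z^+)-f(z^-)}{2}$ (so $\kappa_z(f)=0$ if $z\notin\Omega$). One has $\|H_N(f)\|\le1$, and $\log\det(I_N-\beta H_N(f))$ is understood as $\operatorname{Tr}\log(I_N-\beta H_N(f))=-\sum_{k\ge1}\beta^k\operatorname{Tr}(H_N(f)^k)/k$. $\arcsin$ is the principal branch (given by its power series on $|v|\le1$), and $\arcsin^2(v)=(\arcsin v)^2$. The square root $(\cdot)^{1/2}$ is any choice of square root; the expression does not depend on it because $\arcsin^2$ is an even function. *)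

theory Defs
  imports
    "HOL-Analysis.Analysis"
    "HOL-Library.Landau_Symbols"
    "Jordan_Normal_Form.Matrix"
begin

text \<open>
  A function on the unit circle is represented by a function on \<^typ>\<open>complex\<close>; only its
  values on \<^term>\<open>sphere (0::complex) 1\<close> are ever used.
\<close>

abbreviation unit_circle :: "complex set"
  where "unit_circle \<equiv> sphere 0 1"

definition fourier_coeff :: "(complex \<Rightarrow> complex) \<Rightarrow> nat \<Rightarrow> complex"
  where "fourier_coeff f k =
    1 / (2 * of_real pi) * integral {0..2 * pi} (\<lambda>t. f (cis t) * cis (- (real k * t)))"

definition hankel_mat :: "nat \<Rightarrow> (complex \<Rightarrow> complex) \<Rightarrow> complex Matrix.mat"
  where "hankel_mat N f = Matrix.mat N N (\<lambda>(n, m). fourier_coeff f (n + m))"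

definition mat_trace :: "'a::comm_monoid_add Matrix.mat \<Rightarrow> 'a"
  where "mat_trace A = (\<Sum>i<dim_row A. A $$ (i, i))"

text \<open>
  The branch of \<open>log det (I - \<beta> A)\<close> given by \<open>Tr log (I - \<beta> A)\<close>, where \<open>log\<close> is the power series
  at the identity. It is meaningful when the series converges, in particular
  when \<open>|\<beta>| < 1\<close> and \<open>A\<close> is a contraction.
\<close>

definition log_det_one_minus :: "complex \<Rightarrow> complex Matrix.mat \<Rightarrow> complex"
  where "log_det_one_minus \<beta> A = - (\<Sum>k. \<beta> ^ Suc k * mat_trace (A ^\<^sub>m Suc k) / of_nat (Suc k))"

definition limit_plus :: "(complex \<Rightarrow> complex) \<Rightarrow> complex \<Rightarrow> complex"
  where "limit_plus f z = Lim (at_right 0) (\<lambda>\<epsilon>. f (cis \<epsilon> * z))"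

definition limit_minus :: "(complex \<Rightarrow> complex) \<Rightarrow> complex \<Rightarrow> complex"
  where "limit_minus f z = Lim (at_right 0) (\<lambda>\<epsilon>. f (cis (- \<epsilon>) * z))"

definition jump_set :: "(complex \<Rightarrow> complex) \<Rightarrow> complex set"
  where "jump_set f = {z \<in> unit_circle. limit_plus f z \<noteq> limit_minus f z}"

definition jump_height :: "(complex \<Rightarrow> complex) \<Rightarrow> complex \<Rightarrow> complex"
  where "jump_height f z = (limit_plus f z - limit_minus f z) / 2"

text \<open>
  Hoelder continuity on a set \<open>A\<close> of points of the circle, with respect to arc length along arcs
  contained in \<open>A\<close>: the arc from \<open>cis s\<close> to \<open>cis t\<close> traversed by \<open>[s, t]\<close> has length \<open>t - s\<close>.
\<close>

definition arc_holder_on :: "real \<Rightarrow> complex set \<Rightarrow> (complex \<Rightarrow> complex) \<Rightarrow> bool"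
  where "arc_holder_on \<gamma> A f \<longleftrightarrow>
    (\<exists>C. \<forall>s t. s \<le> t \<longrightarrow> cis ` {s..t} \<subseteq> A \<longrightarrow>
       norm (f (cis s) - f (cis t)) \<le> C * (t - s) powr \<gamma>)"

definition PD :: "(complex \<Rightarrow> complex) set"
  where "PD = {f.
    (\<forall>z\<in>unit_circle.
       (\<exists>l. ((\<lambda>\<epsilon>. f (cis \<epsilon> * z)) \<longlongrightarrow> l) (at_right 0)) \<and>
       (\<exists>l. ((\<lambda>\<epsilon>. f (cis (- \<epsilon>) * z)) \<longlongrightarrow> l) (at_right 0))) \<and>
    finite (jump_set f) \<and>
    (\<exists>\<gamma>. 1/2 < \<gamma> \<and> \<gamma> \<le> 1 \<and>
       (\<forall>A\<in>components (unit_circle - jump_set f). arc_holder_on \<gamma> A f) \<and>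
       (\<exists>C>0. \<forall>\<delta>>0. \<forall>z\<in>jump_set f.
          norm (limit_plus f z - f (cis \<delta> * z)) \<le> C * \<delta> powr \<gamma> \<and>
          norm (limit_minus f z - f (cis (- \<delta>) * z)) \<le> C * \<delta> powr \<gamma>)) \<and>
    (\<forall>v\<in>unit_circle. norm (f v) \<le> 1)}"

text \<open>
  The choice of square root is immaterial, since the square of \<^const>\<open>Arcsin\<close> is even on the
  open unit disc, where all arguments below lie for \<open>f \<in> PD\<close> and \<open>|\<beta>| < 1\<close>.
\<close>

definition gamma_coeff :: "(complex \<Rightarrow> complex) \<Rightarrow> complex \<Rightarrow> complex"
  where "gamma_coeff f \<beta> =
    of_real pi * (Arcsin (- \<i> * \<beta> * jump_height f 1) + Arcsin (- \<i> * \<beta> * jump_height f (-1)))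
    + (\<Sum>z\<in>jump_set f.
         (Arcsin (- \<i> * \<beta> * csqrt (jump_height f z * jump_height f (cnj z))))\<^sup>2)"

end

theory Submission
  imports Defs
begin

text \<open>
  By definition, \<open>log det (I - \<beta> H)\<close> is the power series in \<open>\<beta>\<close> with coefficients \<open>- Tr H\<^sup>k / k\<close>, where
  \<open>H\<close> is the \<open>N\<close>-th Hankel matrix of \<open>f\<close>. As \<open>|f| \<le> 1\<close>, the matrix \<open>H\<close> is a contraction, and its
  Hilbert--Schmidt norm is \<open>O(sqrt (log N))\<close>; so all the traces are \<open>O(log N)\<close>, uniformly in \<open>k\<close>, and
  dominated convergence (\<open>log_det_limit\<close>) reduces the theorem to the leading order of \<open>Tr H\<^sup>k\<close> for
  every fixed \<open>k\<close>.

  The same Hilbert--Schmidt bound shows, with the Cauchy--Schwarz inequality for traces, that a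
  perturbation which is bounded in Hilbert--Schmidt norm changes \<open>Tr H\<^sup>k\<close> only by \<open>O(sqrt (log N))\<close>
  (\<open>tr_perturbed_jump_hankel_power\<close>). Only the lowest powers, which offer no second factor, require
  direct estimates of traces. The function \<open>f\<close> is a superposition of rotated model jumps, whose Hankel matrices are rotated
  multiples of the Hilbert matrix \<open>1 / (i + j + 1)\<close>, and of a continuous function which is Hoelder of
  exponent greater than \<open>1/2\<close>. Bessel's inequality for differences puts the latter into the Sobolev
  class of order \<open>1/2\<close> (\<open>weighted_coefficients_of_holder\<close>), which means that its Hankel matrix is
  Hilbert--Schmidt (\<open>PD_hankel\<close>).

  In a product of rotated Hilbert matrices, two neighbouring factors interact only if their
  singularities are at conjugate points: otherwise the sum over the common index oscillates
  (\<open>hs_bounded_hilb_rot_hilb\<close>). In the trace there remain the cyclic words \<open>z, cnj z, z, \<dots>\<close>. Those of even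
  length exist for every jump \<open>z\<close>; those of odd length force \<open>z = cnj z\<close>, that is, \<open>z = 1\<close> or
  \<open>z = -1\<close>. This is the origin of the two parts of \<^const>\<open>gamma_coeff\<close>.

  What remains is \<open>T\<^sub>k = Tr H\<^sup>k\<close> for the Hilbert matrix itself (\<open>tr_hilb_power\<close>). In the
  continuous picture the Hilbert matrix is the operator with kernel \<open>1 / (x + y)\<close>, which the Mellin
  transform turns into multiplication by \<open>\<pi> sech (\<pi> \<xi>)\<close>, while \<open>1 / (x - y)\<close> becomes \<open>tanh\<close> up to a
  constant, and the commutator with \<open>log x\<close> becomes a derivative. Hence \<open>T\<^sub>k\<close> should grow like
  \<open>log N\<close> times the integral of \<open>(\<pi> sech (\<pi> \<xi>))\<^sup>k\<close>, divided by \<open>2 \<pi>\<close>. This integral obeys a recursion of step 2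
  that follows from \<open>sech' = - sech tanh\<close>, \<open>tanh' = sech\<^sup>2\<close>, \<open>tanh\<^sup>2 = 1 - sech\<^sup>2\<close> and an
  integration by parts. Each of the three formulas is a partial fraction identity for matrices, up
  to bounded Hilbert--Schmidt errors (\<open>hilb_dht_equiv\<close>, \<open>log_comm_dht\<close>, \<open>dht_square_hilb\<close>), and the
  integration by parts is the fact that a commutator has trace zero (\<open>tr_hilb_power_rec\<close>,
  \<open>tr_hilb_cube\<close>). So the recursion can be read off from finite matrices, without any Mellin
  transform, and it is started by \<open>T\<^sub>1\<close> and \<open>T\<^sub>2\<close>, which are elementary.

  Finally, the recursion turns into a differential equation for the generating function of the moments, with
  solution \<open>arcsin\<^sup>2 + \<pi> arcsin\<close> (\<open>sech_moment_generating_function\<close>); its even and odd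
  parts give the two kinds of terms of the theorem.
\<close>

section \<open>The ring of matrix sequences\<close>

text \<open>The entries outside the \<open>N \<times> N\<close> corner are required to vanish so that the identity matrices
  form a unit. Then sequences of matrices form a ring, and the arguments below become ring algebra.\<close>

typedef mseq = "{X :: nat \<Rightarrow> nat \<Rightarrow> nat \<Rightarrow> complex. \<forall>N i j. \<not> (i < N \<and> j < N) \<longrightarrow> X N i j = 0}"
  morphisms entry Abs_mseq
  by (rule exI[of _ "\<lambda>_ _ _. 0"]) simp

setup_lifting type_definition_mseq

lift_definition mat_seq :: "(nat \<Rightarrow> nat \<Rightarrow> nat \<Rightarrow> complex) \<Rightarrow> mseq"
  is "\<lambda>f N i j. if i < N \<and> j < N then f N i j else 0" by auto

lift_definition diag_seq :: "(nat \<Rightarrow> nat \<Rightarrow> complex) \<Rightarrow> mseq"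
  is "\<lambda>d N i j. if i < N \<and> i = j then d N i else 0" by auto

lift_definition mtransp :: "mseq \<Rightarrow> mseq" is "\<lambda>X N i j. X N j i" by auto

lemma entry_mat_seq [simp]:
  "entry (mat_seq f) N i j = (if i < N \<and> j < N then f N i j else 0)"
  by (simp add: mat_seq.rep_eq)

lemma entry_diag_seq [simp]: "entry (diag_seq d) N i j = (if i < N \<and> i = j then d N i else 0)"
  by (simp add: diag_seq.rep_eq)

lemma entry_transp [simp]: "entry (mtransp X) N i j = entry X N j i"
  by (simp add: mtransp.rep_eq)

lemma entry_outside [simp]: "\<not> (i < N \<and> j < N) \<Longrightarrow> entry X N i j = 0"
  using entry[of X] by simp

lemma mseq_eqI:
  assumes "\<And>N i j. i < N \<Longrightarrow> j < N \<Longrightarrow> entry X N i j = entry Y N i j"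
  shows "X = Y"
proof -
  have "entry X N i j = entry Y N i j" for N i j
    by (cases "i < N \<and> j < N") (auto simp: assms)
  then show ?thesis by (simp add: entry_inject[symmetric] fun_eq_iff)
qed

instantiation mseq :: ring_1
begin

lift_definition zero_mseq :: mseq is "\<lambda>_ _ _. 0" by simp
lift_definition one_mseq :: mseq is "\<lambda>N i j. if i < N \<and> i = j then 1 else 0" by auto
lift_definition plus_mseq :: "mseq \<Rightarrow> mseq \<Rightarrow> mseq" is "\<lambda>X Y N i j. X N i j + Y N i j" by simp
lift_definition minus_mseq :: "mseq \<Rightarrow> mseq \<Rightarrow> mseq" is "\<lambda>X Y N i j. X N i j - Y N i j" by simp
lift_definition uminus_mseq :: "mseq \<Rightarrow> mseq" is "\<lambda>X N i j. - X N i j" by simp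
lift_definition times_mseq :: "mseq \<Rightarrow> mseq \<Rightarrow> mseq"
  is "\<lambda>X Y N i j. \<Sum>t<N. X N i t * Y N t j" by auto

instance
proof
  fix a b c :: mseq
  show "a * b * c = a * (b * c)"
  proof (transfer, intro ext)
    fix a b c :: "nat \<Rightarrow> nat \<Rightarrow> nat \<Rightarrow> complex" and N i j
    have "(\<Sum>t<N. (\<Sum>s<N. a N i s * b N s t) * c N t j) = (\<Sum>t<N. \<Sum>s<N. a N i s * b N s t * c N t j)"
      by (simp add: sum_distrib_right)
    also have "\<dots> = (\<Sum>s<N. \<Sum>t<N. a N i s * b N s t * c N t j)" by (rule sum.swap)
    also have "\<dots> = (\<Sum>s<N. a N i s * (\<Sum>t<N. b N s t * c N t j))"
      by (simp add: sum_distrib_left mult.assoc)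
    finally show "(\<Sum>t<N. (\<Sum>s<N. a N i s * b N s t) * c N t j)
        = (\<Sum>s<N. a N i s * (\<Sum>t<N. b N s t * c N t j))" .
  qed
  show "a + b + c = a + (b + c)" by transfer (simp add: add.assoc)
  show "a + b = b + a" by transfer (simp add: add.commute)
  show "0 + a = a" by transfer simp
  show "- a + a = 0" by transfer simp
  show "a - b = a + - b" by transfer simp
  show "(a + b) * c = a * c + b * c"
    by transfer (simp add: sum.distrib algebra_simps)
  show "a * (b + c) = a * b + a * c"
    by transfer (simp add: sum.distrib algebra_simps)
  show "1 * a = a"
  proof (transfer, intro ext)
    fix a :: "nat \<Rightarrow> nat \<Rightarrow> nat \<Rightarrow> complex" and N i j
    assume "\<forall>N i j. \<not> (i < N \<and> j < N) \<longrightarrow> a N i j = 0"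
    then show "(\<Sum>t<N. (if i < N \<and> i = t then 1 else 0) * a N t j) = a N i j"
      by (cases "i < N") (auto simp: mult_delta_left)
  qed
  show "a * 1 = a"
  proof (transfer, intro ext)
    fix a :: "nat \<Rightarrow> nat \<Rightarrow> nat \<Rightarrow> complex" and N i j
    assume *: "\<forall>N i j. \<not> (i < N \<and> j < N) \<longrightarrow> a N i j = 0"
    have "(\<Sum>t<N. a N i t * (if t < N \<and> t = j then 1 else 0)) = (\<Sum>t<N. if t = j then a N i t else 0)"
      by (intro sum.cong) auto
    also have "\<dots> = a N i j" using * by (cases "j < N") (auto simp: sum.delta)
    finally show "(\<Sum>t<N. a N i t * (if t < N \<and> t = j then 1 else 0)) = a N i j" .
  qed
  show "(0::mseq) \<noteq> 1"
  proof (transfer, rule notI)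
    assume "(\<lambda>_ _ _. 0) = (\<lambda>(N::nat) i j. if i < N \<and> i = j then 1 else (0::complex))"
    from fun_cong[OF this, of "Suc 0"]
    have "(\<lambda>_ _. 0) = (\<lambda>i (j::nat). if i < Suc 0 \<and> i = j then 1 else (0::complex))" .
    from fun_cong[OF this, of 0]
    have "(\<lambda>_. 0) = (\<lambda>j::nat. if 0 < Suc 0 \<and> 0 = j then 1 else (0::complex))" .
    from fun_cong[OF this, of 0] show False by simp
  qed
qed

end

lemma entry_add [simp]: "entry (X + Y) N i j = entry X N i j + entry Y N i j"
  by (simp add: plus_mseq.rep_eq)

lemma entry_diff [simp]: "entry (X - Y) N i j = entry X N i j - entry Y N i j"
  by (simp add: minus_mseq.rep_eq)

lemma entry_minus [simp]: "entry (- X) N i j = - entry X N i j"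
  by (simp add: uminus_mseq.rep_eq)

lemma entry_zero [simp]: "entry 0 N i j = 0"
  by (simp add: zero_mseq.rep_eq)

lemma entry_one [simp]: "entry 1 N i j = (if i < N \<and> i = j then 1 else 0)"
  by (simp add: one_mseq.rep_eq)

lemma entry_sum [simp]: "entry (\<Sum>a\<in>S. X a) N i j = (\<Sum>a\<in>S. entry (X a) N i j)"
  by (induction S rule: infinite_finite_induct) auto

lemma entry_mult: "entry (X * Y) N i j = (\<Sum>t<N. entry X N i t * entry Y N t j)"
  by (simp add: times_mseq.rep_eq)

lemma entry_diag_mult [simp]: "entry (diag_seq d * X) N i j = d N i * entry X N i j"
proof (cases "i < N")
  case True
  have "entry (diag_seq d * X) N i j = (\<Sum>t<N. if i = t then d N i * entry X N t j else 0)"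
    unfolding entry_mult by (intro sum.cong) (auto simp: True)
  then show ?thesis using True by simp
qed (simp add: entry_mult)

lemma entry_mult_diag [simp]: "entry (X * diag_seq d) N i j = entry X N i j * d N j"
proof (cases "j < N")
  case True
  have "entry (X * diag_seq d) N i j = (\<Sum>t<N. if t = j then entry X N i t * d N j else 0)"
    unfolding entry_mult by (intro sum.cong) (auto simp: True)
  then show ?thesis using True by simp
qed (simp add: entry_mult)

lemma diag_seq_mult: "diag_seq d * diag_seq d' = diag_seq (\<lambda>N i. d N i * d' N i)"
  by (rule mseq_eqI) simp

lemma transp_mult: "mtransp (X * Y) = mtransp Y * mtransp X"
  by (rule mseq_eqI) (simp add: entry_mult mult.commute)

lemma transp_diff: "mtransp (X - Y) = mtransp X - mtransp Y"
  and transp_minus: "mtransp (- X) = - mtransp X"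
  and transp_transp [simp]: "mtransp (mtransp X) = X"
  and transp_diag [simp]: "mtransp (diag_seq d) = diag_seq d"
  by (rule mseq_eqI, force)+

definition tr :: "mseq \<Rightarrow> nat \<Rightarrow> complex"
  where "tr X N = (\<Sum>i<N. entry X N i i)"

lemma tr_add: "tr (X + Y) N = tr X N + tr Y N"
  and tr_diff: "tr (X - Y) N = tr X N - tr Y N"
  and tr_minus: "tr (- X) N = - tr X N"
  and tr_zero [simp]: "tr 0 N = 0"
  by (simp_all add: tr_def sum.distrib sum_subtractf sum_negf)

lemma tr_sum: "tr (\<Sum>a\<in>S. X a) N = (\<Sum>a\<in>S. tr (X a) N)"
  by (simp add: tr_def sum.swap[of _ S])

lemma tr_commute: "tr (X * Y) N = tr (Y * X) N"
proof -
  have "tr (X * Y) N = (\<Sum>i<N. \<Sum>t<N. entry X N i t * entry Y N t i)"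
    by (simp add: tr_def entry_mult)
  also have "\<dots> = (\<Sum>t<N. \<Sum>i<N. entry X N i t * entry Y N t i)" by (rule sum.swap)
  also have "\<dots> = tr (Y * X) N" by (simp add: tr_def entry_mult mult.commute)
  finally show ?thesis .
qed

lemma tr_transp: "tr (mtransp X) N = tr X N"
  by (simp add: tr_def)

section \<open>Operator norm, Hilbert--Schmidt norm and negligible errors\<close>

definition vnorm :: "nat \<Rightarrow> (nat \<Rightarrow> complex) \<Rightarrow> real"
  where "vnorm N v = L2_set (\<lambda>i. cmod (v i)) {..<N}"

lemma vnorm_nonneg [simp]: "0 \<le> vnorm N v"
  by (simp add: vnorm_def L2_set_nonneg)

lemma vnorm_sq: "(vnorm N v)\<^sup>2 = (\<Sum>i<N. (cmod (v i))\<^sup>2)"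
  by (simp add: vnorm_def L2_set_def sum_nonneg)

lemma vnorm_cnj [simp]: "vnorm N (\<lambda>i. cnj (v i)) = vnorm N v"
  by (simp add: vnorm_def)

definition hs :: "mseq \<Rightarrow> nat \<Rightarrow> real"
  where "hs X N = L2_set (\<lambda>(i, j). cmod (entry X N i j)) ({..<N} \<times> {..<N})"

lemma hs_nonneg [simp]: "0 \<le> hs X N"
  by (simp add: hs_def L2_set_nonneg)

lemma hs_sq: "(hs X N)\<^sup>2 = (\<Sum>i<N. \<Sum>j<N. (cmod (entry X N i j))\<^sup>2)"
proof -
  have "(hs X N)\<^sup>2 = (\<Sum>(i, j)\<in>{..<N} \<times> {..<N}. (cmod (entry X N i j))\<^sup>2)"
    by (simp add: hs_def L2_set_def case_prod_unfold sum_nonneg)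
  then show ?thesis by (simp add: sum.cartesian_product)
qed

lemma hs_transp [simp]: "hs (mtransp X) N = hs X N"
proof -
  have "(hs (mtransp X) N)\<^sup>2 = (hs X N)\<^sup>2"
    unfolding hs_sq by (subst sum.swap) simp
  then show ?thesis by simp
qed

lemma hs_triangle: "hs (X + Y) N \<le> hs X N + hs Y N"
proof -
  have "hs (X + Y) N \<le> L2_set (\<lambda>(i, j). cmod (entry X N i j) + cmod (entry Y N i j)) ({..<N} \<times> {..<N})"
    unfolding hs_def by (intro L2_set_mono) (auto simp: norm_triangle_ineq)
  also have "\<dots> \<le> hs X N + hs Y N"
    unfolding hs_def case_prod_unfold by (rule L2_set_triangle_ineq)
  finally show ?thesis .
qed

lemma hs_minus [simp]: "hs (- X) N = hs X N"
  by (simp add: hs_def)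

text \<open>The bilinear form of the bound makes it visibly invariant under transposition, so that one
  constant serves for multiplication from either side.\<close>

definition op_le :: "mseq \<Rightarrow> real \<Rightarrow> bool"
  where "op_le X C \<longleftrightarrow> 0 \<le> C \<and> (\<forall>N u v.
    cmod (\<Sum>i<N. \<Sum>j<N. u i * entry X N i j * v j) \<le> C * vnorm N u * vnorm N v)"

lemma op_leI:
  assumes "0 \<le> C"
    and "\<And>N u v. cmod (\<Sum>i<N. \<Sum>j<N. u i * entry X N i j * v j) \<le> C * vnorm N u * vnorm N v"
  shows "op_le X C"
  using assms by (simp add: op_le_def)

lemma op_leD:
  "op_le X C \<Longrightarrow> cmod (\<Sum>i<N. \<Sum>j<N. u i * entry X N i j * v j) \<le> C * vnorm N u * vnorm N v"
  by (simp add: op_le_def)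

lemma op_le_nonneg: "op_le X C \<Longrightarrow> 0 \<le> C"
  by (simp add: op_le_def)

lemma op_le_apply:
  assumes "op_le X C"
  shows "vnorm N (\<lambda>i. \<Sum>j<N. entry X N i j * v j) \<le> C * vnorm N v"
proof -
  define w where "w = (\<lambda>i. \<Sum>j<N. entry X N i j * v j)"
  have "(\<Sum>i<N. \<Sum>j<N. cnj (w i) * entry X N i j * v j) = (\<Sum>i<N. cnj (w i) * w i)"
    by (simp add: w_def sum_distrib_left mult.assoc)
  also have "\<dots> = (\<Sum>i<N. of_real ((cmod (w i))\<^sup>2))"
    by (intro sum.cong refl) (simp add: mult.commute complex_norm_square[symmetric])
  also have "\<dots> = of_real ((vnorm N w)\<^sup>2)" by (simp add: vnorm_sq)
  finally have "(vnorm N w)\<^sup>2 \<le> C * vnorm N w * vnorm N v"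
    using op_leD[OF assms, where N = N and u = "\<lambda>i. cnj (w i)" and v = v] by (simp add: norm_power)
  then have "vnorm N w \<le> C * vnorm N v"
    using op_le_nonneg[OF assms] vnorm_nonneg[of N w] vnorm_nonneg[of N v]
    by (cases "vnorm N w = 0") (auto simp: power2_eq_square mult.commute mult.left_commute)
  then show ?thesis by (simp add: w_def)
qed

lemma op_le_transp:
  assumes "op_le X C"
  shows "op_le (mtransp X) C"
proof (rule op_leI)
  show "0 \<le> C" by (rule op_le_nonneg[OF assms])
  fix N u v
  have "(\<Sum>i<N. \<Sum>j<N. u i * entry (mtransp X) N i j * v j) = (\<Sum>i<N. \<Sum>j<N. v i * entry X N i j * u j)"
    by (subst sum.swap) (simp add: mult.commute mult.left_commute)
  then show "cmod (\<Sum>i<N. \<Sum>j<N. u i * entry (mtransp X) N i j * v j) \<le> C * vnorm N u * vnorm N v"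
    using op_leD[OF assms, where N = N and u = v and v = u] by (simp add: mult.commute mult.left_commute)
qed

lemma op_le_mult:
  assumes "op_le X C" "op_le Y D"
  shows "op_le (X * Y) (C * D)"
proof (rule op_leI)
  show "0 \<le> C * D" using assms by (simp add: op_le_nonneg)
  fix N u v
  define w where "w = (\<lambda>i. \<Sum>j<N. entry Y N i j * v j)"
  have "(\<Sum>j<N. u i * entry (X * Y) N i j * v j) = (\<Sum>t<N. u i * entry X N i t * w t)" for i
  proof -
    have "(\<Sum>j<N. u i * entry (X * Y) N i j * v j)
        = (\<Sum>j<N. \<Sum>t<N. u i * entry X N i t * (entry Y N t j * v j))"
      by (simp add: entry_mult sum_distrib_left sum_distrib_right mult.assoc)
    also have "\<dots> = (\<Sum>t<N. \<Sum>j<N. u i * entry X N i t * (entry Y N t j * v j))" by (rule sum.swap)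
    finally show ?thesis by (simp add: w_def sum_distrib_left)
  qed
  then have "cmod (\<Sum>i<N. \<Sum>j<N. u i * entry (X * Y) N i j * v j) \<le> C * vnorm N u * vnorm N w"
    using op_leD[OF assms(1), where N = N and u = u and v = w] by simp
  also have "\<dots> \<le> C * vnorm N u * (D * vnorm N v)"
    using op_le_apply[OF assms(2)] op_le_nonneg[OF assms(1)] unfolding w_def
    by (intro mult_left_mono) auto
  finally show "cmod (\<Sum>i<N. \<Sum>j<N. u i * entry (X * Y) N i j * v j) \<le> C * D * vnorm N u * vnorm N v"
    by (simp add: mult.commute mult.left_commute)
qed

lemma op_le_add:
  assumes "op_le X C" "op_le Y D"
  shows "op_le (X + Y) (C + D)"
proof (rule op_leI)
  show "0 \<le> C + D" using assms by (simp add: op_le_nonneg)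
  fix N u v
  have "(\<Sum>i<N. \<Sum>j<N. u i * entry (X + Y) N i j * v j)
      = (\<Sum>i<N. \<Sum>j<N. u i * entry X N i j * v j) + (\<Sum>i<N. \<Sum>j<N. u i * entry Y N i j * v j)"
    by (simp add: sum.distrib algebra_simps)
  then show "cmod (\<Sum>i<N. \<Sum>j<N. u i * entry (X + Y) N i j * v j) \<le> (C + D) * vnorm N u * vnorm N v"
    using op_leD[OF assms(1), where N = N and u = u and v = v] op_leD[OF assms(2), where N = N and u = u and v = v]
      norm_triangle_ineq[of "\<Sum>i<N. \<Sum>j<N. u i * entry X N i j * v j"
        "\<Sum>i<N. \<Sum>j<N. u i * entry Y N i j * v j"]
    by (simp add: distrib_right)
qed

lemma op_le_diag:
  assumes "0 \<le> C" "\<And>N i. i < N \<Longrightarrow> cmod (d N i) \<le> C"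
  shows "op_le (diag_seq d) C"
proof (rule op_leI)
  fix N u v
  have "(\<Sum>i<N. \<Sum>j<N. u i * entry (diag_seq d) N i j * v j) = (\<Sum>i<N. u i * d N i * v i)"
  proof (rule sum.cong)
    fix i assume "i \<in> {..<N}"
    then have "(\<Sum>j<N. u i * entry (diag_seq d) N i j * v j) = (\<Sum>j<N. if i = j then u i * d N i * v i else 0)"
      by (intro sum.cong) auto
    then show "(\<Sum>j<N. u i * entry (diag_seq d) N i j * v j) = u i * d N i * v i"
      using \<open>i \<in> {..<N}\<close> by simp
  qed simp
  also have "cmod \<dots> \<le> (\<Sum>i<N. C * (\<bar>cmod (u i)\<bar> * \<bar>cmod (v i)\<bar>))"
  proof (rule sum_norm_le)
    fix i assume "i \<in> {..<N}"
    then have "cmod (d N i) * (cmod (u i) * cmod (v i)) \<le> C * (cmod (u i) * cmod (v i))"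
      using assms(2)[of i N] by (intro mult_right_mono) auto
    then show "cmod (u i * d N i * v i) \<le> C * (\<bar>cmod (u i)\<bar> * \<bar>cmod (v i)\<bar>)"
      by (simp add: norm_mult mult.commute mult.left_commute)
  qed
  also have "\<dots> \<le> C * (vnorm N u * vnorm N v)"
    unfolding sum_distrib_left[symmetric] vnorm_def
    using assms(1) by (intro mult_left_mono L2_set_mult_ineq)
  finally show "cmod (\<Sum>i<N. \<Sum>j<N. u i * entry (diag_seq d) N i j * v j) \<le> C * vnorm N u * vnorm N v"
    by (simp add: mult.assoc)
qed (rule assms(1))

lemma op_le_one: "op_le 1 1"
proof -
  have "(1::mseq) = diag_seq (\<lambda>_ _. 1)" by (rule mseq_eqI) auto
  then show ?thesis using op_le_diag[of 1 "\<lambda>_ _. 1"] by simp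
qed

lemma op_le_power: "op_le X C \<Longrightarrow> op_le (X ^ k) (C ^ k)"
  by (induction k) (auto intro: op_le_mult op_le_one)

lemma hs_op_left:
  assumes "op_le X C"
  shows "hs (X * Y) N \<le> C * hs Y N"
proof -
  have "(hs (X * Y) N)\<^sup>2 = (\<Sum>j<N. (vnorm N (\<lambda>i. \<Sum>t<N. entry X N i t * entry Y N t j))\<^sup>2)"
    unfolding hs_sq vnorm_sq by (subst sum.swap) (simp add: entry_mult)
  also have "\<dots> \<le> (\<Sum>j<N. (C * vnorm N (\<lambda>t. entry Y N t j))\<^sup>2)"
    by (intro sum_mono power_mono op_le_apply[OF assms] vnorm_nonneg)
  also have "\<dots> = C\<^sup>2 * (\<Sum>j<N. \<Sum>i<N. (cmod (entry Y N i j))\<^sup>2)"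
    by (simp add: power_mult_distrib vnorm_sq sum_distrib_left)
  also have "\<dots> = (C * hs Y N)\<^sup>2"
    unfolding power_mult_distrib hs_sq by (subst sum.swap) simp
  finally show ?thesis
    by (rule power2_le_imp_le) (simp add: op_le_nonneg[OF assms])
qed

lemma tr_le_hs: "cmod (tr (X * Y) N) \<le> hs X N * hs Y N"
proof -
  have "tr (X * Y) N = (\<Sum>(i, t)\<in>{..<N} \<times> {..<N}. entry X N i t * entry (mtransp Y) N i t)"
    by (simp add: tr_def entry_mult sum.cartesian_product)
  also have "cmod \<dots> \<le> (\<Sum>p\<in>{..<N} \<times> {..<N}. \<bar>case p of (i, j) \<Rightarrow> cmod (entry X N i j)\<bar>
      * \<bar>case p of (i, j) \<Rightarrow> cmod (entry (mtransp Y) N i j)\<bar>)"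
    by (rule sum_norm_le) (auto simp: norm_mult)
  also have "\<dots> \<le> hs X N * hs (mtransp Y) N"
    unfolding hs_def by (rule L2_set_mult_ineq)
  finally show ?thesis by simp
qed

definition op_bounded :: "mseq \<Rightarrow> bool"
  where "op_bounded X \<longleftrightarrow> (\<exists>C. op_le X C)"

definition hs_bounded :: "mseq \<Rightarrow> bool"
  where "hs_bounded X \<longleftrightarrow> (\<exists>C. \<forall>N. hs X N \<le> C)"

text \<open>The growth of the Hilbert--Schmidt norm of the Hankel matrices under consideration. The
  harmonic number stands for \<open>log N\<close>.\<close>

definition hs_log :: "mseq \<Rightarrow> bool"
  where "hs_log X \<longleftrightarrow> (\<exists>C. \<forall>N. hs X N \<le> C * sqrt (harm N))"

definition hs_equiv :: "mseq \<Rightarrow> mseq \<Rightarrow> bool"  (infix "\<doteq>" 50)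
  where "X \<doteq> Y \<longleftrightarrow> hs_bounded (X - Y)"

definition negligible_seq :: "(nat \<Rightarrow> complex) \<Rightarrow> bool"
  where "negligible_seq a \<longleftrightarrow> (\<exists>C. \<forall>N. cmod (a N) \<le> C * sqrt (harm N))"

lemma op_bounded_mult: "op_bounded X \<Longrightarrow> op_bounded Y \<Longrightarrow> op_bounded (X * Y)"
  unfolding op_bounded_def by (blast intro: op_le_mult)

lemma op_bounded_add: "op_bounded X \<Longrightarrow> op_bounded Y \<Longrightarrow> op_bounded (X + Y)"
  unfolding op_bounded_def by (blast intro: op_le_add)

lemma op_bounded_power: "op_bounded X \<Longrightarrow> op_bounded (X ^ k)"
  unfolding op_bounded_def by (blast intro: op_le_power)

lemma op_bounded_diag: "(\<And>N i. i < N \<Longrightarrow> cmod (d N i) \<le> C) \<Longrightarrow> op_bounded (diag_seq d)"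
  unfolding op_bounded_def
  by (rule exI[of _ "max C 0"], rule op_le_diag) (auto intro: max.coboundedI1)

lemma op_bounded_sum:
  "(\<And>a. a \<in> S \<Longrightarrow> op_bounded (X a)) \<Longrightarrow> op_bounded (\<Sum>a\<in>S. X a)"
proof (induction S rule: infinite_finite_induct)
  case (insert a S)
  then show ?case by (simp add: op_bounded_add)
qed (use op_le_diag[of 0 "\<lambda>_ _. 0"] in \<open>auto simp: op_bounded_def op_le_def intro!: exI[of _ 0]\<close>)

lemma hs_bounded_op_left: "op_bounded X \<Longrightarrow> hs_bounded Y \<Longrightarrow> hs_bounded (X * Y)"
proof -
  assume "op_bounded X" "hs_bounded Y"
  then obtain C D where C: "op_le X C" and D: "\<And>N. hs Y N \<le> D"
    by (auto simp: op_bounded_def hs_bounded_def)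
  have "hs (X * Y) N \<le> C * D" for N
    using hs_op_left[OF C, of Y N] mult_left_mono[OF D op_le_nonneg[OF C], of N] by linarith
  then show ?thesis by (auto simp: hs_bounded_def)
qed

lemma hs_bounded_transp: "hs_bounded (mtransp X) \<longleftrightarrow> hs_bounded X"
  by (simp add: hs_bounded_def)

lemma op_bounded_transp: "op_bounded X \<Longrightarrow> op_bounded (mtransp X)"
  by (auto simp: op_bounded_def intro: op_le_transp)

lemma hs_bounded_op_right: "op_bounded X \<Longrightarrow> hs_bounded Y \<Longrightarrow> hs_bounded (Y * X)"
  using hs_bounded_op_left[of "mtransp X" "mtransp Y"]
  by (simp add: op_bounded_transp hs_bounded_transp transp_mult[symmetric])

lemma hs_log_op_left: "op_bounded X \<Longrightarrow> hs_log Y \<Longrightarrow> hs_log (X * Y)"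
proof -
  assume "op_bounded X" "hs_log Y"
  then obtain C D where C: "op_le X C" and D: "\<And>N. hs Y N \<le> D * sqrt (harm N)"
    by (auto simp: op_bounded_def hs_log_def)
  have "hs (X * Y) N \<le> (C * D) * sqrt (harm N)" for N
    using hs_op_left[OF C, of Y N] mult_left_mono[OF D op_le_nonneg[OF C], of N] by (simp add: mult.assoc)
  then show ?thesis unfolding hs_log_def by blast
qed

lemma hs_log_transp: "hs_log (mtransp X) \<longleftrightarrow> hs_log X"
  by (simp add: hs_log_def)

lemma hs_log_op_right: "op_bounded X \<Longrightarrow> hs_log Y \<Longrightarrow> hs_log (Y * X)"
  using hs_log_op_left[of "mtransp X" "mtransp Y"]
  by (simp add: op_bounded_transp hs_log_transp transp_mult[symmetric])

lemma hs_bounded_add: "hs_bounded X \<Longrightarrow> hs_bounded Y \<Longrightarrow> hs_bounded (X + Y)"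
  unfolding hs_bounded_def using hs_triangle by (meson add_mono order.trans)

lemma hs_bounded_minus: "hs_bounded (- X) \<longleftrightarrow> hs_bounded X"
  by (simp add: hs_bounded_def)

lemma hs_bounded_zero [simp]: "hs_bounded 0"
  by (auto simp: hs_bounded_def hs_def L2_set_def)

lemma hs_bounded_diff: "hs_bounded X \<Longrightarrow> hs_bounded Y \<Longrightarrow> hs_bounded (X - Y)"
  using hs_bounded_add[of X "- Y"] by (simp add: hs_bounded_minus)

lemma hs_bounded_sum:
  "(\<And>a. a \<in> S \<Longrightarrow> hs_bounded (X a)) \<Longrightarrow> hs_bounded (\<Sum>a\<in>S. X a)"
  by (induction S rule: infinite_finite_induct) (auto intro: hs_bounded_add)

lemma hs_log_add: "hs_log X \<Longrightarrow> hs_log Y \<Longrightarrow> hs_log (X + Y)"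
proof -
  assume "hs_log X" "hs_log Y"
  then obtain C D where *: "\<And>N. hs X N \<le> C * sqrt (harm N)" "\<And>N. hs Y N \<le> D * sqrt (harm N)"
    by (auto simp: hs_log_def)
  have "hs (X + Y) N \<le> (C + D) * sqrt (harm N)" for N
    using hs_triangle[of X Y N] *[of N] by (simp add: distrib_right)
  then show ?thesis unfolding hs_log_def by blast
qed

lemma harm_ge_1: "0 < N \<Longrightarrow> 1 \<le> (harm N :: real)"
  using harm_mono[of 1 N, where 'a = real] by (simp add: harm_expand)

text \<open>A bounded quantity is dominated by \<open>sqrt (harm N)\<close> except possibly at \<open>N = 0\<close>, where all
  quantities of interest are empty sums.\<close>

lemma le_sqrt_harm:
  assumes "\<And>N. a N \<le> C" "a 0 \<le> (0::real)"
  shows "a N \<le> \<bar>C\<bar> * sqrt (harm N)"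
proof (cases "N = 0")
  case True
  then show ?thesis using assms(2) by (simp add: harm_def)
next
  case False
  then have "1 \<le> sqrt (harm N)" using harm_ge_1[of N] by simp
  then have "\<bar>C\<bar> * 1 \<le> \<bar>C\<bar> * sqrt (harm N)" by (intro mult_left_mono) auto
  then show ?thesis using assms(1)[of N] by linarith
qed

lemma hs_bounded_imp_log: "hs_bounded X \<Longrightarrow> hs_log X"
proof -
  assume "hs_bounded X"
  then obtain C where "\<And>N. hs X N \<le> C" by (auto simp: hs_bounded_def)
  then have "hs X N \<le> \<bar>C\<bar> * sqrt (harm N)" for N
    by (rule le_sqrt_harm) (simp add: hs_def L2_set_def)
  then show ?thesis by (auto simp: hs_log_def)
qed

lemma hs_log_sum:
  "(\<And>a. a \<in> S \<Longrightarrow> hs_log (X a)) \<Longrightarrow> hs_log (\<Sum>a\<in>S. X a)"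
  by (induction S rule: infinite_finite_induct) (auto intro: hs_log_add hs_bounded_imp_log)

lemma hs_equiv_refl [simp, intro]: "X \<doteq> X"
  by (simp add: hs_equiv_def)

lemma hs_equiv_sym: "X \<doteq> Y \<Longrightarrow> Y \<doteq> X"
  unfolding hs_equiv_def using hs_bounded_minus[of "X - Y"] by simp

lemma hs_equiv_trans [trans]: "X \<doteq> Y \<Longrightarrow> Y \<doteq> Z \<Longrightarrow> X \<doteq> Z"
  unfolding hs_equiv_def using hs_bounded_add[of "X - Y" "Y - Z"] by simp

lemma hs_equiv_add: "X \<doteq> X' \<Longrightarrow> Y \<doteq> Y' \<Longrightarrow> X + Y \<doteq> X' + Y'"
  unfolding hs_equiv_def using hs_bounded_add[of "X - X'" "Y - Y'"] by (simp add: algebra_simps)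

lemma hs_equiv_diff: "X \<doteq> X' \<Longrightarrow> Y \<doteq> Y' \<Longrightarrow> X - Y \<doteq> X' - Y'"
  unfolding hs_equiv_def using hs_bounded_diff[of "X - X'" "Y - Y'"] by (simp add: algebra_simps)

lemma hs_equiv_mult_left: "op_bounded Z \<Longrightarrow> X \<doteq> Y \<Longrightarrow> Z * X \<doteq> Z * Y"
  unfolding hs_equiv_def by (metis hs_bounded_op_left right_diff_distrib)

lemma hs_equiv_mult_right: "op_bounded Z \<Longrightarrow> X \<doteq> Y \<Longrightarrow> X * Z \<doteq> Y * Z"
  unfolding hs_equiv_def by (metis hs_bounded_op_right left_diff_distrib)

lemma hs_equiv_hs_log: "X \<doteq> Y \<Longrightarrow> hs_log Y \<Longrightarrow> hs_log X"
  unfolding hs_equiv_def using hs_log_add[of "X - Y" Y] by (simp add: hs_bounded_imp_log)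

lemma hs_equiv_sum:
  "(\<And>a. a \<in> S \<Longrightarrow> X a \<doteq> Y a) \<Longrightarrow> (\<Sum>a\<in>S. X a) \<doteq> (\<Sum>a\<in>S. Y a)"
  unfolding hs_equiv_def sum_subtractf[symmetric] by (rule hs_bounded_sum)

lemma negligible_seq_add:
  "negligible_seq a \<Longrightarrow> negligible_seq b \<Longrightarrow> negligible_seq (\<lambda>N. a N + b N)"
proof -
  assume "negligible_seq a" "negligible_seq b"
  then obtain C D where *: "\<And>N. cmod (a N) \<le> C * sqrt (harm N)" "\<And>N. cmod (b N) \<le> D * sqrt (harm N)"
    by (auto simp: negligible_seq_def)
  have "cmod (a N + b N) \<le> (C + D) * sqrt (harm N)" for N
    using norm_triangle_ineq[of "a N" "b N"] *[of N] by (simp add: distrib_right)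
  then show ?thesis unfolding negligible_seq_def by blast
qed

lemma negligible_seq_cmult: "negligible_seq a \<Longrightarrow> negligible_seq (\<lambda>N. c * a N)"
proof -
  assume "negligible_seq a"
  then obtain C where *: "\<And>N. cmod (a N) \<le> C * sqrt (harm N)"
    by (auto simp: negligible_seq_def)
  have "cmod (c * a N) \<le> (cmod c * C) * sqrt (harm N)" for N
    using mult_left_mono[OF *[of N], of "cmod c"] by (simp add: norm_mult mult.assoc)
  then show ?thesis unfolding negligible_seq_def by blast
qed

lemma negligible_seq_diff:
  "negligible_seq a \<Longrightarrow> negligible_seq b \<Longrightarrow> negligible_seq (\<lambda>N. a N - b N)"
  using negligible_seq_add[of a "\<lambda>N. -1 * b N"] negligible_seq_cmult[of b "-1"] by simp

lemma negligible_seq_sum: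
  "(\<And>a. a \<in> S \<Longrightarrow> negligible_seq (X a)) \<Longrightarrow> negligible_seq (\<lambda>N. \<Sum>a\<in>S. X a N)"
proof (induction S rule: infinite_finite_induct)
  case (insert a S)
  then show ?case using negligible_seq_add[of "X a" "\<lambda>N. \<Sum>a\<in>S. X a N"] by simp
qed (auto simp: negligible_seq_def intro!: exI[of _ 0])

lemma negligible_seqI:
  assumes "\<And>N. cmod (a N) \<le> C" "a 0 = 0"
  shows "negligible_seq a"
  unfolding negligible_seq_def using le_sqrt_harm[of "\<lambda>N. cmod (a N)" C] assms by auto

text \<open>Cauchy--Schwarz for the Hilbert--Schmidt inner product is what turns bounded errors into
  negligible traces.\<close>

lemma negligible_tr_mult:
  assumes "hs_bounded X" "hs_log Y"
  shows "negligible_seq (tr (X * Y))"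
proof -
  obtain C D where C: "\<And>N. hs X N \<le> C" and D: "\<And>N. hs Y N \<le> D * sqrt (harm N)"
    using assms by (auto simp: hs_bounded_def hs_log_def)
  have "cmod (tr (X * Y) N) \<le> (C * D) * sqrt (harm N)" for N
  proof -
    have "cmod (tr (X * Y) N) \<le> hs X N * hs Y N" by (rule tr_le_hs)
    also have "\<dots> \<le> C * (D * sqrt (harm N))"
      using C[of N] D[of N] by (intro mult_mono) (auto intro: order.trans[OF hs_nonneg])
    finally show ?thesis by (simp add: mult.assoc)
  qed
  then show ?thesis unfolding negligible_seq_def by blast
qed

lemma negligible_tr_mult': "hs_log X \<Longrightarrow> hs_bounded Y \<Longrightarrow> negligible_seq (tr (X * Y))"
  using negligible_tr_mult[of Y X] by (metis (no_types, lifting) ext tr_commute)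

lemma negligible_tr_equiv:
  "X \<doteq> Y \<Longrightarrow> hs_log Z \<Longrightarrow> negligible_seq (\<lambda>N. tr (X * Z) N - tr (Y * Z) N)"
  unfolding hs_equiv_def using negligible_tr_mult[of "X - Y" Z]
  by (simp add: left_diff_distrib tr_diff[abs_def])

text \<open>Equality of sequences of traces up to the precision that is kept throughout.\<close>

definition seq_equiv :: "(nat \<Rightarrow> complex) \<Rightarrow> (nat \<Rightarrow> complex) \<Rightarrow> bool"  (infix "\<triangleq>" 50)
  where "a \<triangleq> b \<longleftrightarrow> negligible_seq (\<lambda>N. a N - b N)"

lemma negligible_seq_zero [simp]: "negligible_seq (\<lambda>_. 0)"
  by (auto simp: negligible_seq_def intro!: exI[of _ 0])

lemma seq_equiv_refl [simp, intro]: "a \<triangleq> a"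
  by (simp add: seq_equiv_def)

lemma seq_equiv_trans [trans]: "a \<triangleq> b \<Longrightarrow> b \<triangleq> c \<Longrightarrow> a \<triangleq> c"
  unfolding seq_equiv_def using negligible_seq_add[of "\<lambda>N. a N - b N" "\<lambda>N. b N - c N"] by simp

lemma seq_equiv_sym: "a \<triangleq> b \<Longrightarrow> b \<triangleq> a"
  unfolding seq_equiv_def using negligible_seq_cmult[of "\<lambda>N. a N - b N" "-1"] by simp

lemma seq_equiv_add: "a \<triangleq> a' \<Longrightarrow> b \<triangleq> b' \<Longrightarrow> (\<lambda>N. a N + b N) \<triangleq> (\<lambda>N. a' N + b' N)"
  unfolding seq_equiv_def using negligible_seq_add[of "\<lambda>N. a N - a' N" "\<lambda>N. b N - b' N"]
  by (simp add: algebra_simps)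

lemma seq_equiv_diff: "a \<triangleq> a' \<Longrightarrow> b \<triangleq> b' \<Longrightarrow> (\<lambda>N. a N - b N) \<triangleq> (\<lambda>N. a' N - b' N)"
  unfolding seq_equiv_def using negligible_seq_diff[of "\<lambda>N. a N - a' N" "\<lambda>N. b N - b' N"]
  by (simp add: algebra_simps)

lemma seq_equiv_cmult: "a \<triangleq> b \<Longrightarrow> (\<lambda>N. c * a N) \<triangleq> (\<lambda>N. c * b N)"
  unfolding seq_equiv_def using negligible_seq_cmult[of "\<lambda>N. a N - b N" c]
  by (simp add: algebra_simps)

lemma seq_equiv_sum:
  "(\<And>a. a \<in> S \<Longrightarrow> X a \<triangleq> Y a) \<Longrightarrow> (\<lambda>N. \<Sum>a\<in>S. X a N) \<triangleq> (\<lambda>N. \<Sum>a\<in>S. Y a N)"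
  unfolding seq_equiv_def sum_subtractf[symmetric] by (rule negligible_seq_sum)

lemma tr_equiv_left: "X \<doteq> Y \<Longrightarrow> hs_log Z \<Longrightarrow> tr (X * Z) \<triangleq> tr (Y * Z)"
  unfolding seq_equiv_def by (rule negligible_tr_equiv)

lemma tr_equiv_right: "X \<doteq> Y \<Longrightarrow> hs_log Z \<Longrightarrow> tr (Z * X) \<triangleq> tr (Z * Y)"
  using tr_equiv_left[of X Y Z] by (simp add: tr_commute[abs_def, of Z])

lemma hs_equiv_transp: "X \<doteq> Y \<Longrightarrow> mtransp X \<doteq> mtransp Y"
  unfolding hs_equiv_def transp_diff[symmetric] by (simp add: hs_bounded_transp)

lemma hs_equiv_minus: "- X \<doteq> - Y \<Longrightarrow> X \<doteq> Y"
  unfolding hs_equiv_def using hs_bounded_minus[of "X - Y"] by simp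

lemma hs_boundedI:
  assumes "\<And>N i j. i < N \<Longrightarrow> j < N \<Longrightarrow> (cmod (entry X N i j))\<^sup>2 \<le> f N i j"
    and "\<And>N. 0 < N \<Longrightarrow> (\<Sum>i<N. \<Sum>j<N. f N i j) \<le> C"
  shows "hs_bounded X"
proof -
  have "hs X N \<le> sqrt \<bar>C\<bar>" for N
  proof (cases "N = 0")
    case False
    have "(hs X N)\<^sup>2 \<le> (\<Sum>i<N. \<Sum>j<N. f N i j)"
      unfolding hs_sq by (intro sum_mono assms(1)) auto
    also have "\<dots> \<le> C" using False by (intro assms(2)) auto
    finally have "(hs X N)\<^sup>2 \<le> \<bar>C\<bar>" by linarith
    then show ?thesis by (rule real_le_rsqrt)
  qed (simp add: hs_def L2_set_def)
  then show ?thesis unfolding hs_bounded_def by blast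
qed

lemma hs_equiv_zero_op: "hs_bounded X \<Longrightarrow> X \<doteq> 0"
  by (simp add: hs_equiv_def)

lemma op_le_entry:
  assumes "op_le X C"
  shows "cmod (entry X N i j) \<le> C"
proof (cases "i < N \<and> j < N")
  case True
  define e where "e = (\<lambda>a b::nat. if b = a then 1 else 0 :: complex)"
  have e: "vnorm N (e a) = 1" if "a < N" for a
  proof -
    have "(vnorm N (e a))\<^sup>2 = (\<Sum>b<N. if b = a then 1 else 0)"
      unfolding vnorm_sq by (intro sum.cong) (auto simp: e_def)
    then have "(vnorm N (e a))\<^sup>2 = 1" using that by simp
    then show ?thesis using vnorm_nonneg[of N "e a"] by (simp add: power2_eq_1_iff)
  qed
  have "(\<Sum>a<N. \<Sum>b<N. e i a * entry X N a b * e j b) = (\<Sum>a<N. if a = i then entry X N i j else 0)"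
  proof (intro sum.cong refl)
    fix a assume "a \<in> {..<N}"
    have "(\<Sum>b<N. e i a * entry X N a b * e j b) = (\<Sum>b<N. if b = j then e i a * entry X N a j else 0)"
      by (intro sum.cong) (auto simp: e_def)
    then show "(\<Sum>b<N. e i a * entry X N a b * e j b) = (if a = i then entry X N i j else 0)"
      using True by (simp add: e_def)
  qed
  then show ?thesis
    using op_leD[OF assms, where N = N and u = "e i" and v = "e j"] True e by simp
qed (use op_le_nonneg[OF assms] in auto)

definition scal :: "complex \<Rightarrow> mseq"
  where "scal c = diag_seq (\<lambda>_ _. c)"

lemma entry_scal_mult [simp]: "entry (scal c * X) N i j = c * entry X N i j"
  by (simp add: scal_def)

lemma scal_commute: "scal c * X = X * scal c"
  by (rule mseq_eqI) (simp add: scal_def)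

lemma op_bounded_scal [simp]: "op_bounded (scal c)"
  unfolding scal_def by (rule op_bounded_diag[where C = "cmod c"]) simp

lemma tr_scal: "tr (scal c * X) N = c * tr X N"
  by (simp add: tr_def sum_distrib_left)

lemma scal_mult: "scal c * scal d = scal (c * d)"
  by (simp add: scal_def diag_seq_mult)

section \<open>Bounded symbols\<close>

lemma bounded_measurable_integrable:
  fixes F :: "real \<Rightarrow> 'a::euclidean_space"
  assumes "F \<in> borel_measurable borel" "\<And>t. t \<in> {a..b} \<Longrightarrow> norm (F t) \<le> M"
  shows "F integrable_on {a..b}"
proof -
  have "F absolutely_integrable_on {a..b}"
  proof (rule measurable_bounded_by_integrable_imp_absolutely_integrable)
    show "F \<in> borel_measurable (lebesgue_on {a..b})"
      using assms(1) by (simp add: measurable_completion measurable_restrict_space1)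
    show "(\<lambda>_. M) integrable_on {a..b}" by (rule integrable_const_ivl)
  qed (use assms(2) in auto)
  then show ?thesis by (rule absolutely_integrable_on_def[THEN iffD1, THEN conjunct1])
qed

lemma integral_cis:
  "((\<lambda>t. cis (real_of_int k * t)) has_integral (if k = 0 then 2 * pi else 0)) {0..2 * pi}"
proof (cases "k = 0")
  case True
  have "((\<lambda>_. 1::complex) has_integral (2 * pi - 0) *\<^sub>R 1) {0..2 * pi}"
    using has_integral_const_real[of "1::complex" 0 "2 * pi"] by simp
  then show ?thesis using True by (simp add: scaleR_conv_of_real)
next
  case False
  have "((\<lambda>t. cis (real_of_int k * t)) has_integral
      cis (real_of_int k * (2 * pi)) / (\<i> * k) - cis (real_of_int k * 0) / (\<i> * k)) {0..2 * pi}"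
  proof (rule fundamental_theorem_of_calculus)
    fix t :: real
    show "((\<lambda>t. cis (real_of_int k * t) / (\<i> * k)) has_vector_derivative cis (real_of_int k * t))
        (at t within {0..2 * pi})"
      unfolding has_vector_derivative_def using False
      by (auto intro!: derivative_eq_intros simp: fun_eq_iff scaleR_conv_of_real field_simps)
  qed simp
  moreover have "cis (real_of_int k * (2 * pi)) = 1"
    using cis_multiple_2pi[of "real_of_int k"] by (simp add: mult.commute)
  ultimately show ?thesis using False by simp
qed

text \<open>Exponential sums with arbitrary distinct frequencies, because Hankel and Toeplitz matrices pair
  them with different signs.\<close>

definition trig_poly :: "(nat \<Rightarrow> int) \<Rightarrow> nat \<Rightarrow> (nat \<Rightarrow> complex) \<Rightarrow> real \<Rightarrow> complex"
  where "trig_poly p N u t = (\<Sum>i<N. u i * cis (real_of_int (p i) * t))"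

lemma continuous_trig_poly: "continuous_on S (trig_poly p N u)"
  unfolding trig_poly_def[abs_def] by (intro continuous_intros)

lemma measurable_cis [measurable]: "cis \<in> borel_measurable borel"
  by (intro borel_measurable_continuous_onI continuous_intros)

lemma trig_poly_parseval:
  assumes "inj p"
  shows "((\<lambda>t. (cmod (trig_poly p N u t))\<^sup>2) has_integral 2 * pi * (vnorm N u)\<^sup>2) {0..2 * pi}"
proof -
  have "((\<lambda>t. \<Sum>i<N. \<Sum>j<N. (u i * cnj (u j)) * cis (real_of_int (p i - p j) * t)) has_integral
      (\<Sum>i<N. \<Sum>j<N. (u i * cnj (u j)) * of_real (if p i - p j = 0 then 2 * pi else 0))) {0..2 * pi}"
    by (intro has_integral_sum has_integral_mult_right integral_cis finite_lessThan)
  moreover have "(\<Sum>i<N. \<Sum>j<N. (u i * cnj (u j)) * of_real (if p i - p j = 0 then 2 * pi else 0))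
      = of_real (2 * pi * (vnorm N u)\<^sup>2)"
  proof -
    have "(\<Sum>j<N. (u i * cnj (u j)) * of_real (if p i - p j = 0 then 2 * pi else 0))
        = of_real (2 * pi * (cmod (u i))\<^sup>2)" if "i < N" for i
    proof -
      have "(\<Sum>j<N. (u i * cnj (u j)) * of_real (if p i - p j = 0 then 2 * pi else 0))
          = (\<Sum>j<N. if i = j then u i * cnj (u i) * of_real (2 * pi) else 0)"
        using assms by (intro sum.cong) (auto simp: inj_eq)
      also have "\<dots> = u i * cnj (u i) * of_real (2 * pi)" using that by simp
      finally show ?thesis by (simp add: complex_norm_square[symmetric] mult.commute)
    qed
    then show ?thesis by (simp add: vnorm_sq sum_distrib_left)
  qed
  moreover have "(\<Sum>i<N. \<Sum>j<N. (u i * cnj (u j)) * cis (real_of_int (p i - p j) * t))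
      = of_real ((cmod (trig_poly p N u t))\<^sup>2)" for t
    unfolding complex_norm_square trig_poly_def cnj_sum sum_product
    by (intro sum.cong refl) (simp add: cis_cnj cis_mult left_diff_distrib)
  ultimately have "((\<lambda>t. complex_of_real ((cmod (trig_poly p N u t))\<^sup>2)) has_integral
      of_real (2 * pi * (vnorm N u)\<^sup>2)) {0..2 * pi}"
    by simp
  from has_integral_linear[OF this bounded_linear_Re] show ?thesis
    by (simp add: o_def)
qed

text \<open>Compressions of the operator of multiplication by a function \<open>F\<close> between two systems of
  exponentials: Hankel and Toeplitz matrices are the cases \<open>q = p\<close> and \<open>q = - p\<close>.\<close>

lemma op_le_symbol:
  assumes F: "F \<in> borel_measurable borel" "\<And>t. t \<in> {0..2 * pi} \<Longrightarrow> cmod (F t) \<le> M"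
    and pq: "inj p" "inj q"
    and X: "\<And>N i j. i < N \<Longrightarrow> j < N \<Longrightarrow> entry X N i j = 1 / (2 * pi) *
      integral {0..2 * pi} (\<lambda>t. F t * cis (real_of_int (p i) * t) * cis (real_of_int (q j) * t))"
  shows "op_le X M"
proof (rule op_leI)
  show "0 \<le> M" using F(2)[of 0] by (auto intro: order.trans[OF norm_ge_zero])
  fix N and u v :: "nat \<Rightarrow> complex"
  define B where "B = (\<lambda>u v. \<Sum>i<N. \<Sum>j<N. u i * entry X N i j * v j)"
  have F_int: "(\<lambda>t. F t * cis (real_of_int k * t) * cis (real_of_int l * t)) integrable_on {0..2 * pi}" for k l
    using F by (intro bounded_measurable_integrable[where M = M]) (auto simp: norm_mult)
  have expand: "(\<Sum>i<N. \<Sum>j<N. (u i * v j) * (F t * cis (real_of_int (p i) * t) * cis (real_of_int (q j) * t)))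
      = F t * trig_poly p N u t * trig_poly q N v t" for u v t
  proof -
    have "trig_poly p N u t * trig_poly q N v t
        = (\<Sum>i<N. \<Sum>j<N. (u i * cis (real_of_int (p i) * t)) * (v j * cis (real_of_int (q j) * t)))"
      unfolding trig_poly_def by (rule sum_product)
    then show ?thesis
      unfolding mult.assoc[of "F t"] by (simp only: sum_distrib_left) (intro sum.cong refl, simp add: mult_ac)
  qed
  have B: "B u v = 1 / (2 * pi) * integral {0..2 * pi} (\<lambda>t. F t * trig_poly p N u t * trig_poly q N v t)"
    for u v
  proof -
    have "((\<lambda>t. \<Sum>i<N. \<Sum>j<N. (u i * v j) * (F t * cis (real_of_int (p i) * t) * cis (real_of_int (q j) * t)))
        has_integral (\<Sum>i<N. \<Sum>j<N. (u i * v j) *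
          integral {0..2 * pi} (\<lambda>t. F t * cis (real_of_int (p i) * t) * cis (real_of_int (q j) * t))))
        {0..2 * pi}"
      by (intro has_integral_sum has_integral_mult_right integrable_integral F_int finite_lessThan)
    moreover note expand
    ultimately have "integral {0..2 * pi} (\<lambda>t. F t * trig_poly p N u t * trig_poly q N v t) =
        (\<Sum>i<N. \<Sum>j<N. (u i * v j) *
          integral {0..2 * pi} (\<lambda>t. F t * cis (real_of_int (p i) * t) * cis (real_of_int (q j) * t)))"
      by (simp add: integral_unique)
    then show ?thesis
      unfolding B_def by (simp add: X sum_distrib_left mult_ac)
  qed
  \<comment> \<open>The arithmetic-geometric mean replaces Cauchy--Schwarz for integrals; homogeneity in \<open>u\<close> and \<open>v\<close>
    then restores the product of the norms.\<close>
  have quad: "cmod (B u v) \<le> M / 2 * ((vnorm N u)\<^sup>2 + (vnorm N v)\<^sup>2)" for u v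
  proof -
    have le: "cmod (F t * trig_poly p N u t * trig_poly q N v t)
        \<le> M / 2 * ((cmod (trig_poly p N u t))\<^sup>2 + (cmod (trig_poly q N v t))\<^sup>2)"
      if "t \<in> {0..2 * pi}" for t
    proof -
      have "cmod (F t) * (cmod (trig_poly p N u t) * cmod (trig_poly q N v t))
          \<le> M * (((cmod (trig_poly p N u t))\<^sup>2 + (cmod (trig_poly q N v t))\<^sup>2) / 2)"
        using F(2)[OF that] \<open>0 \<le> M\<close> sum_squares_bound[of "cmod (trig_poly p N u t)" "cmod (trig_poly q N v t)"]
        by (intro mult_mono) auto
      then show ?thesis by (simp add: norm_mult mult.assoc)
    qed
    have I: "((\<lambda>t. M / 2 * ((cmod (trig_poly p N u t))\<^sup>2 + (cmod (trig_poly q N v t))\<^sup>2)) has_integral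
        M / 2 * (2 * pi * (vnorm N u)\<^sup>2 + 2 * pi * (vnorm N v)\<^sup>2)) {0..2 * pi}"
      by (intro has_integral_mult_right has_integral_add trig_poly_parseval pq)
    have "cmod (integral {0..2 * pi} (\<lambda>t. F t * trig_poly p N u t * trig_poly q N v t))
        \<le> integral {0..2 * pi} (\<lambda>t. M / 2 * ((cmod (trig_poly p N u t))\<^sup>2 + (cmod (trig_poly q N v t))\<^sup>2))"
    proof (rule integral_norm_bound_integral[OF _ has_integral_integrable[OF I] le])
      have "(\<lambda>t. \<Sum>i<N. \<Sum>j<N. (u i * v j) * (F t * cis (real_of_int (p i) * t) * cis (real_of_int (q j) * t)))
          integrable_on {0..2 * pi}"
        by (intro integrable_sum integrable_on_mult_right F_int finite_lessThan)
      moreover note expand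
      ultimately show "(\<lambda>t. F t * trig_poly p N u t * trig_poly q N v t) integrable_on {0..2 * pi}"
        by simp
    qed
    then show ?thesis
      unfolding B integral_unique[OF I] by (simp add: norm_mult norm_divide field_simps)
  qed
  have zero: "w i = 0" if "vnorm N w = 0" "i < N" for w i
  proof -
    have "(\<Sum>i<N. (cmod (w i))\<^sup>2) = 0" using that(1) by (simp add: vnorm_sq[symmetric])
    then show ?thesis using that(2) by (simp add: sum_nonneg_eq_0_iff)
  qed
  show "cmod (\<Sum>i<N. \<Sum>j<N. u i * entry X N i j * v j) \<le> M * vnorm N u * vnorm N v"
  proof (cases "vnorm N u = 0 \<or> vnorm N v = 0")
    case True
    then have "u i * entry X N i j * v j = 0" if "i < N" "j < N" for i j
      using zero[of u i] zero[of v j] that by auto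
    then have "(\<Sum>i<N. \<Sum>j<N. u i * entry X N i j * v j) = 0" by (auto intro!: sum.neutral)
    then show ?thesis using \<open>0 \<le> M\<close> by simp
  next
    case False
    define a b where "a = vnorm N u" and "b = vnorm N v"
    have ab: "a > 0" "b > 0" using False vnorm_nonneg[of N u] vnorm_nonneg[of N v] unfolding a_def b_def by linarith+
    have norms: "(vnorm N (\<lambda>i. of_real b * u i))\<^sup>2 = b\<^sup>2 * a\<^sup>2" "(vnorm N (\<lambda>i. of_real a * v i))\<^sup>2 = a\<^sup>2 * b\<^sup>2"
      unfolding a_def b_def vnorm_sq[of _ u] vnorm_sq[of _ v]
      by (simp_all add: vnorm_sq norm_mult power_mult_distrib sum_distrib_left)
    have "B (\<lambda>i. of_real b * u i) (\<lambda>i. of_real a * v i) = of_real (a * b) * B u v"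
      unfolding B_def sum_distrib_left by (intro sum.cong refl) (simp add: mult_ac)
    then have "(a * b) * cmod (B u v) \<le> (a * b) * (M * a * b)"
      using quad[of "\<lambda>i. of_real b * u i" "\<lambda>i. of_real a * v i"] ab
      unfolding norms by (simp add: norm_mult power2_eq_square field_simps)
    then have "cmod (B u v) \<le> M * a * b" using ab by simp
    then show ?thesis by (simp add: B_def a_def b_def)
  qed
qed

text \<open>The sawtooth, whose Fourier coefficients \<open>1 / k\<close> are those of both the Hilbert matrix and the
  discrete Hilbert transform.\<close>

lemma sawtooth_coeff:
  "((\<lambda>t. \<i> * of_real (pi - t) * cis (- (real_of_int k * t))) has_integral
     (if k = 0 then 0 else 2 * pi / k)) {0..2 * pi}"
proof (cases "k = 0")
  case True
  have "((\<lambda>t. \<i> * of_real (pi - t)) has_integral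
      (\<i> * of_real (pi * (2 * pi) - (2 * pi)\<^sup>2 / 2) - \<i> * of_real (pi * 0 - 0\<^sup>2 / 2))) {0..2 * pi}"
    by (rule fundamental_theorem_of_calculus)
      (auto intro!: derivative_eq_intros simp: has_vector_derivative_def fun_eq_iff scaleR_conv_of_real field_simps)
  then show ?thesis using True by (simp add: power2_eq_square)
next
  case False
  define G where "G = (\<lambda>t::real. - (of_real (pi - t) * cis (- (real_of_int k * t)) / k) - \<i> * cis (- (real_of_int k * t)) / (of_int k)\<^sup>2)"
  have "((\<lambda>t. \<i> * of_real (pi - t) * cis (- (real_of_int k * t))) has_integral (G (2 * pi) - G 0)) {0..2 * pi}"
  proof (rule fundamental_theorem_of_calculus)
    fix t :: real
    have "(G has_vector_derivative (- ((- 1) * cis (- (real_of_int k * t)) / k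
          + of_real (pi - t) * (- (\<i> * of_int k * cis (- (real_of_int k * t)))) / k)
        - \<i> * (- (\<i> * of_int k * cis (- (real_of_int k * t)))) / (of_int k)\<^sup>2)) (at t within {0..2 * pi})"
      unfolding has_vector_derivative_def G_def using False
      by (auto intro!: derivative_eq_intros simp: fun_eq_iff scaleR_conv_of_real divide_simps)
        (simp add: algebra_simps power2_eq_square)
    moreover have "- ((- 1) * cis (- (real_of_int k * t)) / k
          + of_real (pi - t) * (- (\<i> * of_int k * cis (- (real_of_int k * t)))) / k)
        - \<i> * (- (\<i> * of_int k * cis (- (real_of_int k * t)))) / (of_int k)\<^sup>2
        = \<i> * of_real (pi - t) * cis (- (real_of_int k * t))"
      using False by (simp add: divide_simps power2_eq_square)
    ultimately show "(G has_vector_derivative \<i> * of_real (pi - t) * cis (- (real_of_int k * t)))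
        (at t within {0..2 * pi})"
      by simp
  qed simp
  moreover have "cis (- (real_of_int k * (2 * pi))) = 1"
    using cis_multiple_2pi[of "- real_of_int k"] by (simp add: mult.commute)
  ultimately show ?thesis using False by (simp add: G_def field_simps)
qed

text \<open>The norm bound \<open>\<pi>\<close> is the supremum of the sawtooth: for \<open>1 / (i + j + 1)\<close> this is Hilbert's
  inequality.\<close>

lemma op_le_sawtooth:
  assumes pq: "inj p" "inj q"
    and X: "\<And>N i j. i < N \<Longrightarrow> j < N \<Longrightarrow>
      entry X N i j = (if p i + q j = 0 then 0 else 1 / of_int (p i + q j))"
  shows "op_le X pi"
proof (rule op_le_symbol[where F = "\<lambda>t. \<i> * of_real (pi - t)" and p = "\<lambda>i. - p i" and q = "\<lambda>i. - q i"])
  show "inj (\<lambda>i. - p i)" "inj (\<lambda>i. - q i)" using pq by (auto simp: inj_def)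
  fix N i j :: nat
  assume "i < N" "j < N"
  have "(\<lambda>t. \<i> * of_real (pi - t) * cis (real_of_int (- p i) * t) * cis (real_of_int (- q j) * t))
      = (\<lambda>t. \<i> * of_real (pi - t) * cis (- (real_of_int (p i + q j) * t)))"
    by (simp add: fun_eq_iff cis_mult mult.assoc algebra_simps)
  then have "integral {0..2 * pi} (\<lambda>t. \<i> * of_real (pi - t) * cis (real_of_int (- p i) * t) * cis (real_of_int (- q j) * t))
      = (if p i + q j = 0 then 0 else 2 * pi / of_int (p i + q j))"
    using integral_unique[OF sawtooth_coeff[of "p i + q j"]] by simp
  then show "entry X N i j = complex_of_real (1 / (2 * pi)) * integral {0..2 * pi}
      (\<lambda>t. \<i> * of_real (pi - t) * cis (real_of_int (- p i) * t) * cis (real_of_int (- q j) * t))"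
    using X[OF \<open>i < N\<close> \<open>j < N\<close>] by simp
qed (auto simp: norm_mult simp del: of_real_diff)

section \<open>The Hilbert matrix and the discrete Hilbert transform\<close>

definition hilb :: mseq
  where "hilb = mat_seq (\<lambda>N i j. of_real (1 / (real i + real j + 1)))"

text \<open>The diagonal value \<open>1 / 0 = 0\<close> is the mean of the sawtooth whose Fourier coefficients are the
  other entries.\<close>

definition dht :: mseq
  where "dht = mat_seq (\<lambda>N i j. of_real (1 / (real i - real j)))"

definition flip :: mseq
  where "flip = mat_seq (\<lambda>N i j. if i + j + 1 = N then 1 else 0)"

definition diag_comm :: "(nat \<Rightarrow> nat \<Rightarrow> real) \<Rightarrow> mseq \<Rightarrow> mseq"
  where "diag_comm d X = diag_seq (\<lambda>N i. of_real (d N i)) * X - X * diag_seq (\<lambda>N i. of_real (d N i))"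

text \<open>Harmonic numbers instead of logarithms make the commutator with the logarithm of the position
  exactly computable on rational kernels.\<close>

definition log_comm :: "mseq \<Rightarrow> mseq"
  where "log_comm = diag_comm (\<lambda>N i. harm i)"

lemma entry_hilb [simp]:
  "entry hilb N i j = (if i < N \<and> j < N then of_real (1 / (real i + real j + 1)) else 0)"
  by (simp add: hilb_def)

lemma entry_dht [simp]:
  "entry dht N i j = (if i < N \<and> j < N then of_real (1 / (real i - real j)) else 0)"
  by (simp add: dht_def)

lemma entry_diag_comm [simp]:
  "entry (diag_comm d X) N i j = of_real (d N i - d N j) * entry X N i j"
  by (simp add: diag_comm_def algebra_simps)

lemma entry_diag_comm_dht:
  "i < N \<Longrightarrow> j < N \<Longrightarrow> entry (diag_comm d dht) N i j = of_real ((d N i - d N j) / (real i - real j))"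
  by simp

lemma entry_flip_mult [simp]:
  assumes "i < N"
  shows "entry (flip * X) N i j = entry X N (N - 1 - i) j"
proof -
  have "entry (flip * X) N i j = (\<Sum>t<N. if t = N - 1 - i then entry X N t j else 0)"
    unfolding entry_mult flip_def using assms by (intro sum.cong) auto
  then show ?thesis using assms by simp
qed

lemma entry_mult_flip [simp]:
  assumes "j < N"
  shows "entry (X * flip) N i j = entry X N i (N - 1 - j)"
proof -
  have "entry (X * flip) N i j = (\<Sum>t<N. if t = N - 1 - j then entry X N i t else 0)"
    unfolding entry_mult flip_def using assms by (intro sum.cong) auto
  then show ?thesis using assms by simp
qed

lemma transp_hilb [simp]: "mtransp hilb = hilb"
  by (rule mseq_eqI) (simp add: add.commute)

lemma transp_dht [simp]: "mtransp dht = - dht"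
proof (rule mseq_eqI)
  fix N i j :: nat
  have "1 / (real j - real i) = - (1 / (real i - real j))"
    by (metis minus_diff_eq minus_divide_right)
  then show "entry (mtransp dht) N i j = entry (- dht) N i j"
    by (cases "i < N \<and> j < N") (auto simp del: of_real_divide simp flip: of_real_minus)
qed

lemma op_le_hilb: "op_le hilb pi"
  by (rule op_le_sawtooth[where p = "\<lambda>i. int i + 1" and q = int]) (auto simp: inj_def algebra_simps)

lemma op_le_dht: "op_le dht pi"
  by (rule op_le_sawtooth[where p = int and q = "\<lambda>i. - int i"]) (auto simp: inj_def)

lemma op_le_flip: "op_le flip 1"
proof (rule op_leI)
  fix N u v
  have "(\<Sum>i<N. \<Sum>j<N. u i * entry flip N i j * v j) = (\<Sum>i<N. u i * v (N - 1 - i))"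
  proof (rule sum.cong)
    fix i assume i: "i \<in> {..<N}"
    have "(\<Sum>j<N. u i * entry flip N i j * v j) = (\<Sum>j<N. if j = N - 1 - i then u i * v j else 0)"
      unfolding flip_def using i by (intro sum.cong) auto
    then show "(\<Sum>j<N. u i * entry flip N i j * v j) = u i * v (N - 1 - i)" using i by simp
  qed simp
  also have "cmod \<dots> \<le> (\<Sum>i<N. \<bar>cmod (u i)\<bar> * \<bar>cmod (v (N - 1 - i))\<bar>)"
    by (rule sum_norm_le) (simp add: norm_mult)
  also have "\<dots> \<le> vnorm N u * L2_set (\<lambda>i. cmod (v (N - 1 - i))) {..<N}"
    unfolding vnorm_def by (rule L2_set_mult_ineq)
  also have "L2_set (\<lambda>i. cmod (v (N - 1 - i))) {..<N} = vnorm N v"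
    unfolding vnorm_def L2_set_def using sum.nat_diff_reindex[of "\<lambda>i. (cmod (v i))\<^sup>2" N] by simp
  finally show "cmod (\<Sum>i<N. \<Sum>j<N. u i * entry flip N i j * v j) \<le> 1 * vnorm N u * vnorm N v" by simp
qed simp

lemma op_bounded_hilb [simp]: "op_bounded hilb"
  and op_bounded_dht [simp]: "op_bounded dht"
  and op_bounded_flip [simp]: "op_bounded flip"
  unfolding op_bounded_def using op_le_hilb op_le_dht op_le_flip by blast+

lemma sum_inverse_squares_le:
  "(\<Sum>j<N. 1 / (real i + real j + 1)\<^sup>2) \<le> 1 / (real i + 1/2)"
proof -
  have "(\<Sum>j<N. 1 / (real i + real j + 1)\<^sup>2) \<le> 1 / (real i + 1/2) - 1 / (real i + real N + 1/2)"
  proof (induction N)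
    case (Suc N)
    define x where "x = real i + real N + 1"
    have "x \<ge> 1" by (simp add: x_def)
    have "(x - 1/2) * (x + 1/2) \<le> x * x" by (simp add: algebra_simps)
    moreover have "(x - 1/2) * (x + 1/2) > 0" using \<open>x \<ge> 1\<close> by simp
    ultimately have "1 / (x * x) \<le> 1 / ((x - 1/2) * (x + 1/2))" by (intro divide_left_mono) auto
    also have "\<dots> = 1 / (x - 1/2) - 1 / (x + 1/2)" using \<open>x \<ge> 1\<close> by (simp add: field_simps)
    finally show ?case using Suc by (simp add: x_def power2_eq_square algebra_simps)
  qed simp
  also have "\<dots> \<le> 1 / (real i + 1/2)" by simp
  finally show ?thesis .
qed

lemma sum_inverse_squares_le': "(\<Sum>j<N. 1 / (real i + real j + 1)\<^sup>2) \<le> 2 / (real i + 1)"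
proof -
  have "1 / (real i + 1/2) \<le> 2 / (real i + 1)" by (simp add: field_simps)
  then show ?thesis using sum_inverse_squares_le[of i N] by linarith
qed

lemma sum_inverse_squares_le_2: "(\<Sum>j<N. 1 / (real j + 1)\<^sup>2) \<le> 2"
  using sum_inverse_squares_le'[of 0 N] by simp

lemma sum_inverse_squares_rev_le_2: "(\<Sum>j<N. 1 / (real N - real j)\<^sup>2) \<le> 2"
proof -
  have "(\<Sum>j<N. 1 / (real N - real j)\<^sup>2) = (\<Sum>j<N. 1 / (real (N - Suc j) + 1)\<^sup>2)"
    by (intro sum.cong) (auto simp: of_nat_diff algebra_simps)
  also have "\<dots> = (\<Sum>j<N. 1 / (real j + 1)\<^sup>2)"
    by (rule sum.nat_diff_reindex[of "\<lambda>j. 1 / (real j + 1)\<^sup>2"])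
  finally show ?thesis using sum_inverse_squares_le_2 by simp
qed

lemma sum_inverse_shift: "(\<Sum>t<N. 1 / (real i + real t + 1)) = harm (i + N) - harm i"
  by (induction N) (simp_all add: harm_Suc inverse_eq_divide algebra_simps)

lemma harm_eq_sum: "harm N = (\<Sum>t<N. 1 / (real t + 1))"
  using sum_inverse_shift[of 0 N] by (simp add: harm_def)

lemma harm_diff_le:
  assumes "m \<le> n"
  shows "harm n - harm m \<le> (real n - real m) / (real m + 1)"
proof -
  have "harm n - harm m = (\<Sum>t<n - m. 1 / (real m + real t + 1))"
    using sum_inverse_shift[where i = m and N = "n - m"] assms by simp
  also have "\<dots> \<le> (\<Sum>t<n - m. 1 / (real m + 1))" by (intro sum_mono divide_left_mono) auto
  finally show ?thesis using assms by (simp add: of_nat_diff)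
qed

lemma sum_inverse_diff:
  assumes "j < N"
  shows "(\<Sum>t<N. 1 / (real t - real j)) = harm (N - 1 - j) - harm j"
proof -
  have split: "{..<N} = {..<j} \<union> {j..<N}" using assms by auto
  have "(\<Sum>t<N. 1 / (real t - real j)) = (\<Sum>t<j. 1 / (real t - real j)) + (\<Sum>t=j..<N. 1 / (real t - real j))"
    unfolding split by (rule sum.union_disjoint) auto
  also have "(\<Sum>t<j. 1 / (real t - real j)) = (\<Sum>t<j. - (1 / (real (j - Suc t) + 1)))"
  proof (intro sum.cong refl)
    fix t assume "t \<in> {..<j}"
    then have "real (j - Suc t) + 1 = real j - real t" by auto
    then show "1 / (real t - real j) = - (1 / (real (j - Suc t) + 1))"
      by (metis minus_diff_eq minus_divide_right)
  qed
  also have "\<dots> = - harm j"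
    using sum.nat_diff_reindex[of "\<lambda>t. 1 / (real t + 1)" j] by (simp add: sum_negf harm_eq_sum)
  also have "(\<Sum>t=j..<N. 1 / (real t - real j)) = (\<Sum>t<N - j. 1 / real t)"
    by (rule sum.reindex_bij_witness[of _ "\<lambda>t. t + j" "\<lambda>t. t - j"]) (auto simp: of_nat_diff)
  also have "\<dots> = (\<Sum>t<Suc (N - 1 - j). 1 / real t)" using assms by (intro sum.cong) auto
  also have "\<dots> = harm (N - 1 - j)"
    by (simp only: sum.lessThan_Suc_shift harm_eq_sum) (simp add: add.commute)
  finally show ?thesis by simp
qed

lemma hs_log_hilb [simp]: "hs_log hilb"
proof -
  have "hs hilb N \<le> sqrt 2 * sqrt (harm N)" for N
  proof -
    have "(hs hilb N)\<^sup>2 = (\<Sum>i<N. \<Sum>j<N. (1 / (real i + real j + 1))\<^sup>2)"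
      unfolding hs_sq by (intro sum.cong refl) (simp del: of_real_divide of_real_add)
    also have "\<dots> \<le> (\<Sum>i<N. 2 / (real i + 1))"
      by (intro sum_mono) (use sum_inverse_squares_le' in \<open>simp add: power_divide\<close>)
    also have "\<dots> = 2 * harm N" by (simp add: harm_eq_sum sum_distrib_left)
    finally show ?thesis unfolding real_sqrt_mult[symmetric] by (rule real_le_rsqrt)
  qed
  then show ?thesis unfolding hs_log_def by blast
qed

text \<open>The kernels \<open>1 / (x + y)\<close> and \<open>1 / (x - y)\<close> are tied together by partial fractions. The exact
  formulas contain boundary terms at the far end \<open>N\<close>, which distinguish the truncated matrices from
  the operators on the half-line.\<close>

lemma hilb_square_sum:
  "(real i - real j) * (\<Sum>t<N. 1 / ((real i + real t + 1) * (real j + real t + 1)))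
    = harm i - harm j + harm (j + N) - harm (i + N)"
proof -
  have "(real i - real j) * (\<Sum>t<N. 1 / ((real i + real t + 1) * (real j + real t + 1)))
      = (\<Sum>t<N. 1 / (real j + real t + 1) - 1 / (real i + real t + 1))"
    unfolding sum_distrib_left by (intro sum.cong refl) (simp add: divide_simps)
  then show ?thesis by (simp add: sum_subtractf sum_inverse_shift)
qed

lemma entry_hilb_square:
  assumes "i < N" "j < N"
  shows "entry (hilb * hilb) N i j
    = of_real (\<Sum>t<N. 1 / ((real i + real t + 1) * (real j + real t + 1)))"
proof -
  have "entry (hilb * hilb) N i j
      = (\<Sum>t<N. of_real (1 / ((real i + real t + 1) * (real j + real t + 1))))"
    unfolding entry_mult using assms by (intro sum.cong refl) (simp add: add.commute)
  then show ?thesis by (simp only: of_real_sum)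
qed

lemma harm_shift_diff_le:
  assumes "0 < N"
  shows "\<bar>(harm (i + N) - harm (j + N)) / (real i - real j)\<bar> \<le> 1 / real N"
proof -
  have *: "(harm (i + N) - harm (j + N)) / (real i - real j) \<le> 1 / real N" if "j < i" for i j
  proof -
    have "harm (i + N) - harm (j + N) \<le> (real i - real j) / (real (j + N) + 1)"
      using harm_diff_le[of "j + N" "i + N"] that by simp
    also have "\<dots> \<le> (real i - real j) / real N" using assms that by (intro divide_left_mono) auto
    finally show ?thesis using that by (simp add: field_simps)
  qed
  have pos: "0 \<le> (harm (i + N) - harm (j + N)) / (real i - real j)" if "j < i" for i j
    using that harm_mono[of "j + N" "i + N", where 'a = real] by simp
  consider "i = j" | "j < i" | "i < j" by linarith
  then show ?thesis
  proof cases
    case 2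
    then show ?thesis using *[of j i] pos[of j i] by (simp only: abs_of_nonneg)
  next
    case 3
    have "(harm (i + N) - harm (j + N)) / (real i - real j) = (harm (j + N) - harm (i + N)) / (real j - real i)"
      by (metis minus_diff_eq minus_divide_divide)
    then show ?thesis using *[of i j] pos[of i j] 3 by simp
  qed simp
qed

lemma hs_bounded_shift_comm: "hs_bounded (diag_comm (\<lambda>N i. harm (i + N)) dht)"
proof (rule hs_boundedI[where f = "\<lambda>N i j. (1 / real N)\<^sup>2" and C = 1])
  fix N i j :: nat
  assume ij: "i < N" "j < N"
  then have "cmod (entry (diag_comm (\<lambda>N i. harm (i + N)) dht) N i j)
      = \<bar>(harm (i + N) - harm (j + N)) / (real i - real j)\<bar>"
    by (simp add: norm_divide norm_mult flip: of_real_diff)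
  also have "\<dots> \<le> 1 / real N" using ij by (intro harm_shift_diff_le) auto
  finally show "(cmod (entry (diag_comm (\<lambda>N i. harm (i + N)) dht) N i j))\<^sup>2 \<le> (1 / real N)\<^sup>2"
    by (rule power_mono) simp
qed (simp add: power2_eq_square)

text \<open>The counterpart of \<open>tanh' = sech\<^sup>2\<close>. Off the diagonal, both sides are explicit differences of harmonic
  numbers; the far end contributes entries of size \<open>1 / N\<close>, and the diagonal entries of \<open>hilb * hilb\<close> are
  square summable.\<close>

lemma log_comm_dht: "log_comm dht \<doteq> hilb * hilb"
proof -
  define X where "X = log_comm dht - hilb * hilb - diag_comm (\<lambda>N i. harm (i + N)) dht"
  have "hs_bounded X"
  proof (rule hs_boundedI[where f = "\<lambda>N i j. if i = j then 4 * (1 / (real i + 1)\<^sup>2) else 0" and C = 8])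
    fix N i j :: nat
    assume ij: "i < N" "j < N"
    show "(cmod (entry X N i j))\<^sup>2 \<le> (if i = j then 4 * (1 / (real i + 1)\<^sup>2) else 0)"
    proof (cases "i = j")
      case True
      have "entry X N i j = - of_real (\<Sum>t<N. 1 / (real i + real t + 1)\<^sup>2)"
        using True ij by (simp add: X_def log_comm_def entry_hilb_square power2_eq_square del: of_real_sum)
      then have "cmod (entry X N i j) = (\<Sum>t<N. 1 / (real i + real t + 1)\<^sup>2)"
        by (simp add: sum_nonneg del: of_real_sum)
      then have "(cmod (entry X N i j))\<^sup>2 \<le> (2 / (real i + 1))\<^sup>2"
        using sum_inverse_squares_le'[of i N] by (intro power_mono) (auto simp: sum_nonneg)
      then show ?thesis using True by (simp add: power_divide)
    next
      case False
      have "(\<Sum>t<N. 1 / ((real i + real t + 1) * (real j + real t + 1)))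
          = (harm i - harm j + harm (j + N) - harm (i + N)) / (real i - real j)"
        using hilb_square_sum[of i j N] False by (simp add: field_simps)
      then have "entry (hilb * hilb) N i j = of_real ((harm i - harm j + harm (j + N) - harm (i + N)) / (real i - real j))"
        using ij by (simp only: entry_hilb_square)
      then have "entry X N i j = of_real ((harm i - harm j) / (real i - real j)
          - (harm i - harm j + harm (j + N) - harm (i + N)) / (real i - real j)
          - (harm (i + N) - harm (j + N)) / (real i - real j))"
        using ij by (simp only: X_def log_comm_def entry_diff entry_diag_comm_dht of_real_diff)
      also have "\<dots> = 0" by (simp add: add_divide_distrib diff_divide_distrib)
      finally have "entry X N i j = 0" .
      then show ?thesis using False by simp
    qed
  next
    fix N :: nat
    have "(\<Sum>i<N. \<Sum>j<N. if i = j then 4 * (1 / (real i + 1)\<^sup>2) else 0) = 4 * (\<Sum>i<N. 1 / (real i + 1)\<^sup>2)"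
      by (simp add: sum_distrib_left)
    then show "(\<Sum>i<N. \<Sum>j<N. if i = j then 4 * (1 / (real i + 1)\<^sup>2) else 0) \<le> 8"
      using sum_inverse_squares_le_2[of N] by simp
  qed
  then have "hs_bounded (X + diag_comm (\<lambda>N i. harm (i + N)) dht)"
    by (intro hs_bounded_add hs_bounded_shift_comm)
  then show ?thesis by (simp add: X_def hs_equiv_def)
qed

text \<open>The contribution of the far end to \<open>hilb * dht\<close>. Written as a difference of products with diagonal
  matrices, it can also be handled under the trace.\<close>

definition edge :: mseq
  where "edge = hilb * diag_seq (\<lambda>N i. of_real (harm (N - 1 - i))) - diag_seq (\<lambda>N i. of_real (harm (i + N))) * hilb"

definition hilb_sq_entries :: mseq
  where "hilb_sq_entries = mat_seq (\<lambda>N i j. of_real (1 / (real i + real j + 1)\<^sup>2))"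

text \<open>The counterpart of \<open>sech' = - sech tanh\<close>, exactly.\<close>

lemma hilb_dht: "hilb * dht = log_comm hilb + edge + hilb_sq_entries"
proof (rule mseq_eqI)
  fix N i j :: nat
  assume ij: "i < N" "j < N"
  define s where "s = (\<Sum>t<N. 1 / ((real i + real t + 1) * (real t - real j)))"
  have "(real i + real j + 1) * s = (\<Sum>t<N. 1 / (real t - real j) - 1 / (real i + real t + 1)
      + (if t = j then 1 / (real i + real j + 1) else 0))"
    unfolding s_def sum_distrib_left
  proof (intro sum.cong refl)
    fix t
    have nz: "real i + real t + 1 \<noteq> 0" by linarith
    show "(real i + real j + 1) * (1 / ((real i + real t + 1) * (real t - real j)))
        = 1 / (real t - real j) - 1 / (real i + real t + 1) + (if t = j then 1 / (real i + real j + 1) else 0)"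
      using nz by (cases "t = j") (simp_all add: divide_simps)
  qed
  also have "\<dots> = harm (N - 1 - j) - harm j - (harm (i + N) - harm i) + 1 / (real i + real j + 1)"
    using ij by (simp add: sum.distrib sum_subtractf sum_inverse_shift sum_inverse_diff)
  finally have s: "s = (harm (N - 1 - j) - harm j - (harm (i + N) - harm i) + 1 / (real i + real j + 1))
      / (real i + real j + 1)"
    by (subst eq_divide_eq) (simp add: mult.commute)
  have "entry (hilb * dht) N i j = (\<Sum>t<N. of_real (1 / ((real i + real t + 1) * (real t - real j))))"
    unfolding entry_mult using ij by (intro sum.cong refl) simp
  also have "\<dots> = of_real s" unfolding s_def by (simp only: of_real_sum)
  also have "\<dots> = entry (log_comm hilb + edge + hilb_sq_entries) N i j"
    unfolding s using ij
    by (simp add: log_comm_def edge_def hilb_sq_entries_def add_divide_distrib diff_divide_distrib power2_eq_square)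

  finally show "entry (hilb * dht) N i j = entry (log_comm hilb + edge + hilb_sq_entries) N i j" .
qed

lemma hs_bounded_hilb_sq_entries: "hs_bounded hilb_sq_entries"
proof (rule hs_boundedI[where f = "\<lambda>N i j. (1 / (real i + 1)\<^sup>2) * (1 / (real i + real j + 1)\<^sup>2)" and C = 4])
  fix N i j :: nat
  assume ij: "i < N" "j < N"
  have "(real i + 1)\<^sup>2 \<le> (real i + real j + 1)\<^sup>2" by (intro power_mono) auto
  then have "1 / (real i + real j + 1)\<^sup>2 \<le> 1 / (real i + 1)\<^sup>2" by (intro divide_left_mono) auto
  then have "1 / (real i + real j + 1)\<^sup>2 * (1 / (real i + real j + 1)\<^sup>2)
      \<le> 1 / (real i + 1)\<^sup>2 * (1 / (real i + real j + 1)\<^sup>2)" by (intro mult_right_mono) auto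
  then show "(cmod (entry hilb_sq_entries N i j))\<^sup>2
      \<le> (1 / (real i + 1)\<^sup>2) * (1 / (real i + real j + 1)\<^sup>2)"
    using ij by (simp add: hilb_sq_entries_def power2_eq_square[of "_ / _"] del: of_real_divide)
next
  fix N :: nat
  have "(\<Sum>i<N. \<Sum>j<N. (1 / (real i + 1)\<^sup>2) * (1 / (real i + real j + 1)\<^sup>2))
      \<le> (\<Sum>i<N. (1 / (real i + 1)\<^sup>2) * 2)"
    unfolding sum_distrib_left[symmetric]
  proof (intro sum_mono mult_left_mono)
    fix i :: nat
    have "2 / (real i + 1) \<le> 2 / 1" by (intro divide_left_mono) auto
    then show "(\<Sum>j<N. 1 / (real i + real j + 1)\<^sup>2) \<le> 2" using sum_inverse_squares_le'[of i N] by simp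
  qed auto
  then show "(\<Sum>i<N. \<Sum>j<N. (1 / (real i + 1)\<^sup>2) * (1 / (real i + real j + 1)\<^sup>2)) \<le> 4"
    unfolding sum_distrib_right[symmetric] using sum_inverse_squares_le_2[of N] by linarith
qed

text \<open>The numerator of the entry is the sum of \<open>1 / l\<close> over \<open>N - j \<le> l \<le> N + i\<close>. The part beyond \<open>N\<close>
  contributes at most \<open>1 / N\<close>; the other part, divided by \<open>j + 1\<close>, is again recognised as an entry
  of a product of Hilbert kernels, so that the norm bound of the Hilbert matrix applies to it.\<close>

lemma edge_entry_le:
  assumes "i < N" "j < N"
  shows "cmod (entry edge N i j) \<le> 2 / real N
    + (\<Sum>t<N. 1 / (real (N - 1 - j) + real t + 1) * (1 / (real N + real t + 1)))"
proof -
  define m where "m = N - 1 - j"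
  have m: "m < N" "real N - real m = real j + 1" using assms by (auto simp: m_def of_nat_diff)
  define q where "q = (\<Sum>t<N. 1 / ((real N + real t + 1) * (real m + real t + 1)))"
  have "entry edge N i j = of_real ((harm m - harm (i + N)) / (real i + real j + 1))"
    using assms by (simp add: edge_def m_def diff_divide_distrib)
  then have "cmod (entry edge N i j) = \<bar>harm m - harm (i + N)\<bar> / (real i + real j + 1)"
    by (simp del: of_real_divide)
  also have "\<dots> = (harm (i + N) - harm m) / (real i + real j + 1)"
    using harm_mono[of m "i + N", where 'a = real] m(1) by simp
  also have "\<dots> = (harm (i + N) - harm N) / (real i + real j + 1) + (harm N - harm m) / (real i + real j + 1)"
    by (simp add: add_divide_distrib diff_divide_distrib)
  also have "\<dots> \<le> 1 / real N + (harm N - harm m) / (real j + 1)"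
  proof (rule add_mono)
    have "harm (i + N) - harm N \<le> real i / (real N + 1)" using harm_diff_le[of N "i + N"] by simp
    also have "\<dots> \<le> (real i + real j + 1) / real N" using assms by (intro frac_le) auto
    finally show "(harm (i + N) - harm N) / (real i + real j + 1) \<le> 1 / real N"
      by (simp add: field_simps)
    show "(harm N - harm m) / (real i + real j + 1) \<le> (harm N - harm m) / (real j + 1)"
      using m harm_mono[of m N, where 'a = real] by (intro divide_left_mono) auto
  qed
  also have "(harm N - harm m) / (real j + 1) = q + (harm (N + N) - harm (m + N)) / (real N - real m)"
  proof -
    have "(real j + 1) * q = harm N - harm m + harm (m + N) - harm (N + N)"
      using hilb_square_sum[of N m N] by (simp add: q_def m(2))
    then have "q = (harm N - harm m + harm (m + N) - harm (N + N)) / (real j + 1)"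
      by (simp add: field_simps)
    then show ?thesis by (simp add: m(2) add_divide_distrib diff_divide_distrib)
  qed
  also have "(harm (N + N) - harm (m + N)) / (real N - real m) \<le> 1 / real N"
    using assms by (intro abs_le_D1[OF harm_shift_diff_le]) auto
  finally show ?thesis by (simp add: q_def m_def mult.commute)
qed

lemma hs_bounded_edge: "hs_bounded edge"
proof (rule hs_boundedI)
  define r where "r = (\<lambda>(N::nat) m. \<Sum>t<N. 1 / (real m + real t + 1) * (1 / (real N + real t + 1)))"
  fix N i j :: nat
  assume ij: "i < N" "j < N"
  have "(cmod (entry edge N i j))\<^sup>2 \<le> (2 / real N + r N (N - Suc j))\<^sup>2"
    using edge_entry_le[OF ij] by (intro power_mono) (auto simp: r_def)
  also have "\<dots> \<le> 2 * ((2 / real N)\<^sup>2 + (r N (N - Suc j))\<^sup>2)"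
    using sum_squares_bound[of "2 / real N" "r N (N - Suc j)"] by (simp add: power2_sum)
  finally show "(cmod (entry edge N i j))\<^sup>2 \<le> 2 * ((2 / real N)\<^sup>2
      + (\<Sum>t<N. 1 / (real (N - Suc j) + real t + 1) * (1 / (real N + real t + 1)))\<^sup>2)"
    by (simp add: r_def)
next
  fix N :: nat
  assume N: "0 < N"
  define r where "r = (\<lambda>m. \<Sum>t<N. 1 / (real m + real t + 1) * (1 / (real N + real t + 1)))"
  define w where "w = (\<lambda>t. complex_of_real (1 / (real N + real t + 1)))"
  have "(\<Sum>j<N. (r (N - Suc j))\<^sup>2) = (\<Sum>m<N. (r m)\<^sup>2)"
    by (rule sum.nat_diff_reindex[of "\<lambda>m. (r m)\<^sup>2"])
  \<comment> \<open>The bound comes from the boundedness of the Hilbert matrix, applied to the vector \<open>w\<close>.\<close>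
  also have "\<dots> = (vnorm N (\<lambda>m. \<Sum>t<N. entry hilb N m t * w t))\<^sup>2"
    unfolding vnorm_sq
  proof (intro sum.cong refl)
    fix m assume "m \<in> {..<N}"
    then have "(\<Sum>t<N. entry hilb N m t * w t) = (\<Sum>t<N. of_real (1 / (real m + real t + 1) * (1 / (real N + real t + 1))))"
      by (intro sum.cong refl) (simp add: w_def)
    also have "\<dots> = of_real (r m)" unfolding r_def by (simp only: of_real_sum)
    finally show "(r m)\<^sup>2 = (cmod (\<Sum>t<N. entry hilb N m t * w t))\<^sup>2" by simp
  qed
  also have "\<dots> \<le> (pi * vnorm N w)\<^sup>2"
    by (intro power_mono op_le_apply op_le_hilb vnorm_nonneg)
  also have "\<dots> = pi\<^sup>2 * (\<Sum>t<N. 1 / (real N + real t + 1)\<^sup>2)"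
    unfolding power_mult_distrib vnorm_sq w_def norm_of_real by (simp add: power_divide)
  also have "\<dots> \<le> pi\<^sup>2 * (2 / (real N + 1))"
    by (intro mult_left_mono sum_inverse_squares_le') simp
  also have "\<dots> \<le> pi\<^sup>2 * (2 / real N)"
    using N by (intro mult_left_mono divide_left_mono) auto
  finally have r: "(\<Sum>j<N. (r (N - Suc j))\<^sup>2) \<le> pi\<^sup>2 * (2 / real N)" .
  have "(\<Sum>j<N. (2 / real N)\<^sup>2 + (r (N - Suc j))\<^sup>2) = 4 / real N + (\<Sum>j<N. (r (N - Suc j))\<^sup>2)"
    using N by (simp add: sum.distrib power2_eq_square)
  also have "\<dots> \<le> 4 / real N + pi\<^sup>2 * (2 / real N)" using r by simp
  also have "\<dots> = (4 + 2 * pi\<^sup>2) / real N" by (simp add: add_divide_distrib mult.commute)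
  finally have "(\<Sum>j<N. (2 / real N)\<^sup>2 + (r (N - Suc j))\<^sup>2) \<le> (4 + 2 * pi\<^sup>2) / real N" .
  then have "real N * (2 * (\<Sum>j<N. (2 / real N)\<^sup>2 + (r (N - Suc j))\<^sup>2)) \<le> real N * (2 * ((4 + 2 * pi\<^sup>2) / real N))"
    by (intro mult_left_mono) auto
  also have "\<dots> = 2 * (4 + 2 * pi\<^sup>2)" using N by simp
  finally show "(\<Sum>i<N. \<Sum>j<N. 2 * ((2 / real N)\<^sup>2
      + (\<Sum>t<N. 1 / (real (N - Suc j) + real t + 1) * (1 / (real N + real t + 1)))\<^sup>2)) \<le> 2 * (4 + 2 * pi\<^sup>2)"
    unfolding r_def by (simp add: sum_distrib_left)
qed

lemma hilb_dht_equiv: "hilb * dht \<doteq> log_comm hilb"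
  unfolding hs_equiv_def hilb_dht
  using hs_bounded_add[OF hs_bounded_edge hs_bounded_hilb_sq_entries] by simp

lemma transp_diag_comm: "mtransp (diag_comm d X) = - diag_comm d (mtransp X)"
  by (rule mseq_eqI) (simp add: algebra_simps)

lemma dht_hilb_equiv: "dht * hilb \<doteq> log_comm hilb"
proof (rule hs_equiv_minus)
  show "- (dht * hilb) \<doteq> - log_comm hilb"
    using hs_equiv_transp[OF hilb_dht_equiv] by (simp add: transp_mult log_comm_def transp_diag_comm)
qed

definition inv_sq :: mseq
  where "inv_sq = mat_seq (\<lambda>N i j. of_real
    (if i = j then \<Sum>t<N. 1 / (real i - real t)\<^sup>2 else 2 / (real i - real j)\<^sup>2))"

text \<open>The singularity of the two factors produces the convolution \<open>inv_sq\<close>; of the two logarithmic terms,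
  one belongs to the near end and its mirror image to the far end.\<close>

lemma dht_square: "dht * dht = log_comm dht + flip * log_comm dht * flip - inv_sq"
proof (rule mseq_eqI)
  fix N i j :: nat
  assume ij: "i < N" "j < N"
  define s where "s = (\<Sum>t<N. 1 / ((real i - real t) * (real t - real j)))"
  have s: "entry (dht * dht) N i j = of_real s"
  proof -
    have "entry (dht * dht) N i j = (\<Sum>t<N. of_real (1 / ((real i - real t) * (real t - real j))))"
      unfolding entry_mult using ij by (intro sum.cong refl) simp
    then show ?thesis unfolding s_def by (simp only: of_real_sum)
  qed
  have c: "entry (log_comm dht) N i j = of_real ((harm i - harm j) / (real i - real j))"
    using ij by (simp add: log_comm_def)
  have "real (N - 1 - i) - real (N - 1 - j) = real j - real i" using ij by (simp add: of_nat_diff)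
  then have f: "entry (flip * log_comm dht * flip) N i j
      = of_real ((harm (N - 1 - i) - harm (N - 1 - j)) / (real j - real i))"
    using ij unfolding log_comm_def
    by (simp only: mult.assoc entry_flip_mult entry_mult_flip)
      (subst entry_diag_comm_dht, simp_all)
  show "entry (dht * dht) N i j = entry (log_comm dht + flip * log_comm dht * flip - inv_sq) N i j"
  proof (cases "i = j")
    case True
    have "s = - (\<Sum>t<N. 1 / (real i - real t)\<^sup>2)"
      unfolding s_def True sum_negf[symmetric]
    proof (intro sum.cong refl)
      fix t
      have "(real j - real t) * (real t - real j) = - ((real j - real t)\<^sup>2)"
        by (simp add: power2_eq_square algebra_simps)
      then show "1 / ((real j - real t) * (real t - real j)) = - (1 / (real j - real t)\<^sup>2)"
        by (simp only: divide_minus_right)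
    qed
    then show ?thesis using ij True unfolding entry_add entry_diff c f s by (simp add: inv_sq_def)
  next
    case False
    have "(real i - real j) * s = (\<Sum>t<N. 1 / (real t - real j) - 1 / (real t - real i)
        - (if t = i then 1 / (real i - real j) else 0) - (if t = j then 1 / (real i - real j) else 0))"
      unfolding s_def sum_distrib_left
    proof (intro sum.cong refl)
      fix t
      show "(real i - real j) * (1 / ((real i - real t) * (real t - real j)))
        = 1 / (real t - real j) - 1 / (real t - real i)
          - (if t = i then 1 / (real i - real j) else 0) - (if t = j then 1 / (real i - real j) else 0)"
        using False by (cases "t = i"; cases "t = j") (simp_all add: divide_simps, simp_all add: algebra_simps)
    qed
    also have "\<dots> = (harm (N - 1 - j) - harm j) - (harm (N - 1 - i) - harm i) - 2 / (real i - real j)"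
      using ij by (simp add: sum.distrib sum_subtractf sum_inverse_diff)
    finally have "s = ((harm (N - 1 - j) - harm j) - (harm (N - 1 - i) - harm i) - 2 / (real i - real j))
        / (real i - real j)"
      using False by (simp add: eq_divide_eq mult.commute)
    also have "\<dots> = (harm i - harm j) / (real i - real j)
        + (harm (N - 1 - i) - harm (N - 1 - j)) / (real j - real i) - 2 / (real i - real j)\<^sup>2"
    proof -
      have "(harm (N - 1 - i) - harm (N - 1 - j)) / (real j - real i)
          = (harm (N - 1 - j) - harm (N - 1 - i)) / (real i - real j)"
        by (metis minus_diff_eq minus_divide_divide)
      then show ?thesis by (simp only:) (simp add: add_divide_distrib diff_divide_distrib power2_eq_square)
    qed
    finally have s': "s = (harm i - harm j) / (real i - real j)
        + (harm (N - 1 - i) - harm (N - 1 - j)) / (real j - real i) - 2 / (real i - real j)\<^sup>2" .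
    have "entry inv_sq N i j = of_real (2 / (real i - real j)\<^sup>2)" using ij False by (simp add: inv_sq_def)
    then show ?thesis unfolding entry_add entry_diff c f s s' by (simp only: of_real_add of_real_diff)
  qed
qed

text \<open>The two ends of the matrix do not interact: \<open>flip\<close> exchanges them, and sandwiching it between
  Hilbert matrices gives a kernel without a singularity at either end, of size \<open>1 / N\<close> up to logarithms.\<close>

lemma hs_bounded_hilb_flip_hilb: "hs_bounded (hilb * flip * hilb)"
proof (rule hs_boundedI)
  define a where "a = (\<lambda>(N::nat) i. \<Sum>t<N. 1 / (real i + real t + 1))"
  fix N i m :: nat
  assume im: "i < N" "m < N"
  define s where "s = (\<Sum>t<N. 1 / ((real i + real t + 1) * (real (N - Suc t) + real m + 1)))"
  have "entry (hilb * flip * hilb) N i m = (\<Sum>t<N. of_real (1 / ((real i + real t + 1) * (real (N - Suc t) + real m + 1))))"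
    unfolding mult.assoc entry_mult[of hilb] using im by (intro sum.cong refl) simp
  also have "\<dots> = of_real s" unfolding s_def by (simp only: of_real_sum)
  finally have e: "cmod (entry (hilb * flip * hilb) N i m) = \<bar>s\<bar>" by (simp only: norm_of_real)
  have "(real i + real m + real N + 1) * s = (\<Sum>t<N. 1 / (real i + real t + 1) + 1 / (real m + real (N - Suc t) + 1))"
    unfolding s_def sum_distrib_left
    by (intro sum.cong refl) (auto simp: divide_simps of_nat_diff, simp_all add: algebra_simps)
  also have "\<dots> = a N i + a N m"
    unfolding sum.distrib using sum.nat_diff_reindex[of "\<lambda>t. 1 / (real m + real t + 1)" N] by (simp add: a_def)
  finally have sum: "(real i + real m + real N + 1) * s = a N i + a N m" .
  have "s \<ge> 0" unfolding s_def by (intro sum_nonneg divide_nonneg_nonneg mult_nonneg_nonneg) auto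
  then have "real N * s \<le> (real i + real m + real N + 1) * s"
    by (intro mult_right_mono) auto
  then have "real N * s \<le> a N i + a N m" using sum by linarith
  then have "s \<le> (a N i + a N m) / real N" using im by (simp add: field_simps)
  then have "s\<^sup>2 \<le> ((a N i + a N m) / real N)\<^sup>2" using \<open>s \<ge> 0\<close> by (intro power_mono) auto
  also have "\<dots> \<le> 2 * ((a N i)\<^sup>2 + (a N m)\<^sup>2) / (real N)\<^sup>2"
    unfolding power_divide using sum_squares_bound[of "a N i" "a N m"]
    by (intro divide_right_mono) (auto simp: power2_sum)
  finally show "(cmod (entry (hilb * flip * hilb) N i m))\<^sup>2 \<le>
      2 * ((\<Sum>t<N. 1 / (real i + real t + 1))\<^sup>2 + (\<Sum>t<N. 1 / (real m + real t + 1))\<^sup>2) / (real N)\<^sup>2"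
    by (simp only: e a_def power2_abs)
next
  fix N :: nat
  assume N: "0 < N"
  define a where "a = (\<lambda>i. \<Sum>t<N. 1 / (real i + real t + 1))"
  have "(\<Sum>i<N. (a i)\<^sup>2) = (vnorm N (\<lambda>i. \<Sum>t<N. entry hilb N i t * 1))\<^sup>2"
    unfolding vnorm_sq
  proof (intro sum.cong refl)
    fix i assume "i \<in> {..<N}"
    then have "(\<Sum>t<N. entry hilb N i t * 1) = (\<Sum>t<N. of_real (1 / (real i + real t + 1)))"
      by (intro sum.cong refl) simp
    also have "\<dots> = of_real (a i)" unfolding a_def by (simp only: of_real_sum)
    finally show "(a i)\<^sup>2 = (cmod (\<Sum>t<N. entry hilb N i t * 1))\<^sup>2" by simp
  qed
  also have "\<dots> \<le> (pi * vnorm N (\<lambda>_. 1))\<^sup>2"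
    by (intro power_mono op_le_apply op_le_hilb vnorm_nonneg)
  also have "\<dots> = pi\<^sup>2 * real N" by (simp add: power_mult_distrib vnorm_sq)
  finally have *: "(\<Sum>i<N. (a i)\<^sup>2) \<le> pi\<^sup>2 * real N" .
  have "(\<Sum>i<N. \<Sum>m<N. 2 * ((a i)\<^sup>2 + (a m)\<^sup>2) / (real N)\<^sup>2) = 4 * real N * (\<Sum>i<N. (a i)\<^sup>2) / (real N)\<^sup>2"
    by (simp add: sum.distrib sum_divide_distrib[symmetric] sum_distrib_left[symmetric] distrib_left)
  also have "\<dots> \<le> 4 * real N * (pi\<^sup>2 * real N) / (real N)\<^sup>2"
    using * by (intro divide_right_mono mult_left_mono) auto
  also have "\<dots> = 4 * pi\<^sup>2" using N by (simp add: power2_eq_square)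
  finally show "(\<Sum>i<N. \<Sum>m<N. 2 * ((\<Sum>t<N. 1 / (real i + real t + 1))\<^sup>2
      + (\<Sum>t<N. 1 / (real m + real t + 1))\<^sup>2) / (real N)\<^sup>2) \<le> 4 * pi\<^sup>2"
    by (simp add: a_def)
qed

lemma sum_inverse_squares_diff:
  assumes "i < N"
  shows "(\<Sum>t<N. 1 / (real i - real t)\<^sup>2)
    = (\<Sum>s<i. 1 / (real s + 1)\<^sup>2) + (\<Sum>s<N - 1 - i. 1 / (real s + 1)\<^sup>2)"
proof -
  have split: "{..<N} = {..<i} \<union> {i..<N}" using assms by auto
  have "(\<Sum>t<N. 1 / (real i - real t)\<^sup>2) = (\<Sum>t<i. 1 / (real i - real t)\<^sup>2) + (\<Sum>t=i..<N. 1 / (real i - real t)\<^sup>2)"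
    unfolding split by (rule sum.union_disjoint) auto
  also have "(\<Sum>t<i. 1 / (real i - real t)\<^sup>2) = (\<Sum>t<i. 1 / (real (i - Suc t) + 1)\<^sup>2)"
    by (intro sum.cong) (auto simp: of_nat_diff algebra_simps)
  also have "\<dots> = (\<Sum>s<i. 1 / (real s + 1)\<^sup>2)"
    by (rule sum.nat_diff_reindex[of "\<lambda>t. 1 / (real t + 1)\<^sup>2"])
  also have "(\<Sum>t=i..<N. 1 / (real i - real t)\<^sup>2) = (\<Sum>t<N - i. 1 / (real t)\<^sup>2)"
    by (rule sum.reindex_bij_witness[of _ "\<lambda>t. t + i" "\<lambda>t. t - i"])
      (auto simp: of_nat_diff power2_commute)
  also have "\<dots> = (\<Sum>t<Suc (N - 1 - i). 1 / (real t)\<^sup>2)" using assms by (intro sum.cong) auto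
  also have "\<dots> = (\<Sum>s<N - 1 - i. 1 / (real s + 1)\<^sup>2)"
    by (simp only: sum.lessThan_Suc_shift) (simp add: add.commute)
  finally show ?thesis .
qed

text \<open>The rows of \<open>inv_sq\<close> are truncations of a series for \<open>\<zeta>(2)\<close>; the defect decays away from both ends.\<close>

lemma zeta2_tail:
  "(\<Sum>s<n. 1 / (real s + 1)\<^sup>2) \<le> pi\<^sup>2 / 6"
  "pi\<^sup>2 / 6 - (\<Sum>s<n. 1 / (real s + 1)\<^sup>2) \<le> 2 / (real n + 1)"
proof -
  have sums: "(\<lambda>s. 1 / (real s + 1)\<^sup>2) sums (pi\<^sup>2 / 6)"
    using inverse_squares_sums by (simp add: add.commute)
  then show "(\<Sum>s<n. 1 / (real s + 1)\<^sup>2) \<le> pi\<^sup>2 / 6"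
    by (metis (no_types, lifting) sum_le_suminf sums_summable sums_unique finite_lessThan
        divide_nonneg_nonneg zero_le_one zero_le_power2)
  have "pi\<^sup>2 / 6 \<le> (\<Sum>s<n. 1 / (real s + 1)\<^sup>2) + 2 / (real n + 1)"
  proof (rule LIMSEQ_le_const2[OF sums[unfolded sums_def]], intro exI allI impI)
    fix M assume "n \<le> M"
    then obtain k where M: "M = n + k" using le_Suc_ex by blast
    have "(\<Sum>s<n + k. 1 / (real s + 1)\<^sup>2)
        = (\<Sum>s<n. 1 / (real s + 1)\<^sup>2) + (\<Sum>s<k. 1 / (real n + real s + 1)\<^sup>2)"
      by (induction k) (simp_all add: algebra_simps)
    then show "(\<Sum>s<M. 1 / (real s + 1)\<^sup>2) \<le> (\<Sum>s<n. 1 / (real s + 1)\<^sup>2) + 2 / (real n + 1)"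
      using sum_inverse_squares_le'[of n k] by (simp add: M)
  qed
  then show "pi\<^sup>2 / 6 - (\<Sum>s<n. 1 / (real s + 1)\<^sup>2) \<le> 2 / (real n + 1)" by simp
qed

text \<open>On the slowly varying kernel \<open>1 / (x + y)\<close> the convolution with \<open>inv_sq\<close> acts as multiplication by
  its total mass \<open>6 \<zeta>(2) = \<pi>\<^sup>2\<close>, of which the diagonal carries one third. The three error terms come
  from the two truncations of the mass and from the variation of the kernel.\<close>

lemma inv_sq_hilb_entry:
  assumes "i < N" "m < N"
  shows "cmod (entry (inv_sq * hilb - scal (of_real (pi\<^sup>2)) * hilb) N i m)
    \<le> 6 / (real i + real m + 1) * (1 / (real i + 1) + 1 / (real N - real i) + 1 / sqrt (real m + 1))"
proof -
  define h where "h = (\<lambda>i. 1 / (real i + real m + 1))"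
  define \<kappa> where "\<kappa> = (\<Sum>t<N. 1 / (real i - real t)\<^sup>2)"
  define D where "D = (\<Sum>t<N. 2 * (h t - h i) / (real i - real t)\<^sup>2)"
  have h: "h i \<ge> 0" by (simp add: h_def)
  have "entry (inv_sq * hilb) N i m = (\<Sum>t<N. of_real ((if i = t then \<kappa> else 2 / (real i - real t)\<^sup>2) * h t))"
    unfolding entry_mult using assms by (intro sum.cong refl) (simp add: inv_sq_def \<kappa>_def h_def)
  also have "\<dots> = of_real (\<Sum>t<N. (if i = t then \<kappa> else 2 / (real i - real t)\<^sup>2) * h t)"
    by (simp only: of_real_sum)
  also have "(\<Sum>t<N. (if i = t then \<kappa> else 2 / (real i - real t)\<^sup>2) * h t)
      = (\<Sum>t<N. (if i = t then \<kappa> * h i else 0) + 2 * (h t - h i) / (real i - real t)\<^sup>2 + 2 * h i * (1 / (real i - real t)\<^sup>2))"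
    by (intro sum.cong refl) (auto simp: diff_divide_distrib algebra_simps)
  also have "\<dots> = 3 * \<kappa> * h i + D"
  proof -
    have "(\<Sum>t<N. 2 * h i * (1 / (real i - real t)\<^sup>2)) = 2 * h i * \<kappa>"
      unfolding \<kappa>_def by (rule sum_distrib_left[symmetric])
    moreover have "(\<Sum>t<N. if i = t then \<kappa> * h i else 0) = \<kappa> * h i" using assms by simp
    ultimately show ?thesis unfolding sum.distrib D_def[symmetric] by simp
  qed
  finally have "entry (inv_sq * hilb - scal (of_real (pi\<^sup>2)) * hilb) N i m
      = of_real (D - (pi\<^sup>2 - 3 * \<kappa>) * h i)"
    using assms by (simp add: h_def algebra_simps)
  then have "cmod (entry (inv_sq * hilb - scal (of_real (pi\<^sup>2)) * hilb) N i m) = \<bar>D - (pi\<^sup>2 - 3 * \<kappa>) * h i\<bar>"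
    by (simp only: norm_of_real)
  also have "\<dots> \<le> \<bar>D\<bar> + \<bar>pi\<^sup>2 - 3 * \<kappa>\<bar> * h i"
    using h abs_triangle_ineq4[of D "(pi\<^sup>2 - 3 * \<kappa>) * h i"] by (simp add: abs_mult)
  finally have le: "cmod (entry (inv_sq * hilb - scal (of_real (pi\<^sup>2)) * hilb) N i m)
      \<le> \<bar>D\<bar> + \<bar>pi\<^sup>2 - 3 * \<kappa>\<bar> * h i" .
  have \<kappa>_le: "\<bar>pi\<^sup>2 - 3 * \<kappa>\<bar> \<le> 6 * (1 / (real i + 1) + 1 / (real N - real i))"
  proof -
    have "real (N - 1 - i) + 1 = real N - real i" using assms by (auto simp: of_nat_diff)
    then show ?thesis
      using zeta2_tail[of i] zeta2_tail[of "N - 1 - i"]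
      unfolding \<kappa>_def sum_inverse_squares_diff[OF assms(1)] by (simp add: abs_le_iff)
  qed
  have "\<bar>D\<bar> \<le> 6 * (1 / sqrt (real m + 1)) * h i"
  proof -
    have "\<bar>D\<bar> \<le> (\<Sum>t<N. 2 * h i * (\<bar>1 / \<bar>real i - real t\<bar>\<bar> * \<bar>1 / (real m + real t + 1)\<bar>))"
      unfolding D_def
    proof (rule order.trans[OF sum_abs], rule sum_mono)
      fix t
      have "h t - h i = h i * ((real i - real t) * (1 / (real m + real t + 1)))"
        by (simp add: h_def divide_simps)
      then have "\<bar>2 * (h t - h i) / (real i - real t)\<^sup>2\<bar>
          = 2 * h i * (1 / (real m + real t + 1)) * (\<bar>real i - real t\<bar> / (real i - real t)\<^sup>2)"
        using h by (simp add: abs_mult)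
      also have "\<bar>real i - real t\<bar> / (real i - real t)\<^sup>2 = 1 / \<bar>real i - real t\<bar>"
      proof -
        have "y / y\<^sup>2 = 1 / y" for y :: real by (simp add: power2_eq_square)
        from this[of "\<bar>real i - real t\<bar>"] show ?thesis by (simp only: power2_abs)
      qed
      finally show "\<bar>2 * (h t - h i) / (real i - real t)\<^sup>2\<bar>
          \<le> 2 * h i * (\<bar>1 / \<bar>real i - real t\<bar>\<bar> * \<bar>1 / (real m + real t + 1)\<bar>)" by (simp add: mult.commute)
    qed
    also have "\<dots> = 2 * h i * (\<Sum>t<N. \<bar>1 / \<bar>real i - real t\<bar>\<bar> * \<bar>1 / (real m + real t + 1)\<bar>)"
      by (rule sum_distrib_left[symmetric])
    also have "\<dots> \<le> 2 * h i * (2 * (sqrt 2 / sqrt (real m + 1)))"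
    proof (rule mult_left_mono)
      have "(\<Sum>t<N. \<bar>1 / \<bar>real i - real t\<bar>\<bar> * \<bar>1 / (real m + real t + 1)\<bar>)
          \<le> L2_set (\<lambda>t. 1 / \<bar>real i - real t\<bar>) {..<N} * L2_set (\<lambda>t. 1 / (real m + real t + 1)) {..<N}"
        by (rule L2_set_mult_ineq)
      also have "\<dots> \<le> sqrt 4 * sqrt (2 / (real m + 1))"
      proof (rule mult_mono)
        show "L2_set (\<lambda>t. 1 / \<bar>real i - real t\<bar>) {..<N} \<le> sqrt 4"
          unfolding L2_set_def power_divide power2_abs power_one
          using sum_inverse_squares_diff[OF assms(1)] sum_inverse_squares_le_2[of i] sum_inverse_squares_le_2[of "N - 1 - i"]
          by (intro real_sqrt_le_mono) linarith
        show "L2_set (\<lambda>t. 1 / (real m + real t + 1)) {..<N} \<le> sqrt (2 / (real m + 1))"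
          unfolding L2_set_def power_divide power_one
          by (intro real_sqrt_le_mono sum_inverse_squares_le')
      qed (auto simp: L2_set_nonneg)
      finally show "(\<Sum>t<N. \<bar>1 / \<bar>real i - real t\<bar>\<bar> * \<bar>1 / (real m + real t + 1)\<bar>)
          \<le> 2 * (sqrt 2 / sqrt (real m + 1))" by (simp add: real_sqrt_divide)
    qed (use h in simp)
    also have "\<dots> = (4 * sqrt 2) * (h i / sqrt (real m + 1))" by simp
    also have "\<dots> \<le> 6 * (h i / sqrt (real m + 1))"
    proof (rule mult_right_mono)
      have "sqrt 2 \<le> sqrt ((3/2)\<^sup>2)" by (intro real_sqrt_le_mono) (simp add: power2_eq_square)
      then show "4 * sqrt 2 \<le> 6" by simp
    qed (use h in simp)
    finally show ?thesis by simp
  qed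
  then have "\<bar>D\<bar> + \<bar>pi\<^sup>2 - 3 * \<kappa>\<bar> * h i
      \<le> 6 * (1 / sqrt (real m + 1)) * h i + 6 * (1 / (real i + 1) + 1 / (real N - real i)) * h i"
    using \<kappa>_le h by (intro add_mono mult_right_mono)
  also have "\<dots> = 6 * h i * (1 / (real i + 1) + 1 / (real N - real i) + 1 / sqrt (real m + 1))"
    by (simp only: distrib_left distrib_right mult_ac add_ac)
  finally show ?thesis using le by (simp add: h_def)
qed

lemma sq_sum3_le: "(x + y + z)\<^sup>2 \<le> 3 * (x\<^sup>2 + y\<^sup>2 + (z::real)\<^sup>2)"
  using sum_squares_bound[of x y] sum_squares_bound[of y z] sum_squares_bound[of x z]
  by (simp add: power2_eq_square algebra_simps)

lemma inv_sq_hilb: "inv_sq * hilb \<doteq> scal (of_real (pi\<^sup>2)) * hilb"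
  unfolding hs_equiv_def
proof (rule hs_boundedI)
  fix N i m :: nat
  assume im: "i < N" "m < N"
  have "(cmod (entry (inv_sq * hilb - scal (of_real (pi\<^sup>2)) * hilb) N i m))\<^sup>2
      \<le> (6 / (real i + real m + 1) * (1 / (real i + 1) + 1 / (real N - real i) + 1 / sqrt (real m + 1)))\<^sup>2"
    by (intro power_mono inv_sq_hilb_entry im) simp
  also have "\<dots> = 36 * (1 / (real i + real m + 1)\<^sup>2) * (1 / (real i + 1) + 1 / (real N - real i) + 1 / sqrt (real m + 1))\<^sup>2"
    by (simp only: power_mult_distrib power_divide) simp
  also have "\<dots> \<le> 36 * (1 / (real i + real m + 1)\<^sup>2)
      * (3 * ((1 / (real i + 1))\<^sup>2 + (1 / (real N - real i))\<^sup>2 + (1 / sqrt (real m + 1))\<^sup>2))"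
    by (intro mult_left_mono sq_sum3_le) auto
  also have "\<dots> = 108 * ((1 / (real i + 1)\<^sup>2 + 1 / (real N - real i)\<^sup>2) * (1 / (real i + real m + 1)\<^sup>2)
      + 1 / (real m + 1) * (1 / (real m + real i + 1)\<^sup>2))"
    by (simp add: power_divide algebra_simps)
  finally show "(cmod (entry (inv_sq * hilb - scal (of_real (pi\<^sup>2)) * hilb) N i m))\<^sup>2
    \<le> 108 * ((1 / (real i + 1)\<^sup>2 + 1 / (real N - real i)\<^sup>2) * (1 / (real i + real m + 1)\<^sup>2)
      + 1 / (real m + 1) * (1 / (real m + real i + 1)\<^sup>2))" .
next
  fix N :: nat
  have row: "(\<Sum>m<N. 1 / (real i + real m + 1)\<^sup>2) \<le> 2" for i
  proof -
    have "2 / (real i + 1) \<le> 2 / 1" by (intro divide_left_mono) auto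
    then show ?thesis using sum_inverse_squares_le'[of i N] by simp
  qed
  have "(\<Sum>i<N. \<Sum>m<N. (1 / (real i + 1)\<^sup>2 + 1 / (real N - real i)\<^sup>2) * (1 / (real i + real m + 1)\<^sup>2))
      \<le> (\<Sum>i<N. (1 / (real i + 1)\<^sup>2 + 1 / (real N - real i)\<^sup>2) * 2)"
    unfolding sum_distrib_left[symmetric] by (intro sum_mono mult_left_mono row) auto
  also have "\<dots> \<le> 4 * 2"
    unfolding sum_distrib_right[symmetric] sum.distrib
    using add_mono[OF sum_inverse_squares_le_2[of N] sum_inverse_squares_rev_le_2[of N]] by simp
  finally have 1: "(\<Sum>i<N. \<Sum>m<N. (1 / (real i + 1)\<^sup>2 + 1 / (real N - real i)\<^sup>2) * (1 / (real i + real m + 1)\<^sup>2)) \<le> 8"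
    by simp
  have "(\<Sum>i<N. \<Sum>m<N. 1 / (real m + 1) * (1 / (real m + real i + 1)\<^sup>2))
      = (\<Sum>m<N. 1 / (real m + 1) * (\<Sum>i<N. 1 / (real m + real i + 1)\<^sup>2))"
    unfolding sum_distrib_left by (rule sum.swap)
  also have "\<dots> \<le> (\<Sum>m<N. 1 / (real m + 1) * (2 / (real m + 1)))"
    by (intro sum_mono mult_left_mono sum_inverse_squares_le') auto
  also have "\<dots> = 2 * (\<Sum>m<N. 1 / (real m + 1)\<^sup>2)"
    by (simp add: sum_distrib_left power2_eq_square)
  finally have 2: "(\<Sum>i<N. \<Sum>m<N. 1 / (real m + 1) * (1 / (real m + real i + 1)\<^sup>2)) \<le> 4"
    using sum_inverse_squares_le_2[of N] by linarith
  show "(\<Sum>i<N. \<Sum>m<N. 108 * ((1 / (real i + 1)\<^sup>2 + 1 / (real N - real i)\<^sup>2) * (1 / (real i + real m + 1)\<^sup>2)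
      + 1 / (real m + 1) * (1 / (real m + real i + 1)\<^sup>2))) \<le> 108 * 12"
    using 1 2 by (simp only: sum_distrib_left[of 108, symmetric] sum.distrib) simp
qed

text \<open>For the trace of a single Hilbert matrix the Hilbert--Schmidt bound of the previous lemma does not
  help, but the pointwise bound on the diagonal does.\<close>

lemma tr_inv_sq_hilb: "tr (inv_sq * hilb) \<triangleq> tr (scal (of_real (pi\<^sup>2)) * hilb)"
proof -
  have "cmod (tr (inv_sq * hilb) N - tr (scal (of_real (pi\<^sup>2)) * hilb) N) \<le> 48 * sqrt (harm N)" for N
  proof (cases "N = 0")
    case False
    have "cmod (tr (inv_sq * hilb) N - tr (scal (of_real (pi\<^sup>2)) * hilb) N)
        \<le> (\<Sum>i<N. 6 / (real i + real i + 1) * (1 / (real i + 1) + 1 / (real N - real i) + 1 / sqrt (real i + 1)))"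
      unfolding tr_diff[symmetric] unfolding tr_def
      by (intro sum_norm_le inv_sq_hilb_entry) auto
    also have "\<dots> \<le> (\<Sum>i<N. 6 * (2 * (1 / (real i + 1)\<^sup>2) + 1 / (real N - real i)\<^sup>2
        + \<bar>1 / (real i + 1)\<bar> * \<bar>1 / sqrt (real i + 1)\<bar>))"
    proof (rule sum_mono)
      fix i assume "i \<in> {..<N}"
      define x y where "x = 1 / (real i + 1)" and "y = 1 / (real N - real i)"
      have xy: "x \<ge> 0" "y \<ge> 0" using \<open>i \<in> {..<N}\<close> by (auto simp: x_def y_def)
      have "6 / (real i + real i + 1) \<le> 6 * x" by (simp add: x_def frac_le)
      then have "6 / (real i + real i + 1) * (x + y + 1 / sqrt (real i + 1)) \<le> 6 * x * (x + y + 1 / sqrt (real i + 1))"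
        using xy by (intro mult_right_mono) auto
      also have "\<dots> \<le> 6 * (2 * x\<^sup>2 + y\<^sup>2 + x * (1 / sqrt (real i + 1)))"
      proof -
        have "x * y \<le> x\<^sup>2 + y\<^sup>2"
          using sum_squares_bound[of x y] zero_le_power2[of x] zero_le_power2[of y]
            mult_nonneg_nonneg[OF xy] by linarith
        then have "6 * (x * x + x * y + x * (1 / sqrt (real i + 1)))
            \<le> 6 * (2 * x\<^sup>2 + y\<^sup>2 + x * (1 / sqrt (real i + 1)))"
          by (simp add: power2_eq_square)
        then show ?thesis by (simp only: distrib_left mult.assoc)
      qed
      finally show "6 / (real i + real i + 1) * (1 / (real i + 1) + 1 / (real N - real i) + 1 / sqrt (real i + 1))
          \<le> 6 * (2 * (1 / (real i + 1)\<^sup>2) + 1 / (real N - real i)\<^sup>2 + \<bar>1 / (real i + 1)\<bar> * \<bar>1 / sqrt (real i + 1)\<bar>)"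
        by (simp add: x_def y_def power_divide)
    qed
    also have "\<dots> = 6 * (2 * (\<Sum>i<N. 1 / (real i + 1)\<^sup>2) + (\<Sum>i<N. 1 / (real N - real i)\<^sup>2)
        + (\<Sum>i<N. \<bar>1 / (real i + 1)\<bar> * \<bar>1 / sqrt (real i + 1)\<bar>))"
      by (simp only: sum_distrib_left[symmetric] sum.distrib)
    also have "\<dots> \<le> 6 * (2 * 2 + 2 + sqrt 2 * sqrt (harm N))"
    proof -
      have "(\<Sum>i<N. \<bar>1 / (real i + 1)\<bar> * \<bar>1 / sqrt (real i + 1)\<bar>)
          \<le> L2_set (\<lambda>i. 1 / (real i + 1)) {..<N} * L2_set (\<lambda>i. 1 / sqrt (real i + 1)) {..<N}"
        by (rule L2_set_mult_ineq)
      also have "\<dots> \<le> sqrt 2 * sqrt (harm N)"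
      proof (rule mult_mono)
        show "L2_set (\<lambda>i. 1 / (real i + 1)) {..<N} \<le> sqrt 2"
          unfolding L2_set_def power_divide power_one
          by (intro real_sqrt_le_mono sum_inverse_squares_le_2)
        show "L2_set (\<lambda>i. 1 / sqrt (real i + 1)) {..<N} \<le> sqrt (harm N)"
          unfolding L2_set_def by (intro real_sqrt_le_mono) (simp add: power_divide harm_eq_sum)
      qed (auto simp: L2_set_nonneg)
      finally show ?thesis
        by (intro mult_left_mono add_mono sum_inverse_squares_le_2 sum_inverse_squares_rev_le_2) auto
    qed
    also have "\<dots> \<le> 6 * (6 * sqrt (harm N) + 2 * sqrt (harm N))"
    proof -
      have "1 \<le> sqrt (harm N)" using harm_ge_1[of N] False by simp
      moreover have "sqrt 2 \<le> sqrt (2\<^sup>2)" by (intro real_sqrt_le_mono) simp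
      then have "sqrt 2 * sqrt (harm N) \<le> 2 * sqrt (harm N)"
        by (intro mult_right_mono) (auto simp: harm_nonneg)
      ultimately have "2 * 2 + 2 + sqrt 2 * sqrt (harm N) \<le> 6 * sqrt (harm N) + 2 * sqrt (harm N)"
        by linarith
      then show ?thesis by (rule mult_left_mono) simp
    qed
    finally show ?thesis by simp
  qed (simp add: tr_def harm_def)
  then show ?thesis unfolding seq_equiv_def negligible_seq_def by blast
qed

section \<open>Traces of powers of the Hilbert matrix\<close>

text \<open>The derivation property of the commutator and the vanishing of its trace are all that is used
  of the logarithm.\<close>

lemma diag_comm_mult: "diag_comm d (X * Y) = diag_comm d X * Y + X * diag_comm d Y"
  by (simp add: diag_comm_def algebra_simps)

lemma log_comm_mult: "log_comm (X * Y) = log_comm X * Y + X * log_comm Y"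
  by (simp add: log_comm_def diag_comm_mult)

lemma tr_log_comm: "tr (log_comm X) N = 0"
  by (simp add: log_comm_def diag_comm_def tr_diff tr_commute)

lemma tr_of_nat: "tr (of_nat m * X) N = of_nat m * tr X N"
  by (induction m) (simp_all add: distrib_right tr_add)

lemma hs_log_hilb_power: "0 < k \<Longrightarrow> hs_log (hilb ^ k)"
  by (cases k) (auto simp: power_Suc2 simp del: power_Suc intro!: hs_log_op_left op_bounded_power)

lemma hilb_power_dht: "hilb ^ m * dht \<doteq> dht * hilb ^ m"
proof (induction m)
  case (Suc m)
  have "hilb ^ Suc m * dht = hilb ^ m * (hilb * dht)" by (simp add: power_Suc2 mult.assoc del: power_Suc)
  also have "\<dots> \<doteq> hilb ^ m * (dht * hilb)"
    by (intro hs_equiv_mult_left op_bounded_power op_bounded_hilb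
        hs_equiv_trans[OF hilb_dht_equiv hs_equiv_sym[OF dht_hilb_equiv]])
  also have "\<dots> = (hilb ^ m * dht) * hilb" by (simp add: mult.assoc)
  also have "\<dots> \<doteq> (dht * hilb ^ m) * hilb" by (intro hs_equiv_mult_right Suc op_bounded_hilb)
  also have "\<dots> = dht * hilb ^ Suc m" by (simp add: mult.assoc power_commutes)
  finally show ?case .
qed simp

lemma log_comm_hilb_power: "log_comm (hilb ^ m) \<doteq> of_nat m * (dht * hilb ^ m)"
proof (induction m)
  case 0
  have "log_comm 1 = 0" by (simp add: log_comm_def diag_comm_def)
  then show ?case by simp
next
  case (Suc m)
  have "log_comm (hilb ^ Suc m) = log_comm (hilb ^ m) * hilb + hilb ^ m * log_comm hilb"
    by (simp add: power_Suc2 log_comm_mult del: power_Suc)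
  also have "\<dots> \<doteq> of_nat m * (dht * hilb ^ m) * hilb + (dht * hilb ^ m) * hilb"
  proof (rule hs_equiv_add)
    show "log_comm (hilb ^ m) * hilb \<doteq> of_nat m * (dht * hilb ^ m) * hilb"
      by (intro hs_equiv_mult_right Suc op_bounded_hilb)
    have "hilb ^ m * log_comm hilb \<doteq> hilb ^ m * (dht * hilb)"
      by (intro hs_equiv_mult_left op_bounded_power op_bounded_hilb hs_equiv_sym[OF dht_hilb_equiv])
    also have "\<dots> = (hilb ^ m * dht) * hilb" by (simp add: mult.assoc)
    also have "\<dots> \<doteq> (dht * hilb ^ m) * hilb"
      by (intro hs_equiv_mult_right hilb_power_dht op_bounded_hilb)
    finally show "hilb ^ m * log_comm hilb \<doteq> (dht * hilb ^ m) * hilb" .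
  qed
  also have "\<dots> = of_nat (Suc m) * (dht * hilb ^ Suc m)"
    by (simp add: power_Suc2 algebra_simps del: power_Suc)
  finally show ?case .
qed

text \<open>The mirror image of \<open>log_comm dht\<close> lives at the far end, the Hilbert matrix at the near end.\<close>

lemma flip_log_comm_flip_hilb: "flip * log_comm dht * flip * hilb \<doteq> 0"
proof -
  have "flip * log_comm dht * flip * hilb = flip * log_comm dht * (flip * hilb)" by (simp add: mult.assoc)
  also have "\<dots> \<doteq> flip * (hilb * hilb) * (flip * hilb)"
    by (intro hs_equiv_mult_left hs_equiv_mult_right log_comm_dht op_bounded_mult op_bounded_flip op_bounded_hilb)
  also have "\<dots> = (flip * hilb) * (hilb * flip * hilb)" by (simp add: mult.assoc)
  also have "\<dots> \<doteq> 0"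
    unfolding hs_equiv_def
    by (simp add: hs_bounded_op_left op_bounded_mult hs_bounded_hilb_flip_hilb)
  finally show ?thesis .
qed

lemma tr_flip_log_comm_flip_hilb: "tr (flip * log_comm dht * flip * hilb) \<triangleq> (\<lambda>_. 0)"
proof -
  have "flip * log_comm dht * flip \<doteq> flip * (hilb * hilb) * flip"
    by (intro hs_equiv_mult_left hs_equiv_mult_right log_comm_dht op_bounded_flip)
  then have "tr (flip * log_comm dht * flip * hilb) \<triangleq> tr (flip * (hilb * hilb) * flip * hilb)"
    by (rule tr_equiv_left) simp
  also have "tr (flip * (hilb * hilb) * flip * hilb) = tr ((flip * hilb) * (hilb * flip * hilb))"
    by (simp add: mult.assoc)
  also have "\<dots> \<triangleq> (\<lambda>_. 0)"
    unfolding seq_equiv_def using negligible_tr_mult'[of "flip * hilb" "hilb * flip * hilb"]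
    by (simp add: hs_log_op_left hs_bounded_hilb_flip_hilb)
  finally show ?thesis .
qed

text \<open>The counterpart of \<open>tanh\<^sup>2 = 1 - sech\<^sup>2\<close>. The factor \<open>hilb\<close> suppresses the short scales and the far
  end, where the correspondence between \<open>dht\<close> and \<open>tanh\<close> breaks down.\<close>

lemma dht_square_hilb:
  "dht * dht * hilb \<doteq> hilb * hilb * hilb - scal (of_real (pi\<^sup>2)) * hilb"
proof -
  have "dht * dht * hilb = log_comm dht * hilb + flip * log_comm dht * flip * hilb - inv_sq * hilb"
    by (simp add: dht_square algebra_simps)
  also have "\<dots> \<doteq> hilb * hilb * hilb + 0 - scal (of_real (pi\<^sup>2)) * hilb"
    by (intro hs_equiv_diff hs_equiv_add hs_equiv_mult_right log_comm_dht op_bounded_hilb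
        flip_log_comm_flip_hilb inv_sq_hilb)
  finally show ?thesis by simp
qed

text \<open>Integration by parts: \<open>log_comm (dht * hilb\<^sup>m\<^sup>+\<^sup>1)\<close> has trace zero. The product rule gives
  \<open>T\<^sub>m\<^sub>+\<^sub>3\<close> from \<open>log_comm dht\<close>, and \<open>m + 1\<close> times the trace of \<open>dht\<^sup>2 * hilb\<^sup>m\<^sup>+\<^sup>1\<close> from the Hilbert
  matrices. In every product that is approximated, a further factor \<open>hilb\<close> is left, because \<open>dht\<close> alone
  is too large in Hilbert--Schmidt norm; this is why \<open>m\<close> has to be positive.\<close>

lemma tr_hilb_power_rec:
  assumes "0 < m"
  shows "(\<lambda>N. of_nat (m + 2) * tr (hilb ^ (m + 3)) N)
    \<triangleq> (\<lambda>N. of_nat (m + 1) * (of_real (pi\<^sup>2) * tr (hilb ^ (m + 1)) N))"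
proof -
  define Q where "Q = tr (dht * dht * hilb * hilb ^ m)"
  have log_m: "hs_log (hilb ^ m)" "hs_log (hilb ^ m * hilb)" "hs_log (dht * hilb ^ m)"
    using assms by (auto intro!: hs_log_op_right hs_log_op_left hs_log_hilb_power op_bounded_power)
  have log_1: "hs_log hilb" by simp
  have "tr (log_comm dht * (hilb ^ m * hilb)) \<triangleq> tr (hilb * hilb * (hilb ^ m * hilb))"
    by (rule tr_equiv_left[OF log_comm_dht log_m(2)])
  also have "hilb * hilb * (hilb ^ m * hilb) = hilb ^ (m + 3)"
    by (simp add: power_add numeral_3_eq_3 power_commutes mult.assoc)
  finally have 1: "tr (log_comm dht * (hilb ^ m * hilb)) \<triangleq> tr (hilb ^ (m + 3))" .
  have "tr ((dht * log_comm (hilb ^ m)) * hilb) \<triangleq> tr ((dht * (of_nat m * (dht * hilb ^ m))) * hilb)"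
    by (intro tr_equiv_left hs_equiv_mult_left log_comm_hilb_power log_1 op_bounded_dht)
  also have "(dht * (of_nat m * (dht * hilb ^ m))) * hilb = of_nat m * (dht * dht * hilb * hilb ^ m)"
  proof -
    have "dht * of_nat m = of_nat m * dht" by (rule mult_of_nat_commute[symmetric])
    then have "dht * (of_nat m * (dht * hilb ^ m)) * hilb = of_nat m * (dht * dht * (hilb ^ m * hilb))"
      by (simp add: mult.assoc[symmetric])
    then show ?thesis by (simp add: power_commutes mult.assoc)
  qed
  also have "tr (of_nat m * (dht * dht * hilb * hilb ^ m)) = (\<lambda>N. of_nat m * Q N)"
    unfolding Q_def by (rule ext) (rule tr_of_nat)
  finally have 2: "tr ((dht * log_comm (hilb ^ m)) * hilb) \<triangleq> (\<lambda>N. of_nat m * Q N)" .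
  have "tr ((dht * hilb ^ m) * log_comm hilb) \<triangleq> tr ((dht * hilb ^ m) * (dht * hilb))"
    by (intro tr_equiv_right hs_equiv_sym[OF dht_hilb_equiv] log_m)
  also have "(dht * hilb ^ m) * (dht * hilb) = (dht * (hilb ^ m * dht)) * hilb" by (simp add: mult.assoc)
  also have "tr \<dots> \<triangleq> tr ((dht * (dht * hilb ^ m)) * hilb)"
    by (intro tr_equiv_left hs_equiv_mult_left hilb_power_dht log_1 op_bounded_dht)
  also have "(dht * (dht * hilb ^ m)) * hilb = dht * dht * hilb * hilb ^ m"
    by (simp add: mult.assoc power_commutes)
  finally have 3: "tr ((dht * hilb ^ m) * log_comm hilb) \<triangleq> Q" by (simp add: Q_def)
  have "Q \<triangleq> tr ((hilb * hilb * hilb - scal (of_real (pi\<^sup>2)) * hilb) * hilb ^ m)"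
    unfolding Q_def by (intro tr_equiv_left dht_square_hilb log_m)
  also have "\<dots> = (\<lambda>N. tr (hilb ^ (m + 3)) N - of_real (pi\<^sup>2) * tr (hilb ^ (m + 1)) N)"
    by (rule ext) (simp add: left_diff_distrib tr_diff tr_scal numeral_3_eq_3 mult.assoc)
  finally have Q: "Q \<triangleq> (\<lambda>N. tr (hilb ^ (m + 3)) N - of_real (pi\<^sup>2) * tr (hilb ^ (m + 1)) N)" .
  have zero: "tr (log_comm dht * (hilb ^ m * hilb)) N + tr ((dht * log_comm (hilb ^ m)) * hilb) N
      + tr ((dht * hilb ^ m) * log_comm hilb) N = 0" for N
    using tr_log_comm[of "dht * hilb ^ m * hilb" N]
    by (simp add: log_comm_mult tr_add algebra_simps)
  have "(\<lambda>N. tr (log_comm dht * (hilb ^ m * hilb)) N + tr ((dht * log_comm (hilb ^ m)) * hilb) N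
      + tr ((dht * hilb ^ m) * log_comm hilb) N)
      \<triangleq> (\<lambda>N. tr (hilb ^ (m + 3)) N + of_nat m * (tr (hilb ^ (m + 3)) N - of_real (pi\<^sup>2) * tr (hilb ^ (m + 1)) N)
      + (tr (hilb ^ (m + 3)) N - of_real (pi\<^sup>2) * tr (hilb ^ (m + 1)) N))"
    by (rule seq_equiv_add[OF seq_equiv_add[OF 1 seq_equiv_trans[OF 2 seq_equiv_cmult[OF Q]]]
          seq_equiv_trans[OF 3 Q]])
  from seq_equiv_sym[OF this] show ?thesis
    unfolding zero seq_equiv_def by (simp add: algebra_simps)
qed

text \<open>The first step of the recursion, where no factor \<open>hilb\<close> is left to absorb the errors in
  \<open>hilb * dht\<close>. They are known exactly, however, and their traces against the antisymmetric matrix \<open>dht\<close>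
  simplify: the symmetric error drops out, and the boundary term reduces to commutators of \<open>dht\<close>
  with diagonal matrices.\<close>

lemma tr_hilb_cube: "(\<lambda>N. 2 * tr (hilb ^ 3) N) \<triangleq> (\<lambda>N. of_real (pi\<^sup>2) * tr hilb N)"
proof -
  define T where "T = tr (log_comm dht * hilb)"
  define L where "L = (\<lambda>d. diag_seq (\<lambda>N i. complex_of_real (d N i)))"
  \<comment> \<open>As \<open>dht\<close> is antisymmetric and \<open>hilb\<close> symmetric, only half a commutator of either product with a
    diagonal matrix contributes to the trace.\<close>
  have skew: "2 * tr (dht * (hilb * L d)) N = tr (diag_comm d dht * hilb) N"
    "2 * tr (dht * (L d * hilb)) N = - tr (diag_comm d dht * hilb) N" for d N
  proof -
    have "tr (dht * (hilb * L d)) N = tr (mtransp (dht * (hilb * L d))) N" by (simp add: tr_transp)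
    also have "\<dots> = - tr ((L d * hilb) * dht) N" by (simp add: transp_mult tr_minus L_def)
    finally have "tr (dht * (hilb * L d)) N = - tr (dht * (L d * hilb)) N" by (simp add: tr_commute)
    moreover have "tr (diag_comm d dht * hilb) N = tr (dht * (hilb * L d)) N - tr (dht * (L d * hilb)) N"
      using tr_commute[of "L d" "dht * hilb" N]
      by (simp add: diag_comm_def L_def left_diff_distrib tr_diff mult.assoc)
    ultimately show "2 * tr (dht * (hilb * L d)) N = tr (diag_comm d dht * hilb) N"
      "2 * tr (dht * (L d * hilb)) N = - tr (diag_comm d dht * hilb) N" by simp_all
  qed
  \<comment> \<open>Reversing the positions turns one of these commutators into the far-end copy of \<open>log_comm dht\<close>.\<close>
  have rev: "diag_comm (\<lambda>N i. harm (N - 1 - i)) dht = - (flip * log_comm dht * flip)"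
  proof (rule mseq_eqI)
    fix N i j :: nat
    assume ij: "i < N" "j < N"
    then have "real (N - 1 - i) - real (N - 1 - j) = - (real i - real j)" by (simp add: of_nat_diff)
    then have "entry (flip * log_comm dht * flip) N i j
        = of_real ((harm (N - 1 - i) - harm (N - 1 - j)) / (real j - real i))"
      using ij unfolding log_comm_def
      by (simp only: mult.assoc entry_flip_mult entry_mult_flip)
        (subst entry_diag_comm_dht, simp_all)
    also have "(harm (N - 1 - i) - harm (N - 1 - j)) / (real j - real i)
        = - ((harm (N - 1 - i) - harm (N - 1 - j)) / (real i - real j))"
      by (metis minus_diff_eq minus_divide_right)
    finally show "entry (diag_comm (\<lambda>N i. harm (N - 1 - i)) dht) N i j = entry (- (flip * log_comm dht * flip)) N i j"
      using ij by (simp only: entry_minus entry_diag_comm_dht of_real_minus minus_minus)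
  qed
  have edge_eq: "(\<lambda>N. 2 * tr (dht * edge) N) = (\<lambda>N. - tr (flip * log_comm dht * flip * hilb) N
      + tr (diag_comm (\<lambda>N i. harm (i + N)) dht * hilb) N)"
  proof
    fix N
    have "2 * tr (dht * edge) N = 2 * tr (dht * (hilb * L (\<lambda>N i. harm (N - 1 - i)))) N
        - 2 * tr (dht * (L (\<lambda>N i. harm (i + N)) * hilb)) N"
      by (simp add: edge_def L_def right_diff_distrib tr_diff)
    then show "2 * tr (dht * edge) N = - tr (flip * log_comm dht * flip * hilb) N
      + tr (diag_comm (\<lambda>N i. harm (i + N)) dht * hilb) N"
      unfolding skew rev by (simp add: tr_minus)
  qed
  have edge: "(\<lambda>N. 2 * tr (dht * edge) N) \<triangleq> (\<lambda>N. - 0 + 0)"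
    unfolding edge_eq
  proof (rule seq_equiv_add)
    show "(\<lambda>N. - tr (flip * log_comm dht * flip * hilb) N) \<triangleq> (\<lambda>N. - 0)"
      using seq_equiv_cmult[OF tr_flip_log_comm_flip_hilb, of "-1"] by simp
    show "tr (diag_comm (\<lambda>N i. harm (i + N)) dht * hilb) \<triangleq> (\<lambda>N. 0)"
      unfolding seq_equiv_def using negligible_tr_mult[OF hs_bounded_shift_comm hs_log_hilb] by simp
  qed
  have sym: "mtransp hilb_sq_entries = hilb_sq_entries"
    by (rule mseq_eqI) (simp add: hilb_sq_entries_def add.commute)
  have rem: "tr (dht * hilb_sq_entries) N = 0" for N
  proof -
    have "tr (dht * hilb_sq_entries) N = tr (mtransp (dht * hilb_sq_entries)) N" by (simp add: tr_transp)
    also have "\<dots> = - tr (dht * hilb_sq_entries) N" by (simp add: transp_mult sym tr_minus tr_commute)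
    finally show ?thesis by simp
  qed
  have "2 * T N = tr (inv_sq * hilb) N - tr (flip * log_comm dht * flip * hilb) N + tr (dht * edge) N" for N
  proof -
    have "tr (dht * dht * hilb) N = tr (dht * (hilb * dht)) N"
      using tr_commute[of dht "dht * hilb" N] by (simp add: mult.assoc)
    also have "\<dots> = tr (dht * log_comm hilb) N + tr (dht * edge) N"
      by (simp add: hilb_dht distrib_left tr_add rem)
    also have "tr (dht * log_comm hilb) N = - T N"
      using tr_log_comm[of "dht * hilb" N] by (simp add: log_comm_mult tr_add T_def add_eq_0_iff)
    finally show ?thesis
      by (simp add: dht_square left_diff_distrib distrib_right tr_add tr_diff T_def)
        (simp add: algebra_simps)
  qed
  then have T_eq: "(\<lambda>N. 2 * T N) = (\<lambda>N. tr (inv_sq * hilb) N - tr (flip * log_comm dht * flip * hilb) N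
      + (1/2) * (2 * tr (dht * edge) N))" by simp
  have "(\<lambda>N. 2 * T N) \<triangleq> (\<lambda>N. tr (scal (of_real (pi\<^sup>2)) * hilb) N - 0 + (1/2) * (- 0 + 0))"
    unfolding T_eq by (intro seq_equiv_add seq_equiv_diff seq_equiv_cmult tr_inv_sq_hilb tr_flip_log_comm_flip_hilb edge)
  then have "(\<lambda>N. 2 * T N) \<triangleq> (\<lambda>N. of_real (pi\<^sup>2) * tr hilb N)" by (simp add: tr_scal)
  moreover have "T \<triangleq> tr (hilb * hilb * hilb)"
    unfolding T_def by (intro tr_equiv_left log_comm_dht hs_log_hilb)
  from seq_equiv_cmult[OF seq_equiv_sym[OF this], of 2]
  have "(\<lambda>N. 2 * tr (hilb ^ 3) N) \<triangleq> (\<lambda>N. 2 * T N)"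
    by (simp add: numeral_3_eq_3 mult.assoc)
  ultimately show ?thesis by (rule seq_equiv_trans[rotated])
qed

lemma tr_hilb: "tr hilb \<triangleq> (\<lambda>N. of_real (harm N) / 2)"
  unfolding seq_equiv_def
proof (rule negligible_seqI)
  fix N
  have "tr hilb N - of_real (harm N) / 2 = of_real (\<Sum>i<N. 1 / (real i + real i + 1) - 1 / (real i + 1) / 2)"
    by (simp add: tr_def harm_eq_sum sum_subtractf sum_divide_distrib)
  then have "cmod (tr hilb N - of_real (harm N) / 2) = \<bar>\<Sum>i<N. 1 / (real i + real i + 1) - 1 / (real i + 1) / 2\<bar>"
    by (simp only: norm_of_real)
  also have "\<dots> \<le> (\<Sum>i<N. 1 / (real i + 1)\<^sup>2)"
  proof (rule order.trans[OF sum_abs], rule sum_mono)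
    fix i
    have "1 / (real i + real i + 1) - 1 / (real i + 1) / 2 = 1 / ((real i + 1) * (2 * (real i + real i + 1)))"
      by (simp add: divide_simps) (simp add: algebra_simps)
    moreover have "1 / ((real i + 1) * (2 * (real i + real i + 1))) \<le> 1 / ((real i + 1) * (real i + 1))"
      by (intro divide_left_mono mult_left_mono) auto
    ultimately show "\<bar>1 / (real i + real i + 1) - 1 / (real i + 1) / 2\<bar> \<le> 1 / (real i + 1)\<^sup>2"
      by (simp add: power2_eq_square)
  qed
  also have "\<dots> \<le> 2" by (rule sum_inverse_squares_le_2)
  finally show "cmod (tr hilb N - of_real (harm N) / 2) \<le> 2" .
qed (simp add: tr_def harm_def)

lemma tr_hilb_square: "tr (hilb ^ 2) \<triangleq> (\<lambda>N. of_real (harm N))"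
  unfolding seq_equiv_def
proof (rule negligible_seqI)
  fix N
  define \<rho> where "\<rho> = (\<lambda>i. \<Sum>j<N. 1 / (real i + real j + 1)\<^sup>2)"
  have "tr (hilb ^ 2) N = (\<Sum>i<N. of_real (\<rho> i))"
    unfolding tr_def power2_eq_square
    by (intro sum.cong refl) (simp add: entry_hilb_square \<rho>_def power2_eq_square del: of_real_sum)
  then have "tr (hilb ^ 2) N - of_real (harm N) = of_real (\<Sum>i<N. \<rho> i - 1 / (real i + 1))"
    by (simp add: harm_eq_sum sum_subtractf)
  then have "cmod (tr (hilb ^ 2) N - of_real (harm N)) = \<bar>\<Sum>i<N. \<rho> i - 1 / (real i + 1)\<bar>"
    by (simp only: norm_of_real)
  also have "\<dots> \<le> (\<Sum>i<N. 1 / (real i + 1)\<^sup>2 + 1 / real N)"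
  proof (rule order.trans[OF sum_abs], rule sum_mono)
    fix i assume "i \<in> {..<N}"
    have "1 / (real i + 1/2) - 1 / (real i + 1) = 1 / ((2 * real i + 1) * (real i + 1))"
      by (simp add: divide_simps)
    also have "\<dots> \<le> 1 / ((real i + 1) * (real i + 1))"
      by (intro divide_left_mono mult_right_mono) auto
    finally have "\<rho> i - 1 / (real i + 1) \<le> 1 / (real i + 1)\<^sup>2"
      using sum_inverse_squares_le[of i N] by (simp add: \<rho>_def power2_eq_square)
    moreover have "1 / (real i + 1) - \<rho> i \<le> 1 / real N"
    proof -
      have "1 / (real i + 1) - 1 / (real i + real M + 1) \<le> (\<Sum>j<M. 1 / (real i + real j + 1)\<^sup>2)" for M
      proof (induction M)
        case (Suc M)
        have "1 / (real i + real M + 1) - 1 / (real i + real M + 2) = 1 / ((real i + real M + 1) * (real i + real M + 2))"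
          by (simp add: divide_simps)
        also have "\<dots> \<le> 1 / ((real i + real M + 1) * (real i + real M + 1))"
          by (intro divide_left_mono mult_left_mono) auto
        finally show ?case using Suc by (simp add: power2_eq_square add.commute add.left_commute)
      qed simp
      from this[of N] have "1 / (real i + 1) - \<rho> i \<le> 1 / (real i + real N + 1)" by (simp add: \<rho>_def)
      also have "\<dots> \<le> 1 / real N" using \<open>i \<in> {..<N}\<close> by (intro divide_left_mono) auto
      finally show ?thesis .
    qed
    moreover have "0 \<le> 1 / real N" "0 \<le> 1 / (real i + 1)\<^sup>2" by auto
    ultimately show "\<bar>\<rho> i - 1 / (real i + 1)\<bar> \<le> 1 / (real i + 1)\<^sup>2 + 1 / real N" by linarith
  qed
  also have "\<dots> \<le> 2 + 1"
    using sum_inverse_squares_le_2[of N] by (simp add: sum.distrib)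
  finally show "cmod (tr (hilb ^ 2) N - of_real (harm N)) \<le> 3" by simp
qed (simp add: tr_def harm_def)

text \<open>The integrals of \<open>sech\<^sup>k\<close> over the real line. The recursion is the one of an integration by
  parts; at \<open>0\<close>, where the integral diverges, \<open>0\<close> is a placeholder.\<close>

fun sech_moment :: "nat \<Rightarrow> real" where
  "sech_moment 0 = 0"
| "sech_moment (Suc 0) = pi"
| "sech_moment (Suc (Suc 0)) = 2"
| "sech_moment (Suc (Suc (Suc k))) = real (Suc k) / real (Suc (Suc k)) * sech_moment (Suc k)"

theorem tr_hilb_power:
  assumes "0 < k"
  shows "tr (hilb ^ k) \<triangleq> (\<lambda>N. of_real (pi ^ k * sech_moment k / (2 * pi\<^sup>2)) * of_real (harm N))"
  using assms
proof (induction k rule: sech_moment.induct)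
  case 2
  then show ?case using tr_hilb by (simp add: power2_eq_square)
next
  case 3
  then show ?case using tr_hilb_square by (simp add: power2_eq_square)
next
  case (4 k)
  define c where "c = pi\<^sup>2 * (real (Suc k) / real (Suc (Suc k)))"
  have "(\<lambda>N. of_nat (Suc (Suc k)) * tr (hilb ^ Suc (Suc (Suc k))) N)
      \<triangleq> (\<lambda>N. of_nat (Suc k) * (of_real (pi\<^sup>2) * tr (hilb ^ Suc k) N))"
  proof (cases "k = 0")
    case True
    then show ?thesis using tr_hilb_cube by (simp add: numeral_3_eq_3 numeral_2_eq_2 mult.assoc)
  next
    case False
    then show ?thesis using tr_hilb_power_rec[of k] by (simp add: numeral_3_eq_3 del: of_nat_Suc power_Suc)
  qed
  from seq_equiv_cmult[OF this, of "1 / of_nat (Suc (Suc k))"]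
  have "tr (hilb ^ Suc (Suc (Suc k))) \<triangleq> (\<lambda>N. of_real c * tr (hilb ^ Suc k) N)"
    unfolding c_def by (simp add: mult_ac del: of_nat_Suc power_Suc)
  also have "\<dots> \<triangleq> (\<lambda>N. of_real c * (of_real (pi ^ Suc k * sech_moment (Suc k) / (2 * pi\<^sup>2)) * of_real (harm N)))"
    by (intro seq_equiv_cmult 4) simp
  also have "\<dots> = (\<lambda>N. of_real (pi ^ Suc (Suc (Suc k)) * sech_moment (Suc (Suc (Suc k))) / (2 * pi\<^sup>2)) * of_real (harm N))"
    by (simp add: c_def power2_eq_square mult_ac)
  finally show ?case .
qed simp

section \<open>Superpositions of rotated Hilbert matrices\<close>

definition rot :: "complex \<Rightarrow> mseq"
  where "rot u = diag_seq (\<lambda>N i. u ^ i)"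

lemma entry_rot_mult [simp]: "entry (rot u * X) N i j = u ^ i * entry X N i j"
  and entry_mult_rot [simp]: "entry (X * rot u) N i j = entry X N i j * u ^ j"
  by (simp_all add: rot_def)

lemma rot_mult: "rot u * rot v = rot (u * v)"
  by (simp add: rot_def diag_seq_mult power_mult_distrib)

lemma rot_one [simp]: "rot 1 = 1"
  by (rule mseq_eqI) (auto simp: rot_def)

lemma op_bounded_rot: "cmod u = 1 \<Longrightarrow> op_bounded (rot u)"
  unfolding rot_def by (rule op_bounded_diag[where C = 1]) (simp add: norm_power)

text \<open>Summation by parts: the geometric partial sums are bounded, and the coefficients have total
  variation \<open>a 0\<close>.\<close>

lemma norm_geometric_sum_decreasing_le:
  fixes a :: "nat \<Rightarrow> real" and u :: complex
  assumes "cmod u = 1" "u \<noteq> 1" "\<And>t. 0 \<le> a t" "\<And>t. a (Suc t) \<le> a t"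
  shows "cmod (\<Sum>t<N. u ^ t * of_real (a t)) \<le> 2 / cmod (1 - u) * a 0"
proof -
  define P where "P = (\<lambda>N. (1 - u) * (\<Sum>t<N. u ^ t * of_real (a t)) + u ^ N * of_real (a N))"
  have "cmod (P N) \<le> 2 * a 0 - a N"
  proof (induction N)
    case 0
    show ?case using assms(3)[of 0] by (simp add: P_def)
  next
    case (Suc N)
    have "P (Suc N) = P N - u ^ Suc N * of_real (a N - a (Suc N))"
      by (simp add: P_def algebra_simps)
    then have "cmod (P (Suc N)) \<le> cmod (P N) + cmod (u ^ Suc N * of_real (a N - a (Suc N)))"
      by (simp only: norm_triangle_ineq4)
    also have "cmod (u ^ Suc N * of_real (a N - a (Suc N))) = a N - a (Suc N)"
      using assms(1) assms(4)[of N] unfolding norm_mult norm_power norm_of_real by simp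
    finally show ?case using Suc by simp
  qed
  moreover have "cmod ((1 - u) * (\<Sum>t<N. u ^ t * of_real (a t))) \<le> cmod (P N) + cmod (u ^ N * of_real (a N))"
    using norm_triangle_ineq4[of "P N" "u ^ N * of_real (a N)"] by (simp add: P_def)
  moreover have "cmod (u ^ N * of_real (a N)) = a N"
    using assms(1) assms(3)[of N] by (simp add: norm_mult norm_power)
  ultimately have "cmod (1 - u) * cmod (\<Sum>t<N. u ^ t * of_real (a t)) \<le> 2 * a 0"
    by (simp add: norm_mult)
  moreover have "cmod (1 - u) > 0" using assms(2) by simp
  ultimately show ?thesis by (simp add: field_simps)
qed

definition hilb_ker :: "nat \<Rightarrow> nat \<Rightarrow> nat \<Rightarrow> real"
  where "hilb_ker N i j = (if i < N \<and> j < N then 1 / (real i + real j + 1) else 0)"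

lemma entry_hilb_ker: "entry hilb N i j = of_real (hilb_ker N i j)"
  by (simp add: hilb_ker_def)

lemma hilb_ker_nonneg: "0 \<le> hilb_ker N i j"
  and hilb_ker_decreasing: "hilb_ker N i (Suc j) \<le> hilb_ker N i j"
  and hilb_ker_commute: "hilb_ker N i j = hilb_ker N j i"
  by (auto simp: hilb_ker_def frac_le add.commute)

lemma hilb_power_entry_nonneg:
  "\<exists>r. (\<forall>j. entry (hilb ^ k) N i j = of_real (r j)) \<and> (\<forall>j. 0 \<le> (r j :: real))"
proof (induction k)
  case 0
  show ?case by (rule exI[of _ "\<lambda>j. if i < N \<and> i = j then 1 else 0"]) auto
next
  case (Suc k)
  then obtain r where r: "\<And>j. entry (hilb ^ k) N i j = of_real (r j)" "\<And>j. 0 \<le> r j" by blast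
  have "entry (hilb ^ Suc k) N i j = of_real (\<Sum>t<N. r t * hilb_ker N t j)" for j
    unfolding power_Suc2 entry_mult r entry_hilb_ker by simp
  then show ?case
    by (intro exI[of _ "\<lambda>j. \<Sum>t<N. r t * hilb_ker N t j"])
      (auto intro!: sum_nonneg mult_nonneg_nonneg r hilb_ker_nonneg simp del: power_Suc)
qed

text \<open>Monotonicity of the kernel survives multiplication from the left by anything nonnegative, so
  summation by parts applies to the rows of all powers.\<close>

lemma hilb_power_entry_decreasing:
  assumes "0 < k"
  shows "\<exists>r. (\<forall>j. entry (hilb ^ k) N i j = of_real (r j)) \<and> (\<forall>j. 0 \<le> (r j :: real)) \<and> (\<forall>j. r (Suc j) \<le> r j)"
proof -
  obtain l where k: "k = Suc l" using assms gr0_implies_Suc by blast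
  obtain r where r: "\<And>j. entry (hilb ^ l) N i j = of_real (r j)" "\<And>j. 0 \<le> r j"
    using hilb_power_entry_nonneg by blast
  have "entry (hilb ^ Suc l) N i j = of_real (\<Sum>t<N. r t * hilb_ker N t j)" for j
    unfolding power_Suc2 entry_mult r entry_hilb_ker by simp
  then show ?thesis unfolding k
    by (intro exI[of _ "\<lambda>j. \<Sum>t<N. r t * hilb_ker N t j"])
      (auto intro!: sum_nonneg mult_nonneg_nonneg mult_left_mono sum_mono r hilb_ker_nonneg
        hilb_ker_decreasing simp del: power_Suc)
qed

text \<open>A rotation between two Hilbert matrices makes the sums oscillate: the singularities of the two
  factors sit at different points of the circle and do not interact.\<close>

lemma hs_bounded_hilb_rot_hilb:
  assumes "cmod u = 1" "u \<noteq> 1"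
  shows "hs_bounded (hilb * rot u * hilb)"
proof (rule hs_boundedI)
  fix N i j :: nat
  assume ij: "i < N" "j < N"
  define a where "a = (\<lambda>t. hilb_ker N i t * hilb_ker N j t)"
  have "entry (hilb * rot u * hilb) N i j = (\<Sum>t<N. u ^ t * of_real (a t))"
    unfolding entry_mult[of "hilb * rot u"] a_def
    by (intro sum.cong refl)
      (simp only: entry_mult_rot entry_hilb_ker of_real_mult hilb_ker_commute[of N _ j] mult_ac)
  also have "cmod \<dots> \<le> 2 / cmod (1 - u) * a 0"
    by (rule norm_geometric_sum_decreasing_le[OF assms])
      (auto simp: a_def intro!: mult_mono mult_nonneg_nonneg hilb_ker_nonneg hilb_ker_decreasing)
  also have "a 0 = 1 / (real i + 1) * (1 / (real j + 1))" using ij by (simp add: a_def hilb_ker_def)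
  finally have "(cmod (entry (hilb * rot u * hilb) N i j))\<^sup>2
      \<le> (2 / cmod (1 - u) * (1 / (real i + 1) * (1 / (real j + 1))))\<^sup>2" by (rule power_mono) simp
  also have "\<dots> = (2 / cmod (1 - u))\<^sup>2 * (1 / (real i + 1)\<^sup>2 * (1 / (real j + 1)\<^sup>2))"
    by (simp only: power_mult_distrib power_one_over)
  finally show "(cmod (entry (hilb * rot u * hilb) N i j))\<^sup>2
      \<le> (2 / cmod (1 - u))\<^sup>2 * (1 / (real i + 1)\<^sup>2 * (1 / (real j + 1)\<^sup>2))" .
next
  fix N :: nat
  have "(\<Sum>i<N. \<Sum>j<N. (2 / cmod (1 - u))\<^sup>2 * (1 / (real i + 1)\<^sup>2 * (1 / (real j + 1)\<^sup>2)))
      = (2 / cmod (1 - u))\<^sup>2 * ((\<Sum>i<N. 1 / (real i + 1)\<^sup>2) * (\<Sum>j<N. 1 / (real j + 1)\<^sup>2))"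
    unfolding sum_product by (simp only: sum_distrib_left)
  also have "\<dots> \<le> (2 / cmod (1 - u))\<^sup>2 * (2 * 2)"
    by (intro mult_left_mono mult_mono sum_inverse_squares_le_2) (auto intro!: sum_nonneg)
  finally show "(\<Sum>i<N. \<Sum>j<N. (2 / cmod (1 - u))\<^sup>2 * (1 / (real i + 1)\<^sup>2 * (1 / (real j + 1)\<^sup>2)))
      \<le> (2 / cmod (1 - u))\<^sup>2 * (2 * 2)" .
qed

text \<open>After summation by parts in the inner index there remains an entry of \<open>hilb\<^sup>k\<^sup>+\<^sup>1\<close>, which is
  bounded by the operator norm.\<close>

lemma tr_rot_hilb_power_rot_hilb:
  assumes "0 < k" "cmod u = 1" "cmod v = 1" "u \<noteq> 1"
  shows "tr (rot v * hilb ^ k * rot u * hilb) \<triangleq> (\<lambda>_. 0)"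
  unfolding seq_equiv_def
proof (rule negligible_seqI)
  fix N
  obtain r where r: "\<And>i j. entry (hilb ^ k) N i j = of_real (r i j)" "\<And>i j. 0 \<le> (r i j :: real)"
    "\<And>i j. r i (Suc j) \<le> r i j"
    using hilb_power_entry_decreasing[OF assms(1), of N] by metis
  have "cmod (tr (rot v * hilb ^ k * rot u * hilb) N) \<le> (\<Sum>i<N. 2 / cmod (1 - u) * (r i 0 * hilb_ker N i 0))"
    unfolding tr_def
  proof (rule sum_norm_le)
    fix i
    have "entry (rot v * hilb ^ k * rot u * hilb) N i i = v ^ i * (\<Sum>t<N. u ^ t * of_real (r i t * hilb_ker N i t))"
      unfolding entry_mult[of "rot v * hilb ^ k * rot u"] sum_distrib_left
      by (intro sum.cong refl)
        (simp only: entry_mult_rot entry_rot_mult mult.assoc entry_hilb_ker r of_real_mult hilb_ker_commute[of N _ i] mult_ac)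
    then have "cmod (entry (rot v * hilb ^ k * rot u * hilb) N i i)
        = cmod (\<Sum>t<N. u ^ t * of_real (r i t * hilb_ker N i t))"
      using assms(3) by (simp add: norm_mult norm_power)
    also have "\<dots> \<le> 2 / cmod (1 - u) * (r i 0 * hilb_ker N i 0)"
      by (rule norm_geometric_sum_decreasing_le[OF assms(2,4)])
        (auto intro!: mult_mono mult_nonneg_nonneg hilb_ker_nonneg hilb_ker_decreasing r)
    finally show "cmod (entry (rot v * hilb ^ k * rot u * hilb) N i i)
        \<le> 2 / cmod (1 - u) * (r i 0 * hilb_ker N i 0)" .
  qed
  also have "\<dots> = 2 / cmod (1 - u) * (\<Sum>i<N. hilb_ker N 0 i * r i 0)"
    by (simp only: sum_distrib_left hilb_ker_commute[of N _ 0] mult_ac)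
  also have "\<dots> \<le> 2 / cmod (1 - u) * pi ^ Suc k"
  proof (rule mult_left_mono)
    have "entry (hilb ^ Suc k) N 0 0 = of_real (\<Sum>i<N. hilb_ker N 0 i * r i 0)"
      by (simp only: power_Suc entry_mult r entry_hilb_ker of_real_sum of_real_mult)
    then show "(\<Sum>i<N. hilb_ker N 0 i * r i 0) \<le> pi ^ Suc k"
      using op_le_entry[OF op_le_power[OF op_le_hilb, of "Suc k"], where N = N and i = 0 and j = 0]
      by (simp only: norm_of_real abs_le_iff)
  qed simp
  finally show "cmod (tr (rot v * hilb ^ k * rot u * hilb) N - 0) \<le> 2 / cmod (1 - u) * pi ^ Suc k"
    by simp
qed (simp add: tr_def)

lemma tr_rot_hilb:
  assumes "cmod u = 1" "u \<noteq> 1"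
  shows "tr (rot u * hilb) \<triangleq> (\<lambda>_. 0)"
  unfolding seq_equiv_def
proof (rule negligible_seqI)
  fix N
  have "tr (rot u * hilb) N = (\<Sum>i<N. u ^ i * of_real (1 / (real i + real i + 1)))"
    unfolding tr_def by (intro sum.cong refl) simp
  also have "cmod \<dots> \<le> 2 / cmod (1 - u) * (1 / (real 0 + real 0 + 1))"
    by (rule norm_geometric_sum_decreasing_le[OF assms]) (auto simp: frac_le)
  finally show "cmod (tr (rot u * hilb) N - 0) \<le> 2 / cmod (1 - u) * (1 / (real 0 + real 0 + 1))" by simp
qed (simp add: tr_def)

text \<open>The sequence \<open>z, cnj z, z, \<dots>\<close> of singularities that neighbouring factors of a product must have in
  order to interact, and the product of the corresponding coefficients.\<close>

definition orbit :: "nat \<Rightarrow> complex \<Rightarrow> complex"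
  where "orbit k z = (cnj ^^ k) z"

definition orbit_weight :: "(complex \<Rightarrow> complex) \<Rightarrow> nat \<Rightarrow> complex \<Rightarrow> complex"
  where "orbit_weight c k z = (\<Prod>i<k. c (orbit i z))"

lemma orbit_simps [simp]: "orbit 0 z = z" "orbit (Suc k) z = cnj (orbit k z)"
  by (simp_all add: orbit_def)

lemma cmod_orbit [simp]: "cmod (orbit k z) = cmod z"
  by (induction k) simp_all

lemma orbit_weight_Suc: "orbit_weight c (Suc k) z = orbit_weight c k z * c (orbit k z)"
  by (simp add: orbit_weight_def)

lemma cnj_eq_inverse_unit: "cmod z = 1 \<Longrightarrow> z * cnj z = 1"
  using complex_norm_square[of z] by simp

lemma mult_cnj_eq_1_iff:
  assumes "cmod w = 1"
  shows "z * cnj w = 1 \<longleftrightarrow> w = z"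
proof
  assume "z * cnj w = 1"
  then have "z * cnj w * w = w" by simp
  then show "w = z" using cnj_eq_inverse_unit[OF assms] by (simp add: mult.assoc mult.commute[of "cnj w"])
qed (use cnj_eq_inverse_unit[OF assms] in simp)

context
  fixes S :: "complex set" and c :: "complex \<Rightarrow> complex"
  assumes finite: "finite S" and unit: "\<And>z. z \<in> S \<Longrightarrow> cmod z = 1"
    and cnj_closed: "\<And>z. z \<in> S \<Longrightarrow> cnj z \<in> S"
begin

definition jump_hankel :: mseq
  where "jump_hankel = (\<Sum>z\<in>S. scal (c z) * (rot (cnj z) * hilb * rot (cnj z)))"

definition jump_hankel_power :: "nat \<Rightarrow> mseq"
  where "jump_hankel_power k
    = (\<Sum>z\<in>S. scal (orbit_weight c k z) * (rot (cnj z) * hilb ^ k * rot (orbit k z)))"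

lemma orbit_in: "z \<in> S \<Longrightarrow> orbit k z \<in> S"
  by (induction k) (auto intro: cnj_closed)

lemma op_bounded_jump_hankel: "op_bounded jump_hankel"
  unfolding jump_hankel_def
  by (intro op_bounded_sum op_bounded_mult op_bounded_scal op_bounded_rot op_bounded_hilb) (auto simp: unit)

lemma hs_log_jump_hankel: "hs_log jump_hankel"
  unfolding jump_hankel_def
  by (intro hs_log_sum hs_log_op_left hs_log_op_right op_bounded_scal op_bounded_rot hs_log_hilb) (auto simp: unit)

lemma jump_hankel_power_mult:
  "jump_hankel_power k * jump_hankel = (\<Sum>z\<in>S. \<Sum>w\<in>S. scal (orbit_weight c k z * c w)
    * (rot (cnj z) * hilb ^ k * rot (orbit k z * cnj w) * hilb * rot (cnj w)))"
  unfolding jump_hankel_power_def jump_hankel_def sum_product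
proof (intro sum.cong refl)
  fix z w
  have scal_out: "scal a * X * (scal b * Y) = scal (a * b) * (X * Y)" for a b X Y
  proof -
    have "scal a * X * (scal b * Y) = scal a * (X * scal b) * Y" by (simp add: mult.assoc)
    also have "\<dots> = scal (a * b) * (X * Y)" by (simp only: scal_commute[of b X, symmetric] scal_mult[symmetric] mult.assoc)
    finally show ?thesis .
  qed
  show "scal (orbit_weight c k z) * (rot (cnj z) * hilb ^ k * rot (orbit k z))
      * (scal (c w) * (rot (cnj w) * hilb * rot (cnj w)))
    = scal (orbit_weight c k z * c w) * (rot (cnj z) * hilb ^ k * rot (orbit k z * cnj w) * hilb * rot (cnj w))"
    unfolding scal_out by (simp add: mult.assoc rot_mult[symmetric])
qed

text \<open>Of the words in the expansion of the power, those with a non-interacting pair of neighbours are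
  Hilbert--Schmidt; every remaining word is determined by its first letter.\<close>

lemma jump_hankel_power_equiv: "0 < k \<Longrightarrow> jump_hankel ^ k \<doteq> jump_hankel_power k"
proof (induction k rule: nat_induct_non_zero)
  case 1
  then show ?case by (simp add: jump_hankel_def jump_hankel_power_def orbit_weight_def)
next
  case (Suc k)
  have "jump_hankel ^ Suc k = jump_hankel ^ k * jump_hankel" by (simp add: power_Suc2 del: power_Suc)
  also have "\<dots> \<doteq> jump_hankel_power k * jump_hankel"
    by (intro hs_equiv_mult_right Suc op_bounded_jump_hankel)
  also have "\<dots> \<doteq> (\<Sum>z\<in>S. \<Sum>w\<in>S. if w = orbit k z then scal (orbit_weight c (Suc k) z)
      * (rot (cnj z) * hilb ^ Suc k * rot (orbit (Suc k) z)) else 0)"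
    unfolding jump_hankel_power_mult
  proof (intro hs_equiv_sum)
    fix z w assume zw: "z \<in> S" "w \<in> S"
    let ?X = "scal (orbit_weight c k z * c w)
      * (rot (cnj z) * hilb ^ k * rot (orbit k z * cnj w) * hilb * rot (cnj w))"
    show "?X \<doteq> (if w = orbit k z then scal (orbit_weight c (Suc k) z)
      * (rot (cnj z) * hilb ^ Suc k * rot (orbit (Suc k) z)) else 0)"
    proof (cases "w = orbit k z")
      case True
      then have "orbit k z * cnj w = 1" using unit[OF zw(2)] by (simp add: mult_cnj_eq_1_iff)
      then have "?X = scal (orbit_weight c (Suc k) z) * (rot (cnj z) * hilb ^ Suc k * rot (orbit (Suc k) z))"
        using True by (simp add: orbit_weight_Suc power_Suc2 mult.assoc del: power_Suc)
      then show ?thesis using True by simp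
    next
      case False
      then have u: "orbit k z * cnj w \<noteq> 1" using unit[OF zw(2)] by (simp add: mult_cnj_eq_1_iff)
      obtain l where k: "k = Suc l" using Suc(1) gr0_implies_Suc by blast
      have "?X = scal (orbit_weight c k z * c w)
          * (rot (cnj z) * hilb ^ l * (hilb * rot (orbit k z * cnj w) * hilb) * rot (cnj w))"
        unfolding k power_Suc2 by (simp add: mult.assoc)
      also have "hs_bounded \<dots>"
        using unit[OF zw(1)] unit[OF zw(2)] u
        by (intro hs_bounded_op_left hs_bounded_op_right hs_bounded_hilb_rot_hilb op_bounded_mult
            op_bounded_scal op_bounded_rot op_bounded_power op_bounded_hilb) (auto simp: norm_mult)
      finally show ?thesis using False by (simp add: hs_equiv_zero_op)
    qed
  qed
  also have "\<dots> = jump_hankel_power (Suc k)"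
    unfolding jump_hankel_power_def using finite orbit_in by (intro sum.cong refl) (simp add: sum.delta')
  finally show ?case .
qed

definition jump_trace :: "nat \<Rightarrow> complex"
  where "jump_trace k = (\<Sum>z\<in>S. if orbit k z = z then orbit_weight c k z else 0)"

text \<open>Only closed words survive in the trace: the singularity at \<open>z\<close> has to return to itself after
  \<open>k\<close> steps of complex conjugation.\<close>

lemma tr_jump_hankel_power:
  assumes "0 < k"
  shows "tr (jump_hankel ^ k) \<triangleq> (\<lambda>N. jump_trace k * tr (hilb ^ k) N)"
proof -
  obtain l where k: "k = Suc l" using assms gr0_implies_Suc by blast
  show ?thesis
  proof (cases "l = 0")
    case True
    have eq: "tr jump_hankel N = (\<Sum>z\<in>S. c z * tr (rot (cnj z * cnj z) * hilb) N)" for N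
    proof -
      have "tr (rot (cnj z) * hilb * rot (cnj z)) N = tr (rot (cnj z * cnj z) * hilb) N" for z
        using tr_commute[of "rot (cnj z) * hilb" "rot (cnj z)" N] by (simp add: mult.assoc[symmetric] rot_mult)
      then show ?thesis by (simp add: jump_hankel_def tr_sum tr_scal)
    qed
    have "(\<lambda>N. \<Sum>z\<in>S. c z * tr (rot (cnj z * cnj z) * hilb) N)
        \<triangleq> (\<lambda>N. \<Sum>z\<in>S. (if cnj z = z then c z else 0) * tr hilb N)"
    proof (rule seq_equiv_sum)
      fix z assume z: "z \<in> S"
      show "(\<lambda>N. c z * tr (rot (cnj z * cnj z) * hilb) N)
          \<triangleq> (\<lambda>N. (if cnj z = z then c z else 0) * tr hilb N)"
      proof (cases "cnj z = z")
        case True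
        then have "cnj z * cnj z = 1" using mult_cnj_eq_1_iff[OF unit[OF z], of z] by simp
        then show ?thesis using True by simp
      next
        case False
        then have "cnj z * cnj z \<noteq> 1" using mult_cnj_eq_1_iff[OF unit[OF z], of "cnj z"] by auto
        then have "tr (rot (cnj z * cnj z) * hilb) \<triangleq> (\<lambda>_. 0)"
          by (intro tr_rot_hilb) (auto simp: norm_mult unit[OF z])
        from seq_equiv_cmult[OF this, of "c z"] show ?thesis using False by simp
      qed
    qed
    then show ?thesis
      unfolding k True by (simp add: eq[abs_def] jump_trace_def orbit_weight_def sum_distrib_right cong: if_cong)
  next
    case False
    have eq: "tr (jump_hankel_power l * jump_hankel) N = (\<Sum>z\<in>S. \<Sum>w\<in>S. orbit_weight c l z * c w
        * tr (rot (cnj z * cnj w) * hilb ^ l * rot (orbit l z * cnj w) * hilb) N)" for N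
    proof -
      have "tr (rot (cnj z) * hilb ^ l * rot (orbit l z * cnj w) * hilb * rot (cnj w)) N
          = tr (rot (cnj z * cnj w) * hilb ^ l * rot (orbit l z * cnj w) * hilb) N" for z w
        using tr_commute[of "rot (cnj z) * hilb ^ l * rot (orbit l z * cnj w) * hilb" "rot (cnj w)" N]
        by (simp add: mult.assoc[symmetric] rot_mult mult.commute[of "cnj w"])
      then show ?thesis by (simp add: jump_hankel_power_mult tr_sum tr_scal)
    qed
    have "tr (jump_hankel ^ l * jump_hankel) \<triangleq> tr (jump_hankel_power l * jump_hankel)"
      using False by (intro tr_equiv_left jump_hankel_power_equiv hs_log_jump_hankel) simp
    then have 1: "tr (jump_hankel ^ k) \<triangleq> tr (jump_hankel_power l * jump_hankel)"
      by (simp add: k power_Suc2 del: power_Suc)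
    have "(\<lambda>N. \<Sum>z\<in>S. \<Sum>w\<in>S. orbit_weight c l z * c w
        * tr (rot (cnj z * cnj w) * hilb ^ l * rot (orbit l z * cnj w) * hilb) N)
      \<triangleq> (\<lambda>N. \<Sum>z\<in>S. \<Sum>w\<in>S. (if w = orbit l z then (if orbit k z = z then orbit_weight c k z else 0) * tr (hilb ^ k) N else 0))"
    proof (intro seq_equiv_sum)
      fix z w assume zw: "z \<in> S" "w \<in> S"
      let ?T = "tr (rot (cnj z * cnj w) * hilb ^ l * rot (orbit l z * cnj w) * hilb)"
      have norms: "cmod (cnj z * cnj w) = 1" "cmod (orbit l z * cnj w) = 1"
        using unit[OF zw(1)] unit[OF zw(2)] by (simp_all add: norm_mult)
      have unit_iff: "orbit l z * cnj w = 1 \<longleftrightarrow> w = orbit l z" "cnj z * cnj w = 1 \<longleftrightarrow> w = cnj z"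
        using mult_cnj_eq_1_iff[OF unit[OF zw(2)]] by auto
      consider "w = orbit l z" "w = cnj z" | "w \<noteq> orbit l z" | "w = orbit l z" "w \<noteq> cnj z" by blast
      then show "(\<lambda>N. orbit_weight c l z * c w * ?T N)
        \<triangleq> (\<lambda>N. if w = orbit l z then (if orbit k z = z then orbit_weight c k z else 0) * tr (hilb ^ k) N else 0)"
      proof cases
        case 1
        then have "?T = tr (hilb ^ k)" using unit_iff by (simp add: k power_commutes)
        moreover have "orbit k z = z" using 1 by (simp add: k) (metis complex_cnj_cnj)
        moreover have "orbit_weight c k z = orbit_weight c l z * c w" using 1 by (simp only: k orbit_weight_Suc)
        ultimately show ?thesis using 1 by simp
      next
        case 2
        then have "?T \<triangleq> (\<lambda>_. 0)"
          using False norms unit_iff by (intro tr_rot_hilb_power_rot_hilb) auto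
        from seq_equiv_cmult[OF this, of "orbit_weight c l z * c w"] show ?thesis using 2 by simp
      next
        case 3
        then have "orbit l z * cnj w = 1" using unit_iff by simp
        then have "?T = tr (rot (cnj z * cnj w) * hilb ^ l * hilb)" by simp
        also have "\<dots> = tr (rot 1 * hilb ^ l * rot (cnj z * cnj w) * hilb)"
        proof
          fix N
          show "tr (rot (cnj z * cnj w) * hilb ^ l * hilb) N = tr (rot 1 * hilb ^ l * rot (cnj z * cnj w) * hilb) N"
            using tr_commute[of "rot (cnj z * cnj w) * hilb" "hilb ^ l" N]
            by (simp add: mult.assoc power_commutes)
        qed
        finally have T: "?T = tr (rot 1 * hilb ^ l * rot (cnj z * cnj w) * hilb)" .
        have "?T \<triangleq> (\<lambda>_. 0)"
          unfolding T using False norms unit_iff 3 by (intro tr_rot_hilb_power_rot_hilb) auto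
        from seq_equiv_cmult[OF this, of "orbit_weight c l z * c w"]
        have "(\<lambda>N. orbit_weight c l z * c w * ?T N) \<triangleq> (\<lambda>_. 0)" by simp
        moreover have "orbit k z \<noteq> z" using 3 by (metis complex_cnj_cnj k orbit_simps(2))
        ultimately show ?thesis using 3 by simp
      qed
    qed
    also have "(\<lambda>N. \<Sum>z\<in>S. \<Sum>w\<in>S. (if w = orbit l z then (if orbit k z = z then orbit_weight c k z else 0) * tr (hilb ^ k) N else 0))
        = (\<lambda>N. jump_trace k * tr (hilb ^ k) N)"
      unfolding jump_trace_def sum_distrib_right using finite orbit_in by (intro ext sum.cong refl) simp
    finally have 2: "(\<lambda>N. \<Sum>z\<in>S. \<Sum>w\<in>S. orbit_weight c l z * c w
        * tr (rot (cnj z * cnj w) * hilb ^ l * rot (orbit l z * cnj w) * hilb) N)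
      \<triangleq> (\<lambda>N. jump_trace k * tr (hilb ^ k) N)" .
    show ?thesis
      by (rule seq_equiv_trans[OF 1]) (use 2 in \<open>simp add: eq[abs_def]\<close>)
  qed
qed

text \<open>Hilbert--Schmidt perturbations do not change the leading order of the traces.\<close>

lemma tr_perturbed_jump_hankel_power:
  assumes B: "B \<doteq> jump_hankel" "tr B \<triangleq> tr jump_hankel" "op_bounded B" and k: "0 < k"
  shows "tr (B ^ k) \<triangleq> (\<lambda>N. jump_trace k * tr (hilb ^ k) N)"
proof -
  have pow: "B ^ k \<doteq> jump_hankel ^ k" for k
  proof (induction k)
    case (Suc k)
    have "B * B ^ k \<doteq> B * jump_hankel ^ k" by (intro hs_equiv_mult_left B Suc)
    also have "\<dots> \<doteq> jump_hankel * jump_hankel ^ k"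
      by (intro hs_equiv_mult_right B op_bounded_power op_bounded_jump_hankel)
    finally show ?case by simp
  qed simp
  have "tr (B ^ k) \<triangleq> tr (jump_hankel ^ k)"
  proof (cases "k = 1")
    case True
    then show ?thesis using B by simp
  next
    case False
    then obtain l where l: "k = Suc l" "0 < l" using k by (cases k) auto
    have log: "hs_log B" by (rule hs_equiv_hs_log[OF B(1) hs_log_jump_hankel])
    have log': "hs_log (jump_hankel ^ l)"
      using l(2) by (cases l) (auto simp: power_Suc2 simp del: power_Suc
        intro!: hs_log_op_left op_bounded_power op_bounded_jump_hankel hs_log_jump_hankel)
    have "tr (B ^ l * B) \<triangleq> tr (jump_hankel ^ l * B)" by (intro tr_equiv_left pow log)
    also have "\<dots> \<triangleq> tr (jump_hankel ^ l * jump_hankel)" by (intro tr_equiv_right B log')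
    finally show ?thesis by (simp add: l(1) power_Suc2 del: power_Suc)
  qed
  also have "\<dots> \<triangleq> (\<lambda>N. jump_trace k * tr (hilb ^ k) N)" by (rule tr_jump_hankel_power[OF k])
  finally show ?thesis .
qed

end

section \<open>Fourier coefficients of periodic functions\<close>

definition fcoef :: "(real \<Rightarrow> complex) \<Rightarrow> nat \<Rightarrow> complex"
  where "fcoef F k = 1 / (2 * of_real pi) * integral {0..2 * pi} (\<lambda>t. F t * cis (- (real k * t)))"

definition hankel_seq :: "(nat \<Rightarrow> complex) \<Rightarrow> mseq"
  where "hankel_seq e = mat_seq (\<lambda>N i j. e (i + j))"

lemma entry_hankel_seq [simp]:
  "entry (hankel_seq e) N i j = (if i < N \<and> j < N then e (i + j) else 0)"
  by (simp add: hankel_seq_def)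

lemma cnj_mult_self: "cnj z * z = (of_real (cmod z))\<^sup>2"
  by (metis complex_norm_square mult.commute of_real_power)

text \<open>Boundedness and Borel measurability pass to translates, sums and differences, and they ensure
  that all Fourier integrals exist.\<close>

locale bounded_symbol =
  fixes F :: "real \<Rightarrow> complex" and M :: real
  assumes measurable_F [measurable]: "F \<in> borel_measurable borel"
    and bounded_F: "\<And>t. cmod (F t) \<le> M"
begin

lemma integrable_mult_cis: "(\<lambda>t. F t * cis (c * t)) integrable_on {a..b}"
proof (rule bounded_measurable_integrable)
  show "(\<lambda>t. F t * cis (c * t)) \<in> borel_measurable borel" by measurable
  show "norm (F t * cis (c * t)) \<le> M" for t by (simp add: norm_mult bounded_F)
qed

lemma integrable_sq: "(\<lambda>t. (cmod (F t))\<^sup>2) integrable_on {a..b}"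
proof (rule bounded_measurable_integrable)
  show "(\<lambda>t. (cmod (F t))\<^sup>2) \<in> borel_measurable borel" by measurable
  show "norm ((cmod (F t))\<^sup>2) \<le> M\<^sup>2" for t by (simp add: bounded_F power_mono)
qed

lemma op_le_hankel: "op_le (hankel_seq (fcoef F)) M"
proof (rule op_le_symbol[where F = F and p = "\<lambda>i. - int i" and q = "\<lambda>i. - int i"])
  fix N i j :: nat
  assume "i < N" "j < N"
  have "(\<lambda>t. F t * cis (real_of_int (- int i) * t) * cis (real_of_int (- int j) * t))
      = (\<lambda>t. F t * cis (- (real (i + j) * t)))"
    by (simp add: fun_eq_iff mult.assoc cis_mult algebra_simps)
  then show "entry (hankel_seq (fcoef F)) N i j = complex_of_real (1 / (2 * pi)) *
      integral {0..2 * pi} (\<lambda>t. F t * cis (real_of_int (- int i) * t) * cis (real_of_int (- int j) * t))"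
    using \<open>i < N\<close> \<open>j < N\<close> by (simp add: fcoef_def)
qed (auto simp: inj_def bounded_F)

text \<open>Pairing \<open>F\<close> with its own partial Fourier sum \<open>V\<close> (conjugated) gives the sum of squares, and
  \<open>|F V| \<le> (|F|\<^sup>2 + |V|\<^sup>2) / 2\<close>, where \<open>V\<close> has mean square equal to that same sum.\<close>

lemma bessel: "(\<Sum>k<n. (cmod (fcoef F k))\<^sup>2) \<le> 1 / (2 * pi) * integral {0..2 * pi} (\<lambda>t. (cmod (F t))\<^sup>2)"
proof -
  define a where "a = fcoef F"
  define V where "V = trig_poly (\<lambda>i. - int i) n (\<lambda>i. cnj (a i))"
  define s where "s = (\<Sum>k<n. (cmod (a k))\<^sup>2)"
  have inj: "inj (\<lambda>i. - int i)" by (auto simp: inj_def)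
  have FV: "F t * V t = (\<Sum>k<n. cnj (a k) * (F t * cis (- (real k * t))))" for t
    unfolding V_def trig_poly_def sum_distrib_left by (intro sum.cong refl) simp
  have I: "((\<lambda>t. F t * V t) has_integral (\<Sum>k<n. cnj (a k) * (2 * of_real pi * a k))) {0..2 * pi}"
    unfolding FV
  proof (intro has_integral_sum has_integral_mult_right finite_lessThan)
    fix k
    have "(\<lambda>t. F t * cis (- (real k * t))) integrable_on {0..2 * pi}"
      using integrable_mult_cis[of "- real k"] by simp
    then show "((\<lambda>t. F t * cis (- (real k * t))) has_integral 2 * of_real pi * a k) {0..2 * pi}"
      by (simp add: a_def fcoef_def has_integral_integral)
  qed
  have "(\<Sum>k<n. cnj (a k) * (2 * of_real pi * a k)) = of_real (2 * pi * s)"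
    unfolding s_def of_real_mult of_real_sum sum_distrib_left
    by (intro sum.cong refl) (simp add: cnj_mult_self)
  then have "cmod (integral {0..2 * pi} (\<lambda>t. F t * V t)) = \<bar>2 * pi * s\<bar>"
    using integral_unique[OF I] by (simp only: norm_of_real)
  then have norm: "cmod (integral {0..2 * pi} (\<lambda>t. F t * V t)) = 2 * pi * s"
    by (simp add: s_def sum_nonneg)
  have V: "((\<lambda>t. (cmod (V t))\<^sup>2) has_integral 2 * pi * s) {0..2 * pi}"
    using trig_poly_parseval[OF inj, of n "\<lambda>i. cnj (a i)"] by (simp add: V_def s_def vnorm_sq)
  have "((\<lambda>t. 1/2 * ((cmod (F t))\<^sup>2 + (cmod (V t))\<^sup>2)) has_integral
      1/2 * (integral {0..2 * pi} (\<lambda>t. (cmod (F t))\<^sup>2) + 2 * pi * s)) {0..2 * pi}"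
    by (intro has_integral_mult_right has_integral_add V integrable_integral integrable_sq)
  note J = this
  have "cmod (integral {0..2 * pi} (\<lambda>t. F t * V t)) \<le> integral {0..2 * pi} (\<lambda>t. 1/2 * ((cmod (F t))\<^sup>2 + (cmod (V t))\<^sup>2))"
  proof (rule integral_norm_bound_integral[OF has_integral_integrable[OF I] has_integral_integrable[OF J]])
    fix t show "cmod (F t * V t) \<le> 1/2 * ((cmod (F t))\<^sup>2 + (cmod (V t))\<^sup>2)"
      using sum_squares_bound[of "cmod (F t)" "cmod (V t)"] by (simp add: norm_mult)
  qed
  then have "2 * pi * s \<le> integral {0..2 * pi} (\<lambda>t. (cmod (F t))\<^sup>2)"
    unfolding norm integral_unique[OF J] by simp
  then show ?thesis by (simp add: s_def a_def field_simps)
qed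

lemma bessel_sup:
  assumes "finite X" "\<And>t. t \<in> {0..2 * pi} \<Longrightarrow> t \<notin> X \<Longrightarrow> cmod (F t) \<le> D"
  shows "(\<Sum>k<n. (cmod (fcoef F k))\<^sup>2) \<le> D\<^sup>2"
proof -
  define g where "g = (\<lambda>t. if t \<in> X then (cmod (F t))\<^sup>2 else D\<^sup>2)"
  have "((\<lambda>_. D\<^sup>2) has_integral (2 * pi) * D\<^sup>2) {0..2 * pi}"
    using has_integral_const_real[of "D\<^sup>2" 0 "2 * pi"] by simp
  then have g: "(g has_integral (2 * pi) * D\<^sup>2) {0..2 * pi}"
    by (rule has_integral_spike_finite[OF assms(1), rotated]) (simp add: g_def)
  have "integral {0..2 * pi} (\<lambda>t. (cmod (F t))\<^sup>2) \<le> (2 * pi) * D\<^sup>2"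
  proof (rule has_integral_le[OF integrable_integral[OF integrable_sq] g])
    fix t assume "t \<in> {0..2 * pi}"
    then show "(cmod (F t))\<^sup>2 \<le> g t" using assms(2)[of t] by (auto simp: g_def intro: power_mono)
  qed
  then have "1 / (2 * pi) * integral {0..2 * pi} (\<lambda>t. (cmod (F t))\<^sup>2) \<le> D\<^sup>2"
    by (simp add: field_simps)
  then show ?thesis using bessel[of n] by linarith
qed

lemma fcoef_shift:
  assumes per: "\<And>t. F (t + 2 * pi) = F t" and a: "0 \<le> a" "a \<le> 2 * pi"
  shows "fcoef (\<lambda>t. F (t + a)) k = cis (real k * a) * fcoef F k"
proof -
  define G where "G = (\<lambda>t. F t * cis (- (real k * t)))"
  have G: "G integrable_on {x..y}" for x y
    using integrable_mult_cis[of "- real k"] by (simp add: G_def)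
  have "cis (- (real k * (t + 2 * pi))) = cis (- (real k * t))" for t
  proof -
    have "cis (- (real k * (t + 2 * pi))) = cis (- (real k * t)) * cis (2 * pi * (- real k))"
      by (simp add: cis_mult algebra_simps)
    then show ?thesis using cis_multiple_2pi[of "- real k"] by simp
  qed
  then have G_per: "G (t + 2 * pi) = G t" for t by (simp add: G_def per)
  have "integral {0..2 * pi} (\<lambda>t. G (t + a)) = integral {a..2 * pi + a} G"
    using integral_shift_Icc_real[of 0 "2 * pi" G a] by (simp add: o_def add.commute)
  also have "\<dots> = integral {a..2 * pi} G + integral {2 * pi..2 * pi + a} G"
    using a by (intro Henstock_Kurzweil_Integration.integral_combine[symmetric] G) auto
  also have "integral {2 * pi..2 * pi + a} G = integral {0..a} (\<lambda>t. G (t + 2 * pi))"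
    using integral_shift_Icc_real[of 0 a G "2 * pi"] by (simp add: o_def add.commute)
  also have "\<dots> = integral {0..a} G" by (simp add: G_per)
  also have "integral {a..2 * pi} G + integral {0..a} G = integral {0..2 * pi} G"
    using Henstock_Kurzweil_Integration.integral_combine[of 0 a "2 * pi" G] a G by (simp add: add.commute)
  finally have eq: "integral {0..2 * pi} (\<lambda>t. G (t + a)) = integral {0..2 * pi} G" .
  have "F (t + a) * cis (- (real k * t)) = cis (real k * a) * G (t + a)" for t
  proof -
    have "cis (- (real k * t)) = cis (real k * a) * cis (- (real k * (t + a)))"
      by (simp add: cis_mult algebra_simps)
    then show ?thesis by (simp add: G_def mult_ac)
  qed
  then show ?thesis by (simp add: fcoef_def eq G_def[symmetric])
qed

end

lemma fcoef_diff:
  assumes "bounded_symbol F M" "bounded_symbol G M'"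
  shows "fcoef (\<lambda>t. F t - G t) k = fcoef F k - fcoef G k"
proof -
  interpret F: bounded_symbol F M by fact
  interpret G: bounded_symbol G M' by fact
  show ?thesis
    using integral_diff[OF F.integrable_mult_cis[of "- real k" 0 "2 * pi"] G.integrable_mult_cis[of "- real k" 0 "2 * pi"]]
    by (simp add: fcoef_def left_diff_distrib right_diff_distrib)
qed

lemma fcoef_cmult: "fcoef (\<lambda>t. c * F t) k = c * fcoef F k"
  by (simp add: fcoef_def mult.assoc)

lemma fcoef_sum:
  assumes "finite S" "\<And>z. z \<in> S \<Longrightarrow> bounded_symbol (F z) (M z)"
  shows "fcoef (\<lambda>t. \<Sum>z\<in>S. F z t) k = (\<Sum>z\<in>S. fcoef (F z) k)"
proof -
  have "(\<lambda>t. F z t * cis (- (real k * t))) integrable_on {0..2 * pi}" if "z \<in> S" for z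
    using bounded_symbol.integrable_mult_cis[OF assms(2)[OF that], of "- real k"] by simp
  then have "integral {0..2 * pi} (\<lambda>t. \<Sum>z\<in>S. F z t * cis (- (real k * t)))
      = (\<Sum>z\<in>S. integral {0..2 * pi} (\<lambda>t. F z t * cis (- (real k * t))))"
    by (intro integral_sum assms(1)) auto
  then show ?thesis by (simp add: fcoef_def sum_distrib_right sum_distrib_left)
qed

lemma bounded_symbol_diff:
  assumes "bounded_symbol F M" "bounded_symbol G M'"
  shows "bounded_symbol (\<lambda>t. F t - G t) (M + M')"
proof -
  interpret F: bounded_symbol F M by fact
  interpret G: bounded_symbol G M' by fact
  show ?thesis
  proof
    show "cmod (F t - G t) \<le> M + M'" for t
      using norm_triangle_ineq4[of "F t" "G t"] F.bounded_F[of t] G.bounded_F[of t] by linarith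
  qed measurable
qed

lemma bounded_symbol_sum:
  assumes "finite S" "\<And>z. z \<in> S \<Longrightarrow> bounded_symbol (F z) (M z)"
  shows "bounded_symbol (\<lambda>t. \<Sum>z\<in>S. F z t) (\<Sum>z\<in>S. M z)"
proof
  show "(\<lambda>t. \<Sum>z\<in>S. F z t) \<in> borel_measurable borel"
    using bounded_symbol.measurable_F[OF assms(2)] by (rule borel_measurable_sum)
  show "cmod (\<Sum>z\<in>S. F z t) \<le> (\<Sum>z\<in>S. M z)" for t
    using bounded_symbol.bounded_F[OF assms(2)] by (rule sum_norm_le)
qed

lemma bounded_symbol_cmult:
  assumes "bounded_symbol F M"
  shows "bounded_symbol (\<lambda>t. c * F t) (cmod c * M)"
proof -
  interpret bounded_symbol F M by fact
  show ?thesis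
    by unfold_locales (auto simp: norm_mult intro!: mult_left_mono bounded_F)
qed

lemma bounded_symbol_shift:
  assumes "bounded_symbol F M"
  shows "bounded_symbol (\<lambda>t. F (t + a)) M"
proof -
  interpret bounded_symbol F M by fact
  show ?thesis by unfold_locales (auto intro: bounded_F)
qed

text \<open>Bessel's inequality for \<open>F (t + h) - F t\<close> with \<open>h = 2\<^sup>-\<^sup>m\<close> controls the coefficients of index
  between \<open>2\<^sup>m\<close> and \<open>2\<^sup>m\<^sup>+\<^sup>1\<close>, since there \<open>1 \<le> k h \<le> 2\<close> keeps \<open>cis (k h)\<close> away from \<open>1\<close>. Exponents
  \<open>\<gamma> > 1/2\<close> make the weighted dyadic blocks summable.\<close>

lemma weighted_coefficients_of_holder:
  assumes F: "bounded_symbol F M" and per: "\<And>t. F (t + 2 * pi) = F t"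
    and \<gamma>: "1/2 < \<gamma>" and \<epsilon>: "0 < \<epsilon>" and C: "0 \<le> C" and X: "finite X"
    and holder: "\<And>s t. s \<in> {0..2 * pi} \<Longrightarrow> s \<notin> X \<Longrightarrow> t \<notin> X \<Longrightarrow> s < t \<Longrightarrow> t < s + \<epsilon> \<Longrightarrow>
      cmod (F s - F t) \<le> C * (t - s) powr \<gamma>"
  shows "\<exists>K. \<forall>n. (\<Sum>k<n. real (k + 1) * (cmod (fcoef F k))\<^sup>2) \<le> K"
proof -
  interpret bounded_symbol F M by fact
  define c\<^sub>0 where "c\<^sub>0 = 2 - 2 * cos (1::real)"
  have "cos (1::real) < cos 0" by (rule cos_monotone_0_pi) (use pi_gt3 in auto)
  then have c0: "c\<^sub>0 > 0" by (simp add: c\<^sub>0_def)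
  define w where "w = (\<lambda>k. real (k + 1) * (cmod (fcoef F k))\<^sup>2)"
  define q where "q = (2::real) powr (1 - 2 * \<gamma>)"
  have "q < 2 powr 0" unfolding q_def using \<gamma> by (intro powr_less_mono) auto
  then have q: "0 < q" "q < 1" by (auto simp: q_def)
  obtain m\<^sub>0 where m0: "(1/2::real) ^ m\<^sub>0 < min \<epsilon> 1" using real_arch_pow_inv[of "min \<epsilon> 1" "1/2"] \<epsilon> by auto
  have block: "(\<Sum>k=2^m..<2^Suc m. w k) \<le> 2 * C\<^sup>2 / c\<^sub>0 * q ^ m" if "m\<^sub>0 \<le> m" for m
  proof -
    define h where "h = (1/2::real) ^ m"
    have "h \<le> (1/2::real) ^ m\<^sub>0" unfolding h_def using that by (intro power_decreasing) auto
    moreover have "(1/2::real) ^ m\<^sub>0 < \<epsilon>" "(1/2::real) ^ m\<^sub>0 < 1" using m0 by auto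
    moreover have "0 < h" by (simp add: h_def)
    ultimately have h: "0 < h" "h < \<epsilon>" "h \<le> 2 * pi" using pi_gt3 by linarith+
    have "bounded_symbol (\<lambda>t. F (t + h) - F t) (M + M)"
      by (intro bounded_symbol_diff bounded_symbol_shift F)
    then interpret D: bounded_symbol "\<lambda>t. F (t + h) - F t" "M + M" .
    have coef: "fcoef (\<lambda>t. F (t + h) - F t) k = (cis (real k * h) - 1) * fcoef F k" for k
      using fcoef_diff[OF bounded_symbol_shift[OF F, of h] F] fcoef_shift[OF per, of h] h
      by (simp add: left_diff_distrib)
    have "(\<Sum>k<2^Suc m. (cmod (fcoef (\<lambda>t. F (t + h) - F t) k))\<^sup>2) \<le> (C * h powr \<gamma>)\<^sup>2"
    proof (rule D.bessel_sup)
      show "finite (X \<union> (\<lambda>t. t - h) ` X)" using X by simp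
      fix t assume t: "t \<in> {0..2 * pi}" "t \<notin> X \<union> (\<lambda>t. t - h) ` X"
      then have "t + h \<notin> X" by (metis UnCI add_diff_cancel_right' imageI)
      then have "cmod (F t - F (t + h)) \<le> C * (t + h - t) powr \<gamma>"
        using t h by (intro holder) auto
      then show "cmod (F (t + h) - F t) \<le> C * h powr \<gamma>" by (simp add: norm_minus_commute)
    qed
    moreover have "(\<Sum>k=2^m..<2^Suc m. c\<^sub>0 * (cmod (fcoef F k))\<^sup>2)
        \<le> (\<Sum>k<2^Suc m. (cmod (fcoef (\<lambda>t. F (t + h) - F t) k))\<^sup>2)"
    proof (rule order.trans[OF sum_mono sum_mono2])
      fix k assume k: "k \<in> {2^m..<2^Suc m::nat}"
      define x where "x = real k * h"
      have "real (2 ^ m) * h \<le> x" "x < real (2 ^ Suc m) * h"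
        unfolding x_def using k h by (auto intro!: mult_right_mono mult_strict_right_mono simp del: of_nat_power power_Suc)
      moreover have "real (2 ^ m) * h = 1" "real (2 ^ Suc m) * h = 2"
        by (simp_all add: h_def power_one_over)
      ultimately have x: "1 \<le> x" "x \<le> 2" by auto
      have "cos x \<le> cos 1" using x pi_gt3 by (intro cos_monotone_0_pi_le) auto
      moreover have "(cmod (cis x - 1))\<^sup>2 = 2 - 2 * cos x"
      proof -
        have "(cmod (cis x - 1))\<^sup>2 = (cos x - 1)\<^sup>2 + (sin x)\<^sup>2" by (simp add: cmod_power2)
        then show ?thesis using sin_cos_squared_add[of x] by (simp add: power2_diff)
      qed
      ultimately have "c\<^sub>0 \<le> (cmod (cis x - 1))\<^sup>2" by (simp add: c\<^sub>0_def)
      then show "c\<^sub>0 * (cmod (fcoef F k))\<^sup>2 \<le> (cmod (fcoef (\<lambda>t. F (t + h) - F t) k))\<^sup>2"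
        unfolding coef norm_mult power_mult_distrib x_def by (intro mult_right_mono) auto
    qed auto
    moreover have "(C * h powr \<gamma>)\<^sup>2 = C\<^sup>2 * (2 powr (- 2 * \<gamma>)) ^ m"
    proof -
      have "h = 2 powr (- real m)" by (simp add: h_def powr_minus powr_realpow power_one_over inverse_eq_divide)
      then have "(h powr \<gamma>)\<^sup>2 = 2 powr (- real m * \<gamma>) * 2 powr (- real m * \<gamma>)"
        by (simp add: powr_powr power2_eq_square)
      also have "\<dots> = 2 powr ((- 2 * \<gamma>) * real m)"
        unfolding powr_add[symmetric] by (simp add: algebra_simps)
      also have "\<dots> = (2 powr (- 2 * \<gamma>)) powr real m" by (simp add: powr_powr)
      also have "\<dots> = (2 powr (- 2 * \<gamma>)) ^ m" by (rule powr_realpow) simp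
      finally show ?thesis by (simp add: power_mult_distrib)
    qed
    ultimately have "c\<^sub>0 * (\<Sum>k=2^m..<2^Suc m. (cmod (fcoef F k))\<^sup>2) \<le> C\<^sup>2 * (2 powr (- 2 * \<gamma>)) ^ m"
      by (simp add: sum_distrib_left)
    then have le: "(\<Sum>k=2^m..<2^Suc m. (cmod (fcoef F k))\<^sup>2) \<le> C\<^sup>2 * (2 powr (- 2 * \<gamma>)) ^ m / c\<^sub>0"
      using c0 by (simp add: pos_le_divide_eq mult.commute)
    have "(\<Sum>k=2^m..<2^Suc m. w k) \<le> (\<Sum>k=2^m..<2^Suc m. 2 ^ Suc m * (cmod (fcoef F k))\<^sup>2)"
    proof (rule sum_mono)
      fix k assume "k \<in> {2^m..<2^Suc m::nat}"
      then have "k + 1 \<le> 2 ^ Suc m" by simp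
      then have "real (k + 1) \<le> 2 ^ Suc m" by (metis of_nat_le_iff of_nat_numeral of_nat_power)
      then show "w k \<le> 2 ^ Suc m * (cmod (fcoef F k))\<^sup>2" unfolding w_def by (intro mult_right_mono) auto
    qed
    also have "\<dots> \<le> 2 ^ Suc m * (C\<^sup>2 * (2 powr (- 2 * \<gamma>)) ^ m / c\<^sub>0)"
      unfolding sum_distrib_left[symmetric] by (intro mult_left_mono le) auto
    also have "\<dots> = 2 * C\<^sup>2 / c\<^sub>0 * (2 * 2 powr (- 2 * \<gamma>)) ^ m" by (simp add: power_mult_distrib)
    also have "2 * 2 powr (- 2 * \<gamma>) = q"
      using powr_add[of 2 1 "- 2 * \<gamma>"] by (simp add: q_def)
    finally show ?thesis .
  qed
  define K where "K = (\<Sum>k<2^m\<^sub>0. w k) + 2 * C\<^sup>2 / c\<^sub>0 * (1 / (1 - q))"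
  have dyadic: "(\<Sum>k<2^(m\<^sub>0 + j). w k) \<le> (\<Sum>k<2^m\<^sub>0. w k) + 2 * C\<^sup>2 / c\<^sub>0 * (\<Sum>i<j. q ^ (m\<^sub>0 + i))" for j
  proof (induction j)
    case (Suc j)
    define a b :: nat where "a = 2 ^ (m\<^sub>0 + j)" and "b = 2 ^ Suc (m\<^sub>0 + j)"
    have "a \<le> b" by (simp add: a_def b_def)
    then have split: "{..<b} = {..<a} \<union> {a..<b}" by auto
    have "(\<Sum>k<b. w k) = (\<Sum>k<a. w k) + (\<Sum>k=a..<b. w k)"
      unfolding split by (rule sum.union_disjoint) auto
    also have "\<dots> \<le> (\<Sum>k<2^m\<^sub>0. w k) + 2 * C\<^sup>2 / c\<^sub>0 * (\<Sum>i<j. q ^ (m\<^sub>0 + i)) + 2 * C\<^sup>2 / c\<^sub>0 * q ^ (m\<^sub>0 + j)"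
      unfolding a_def b_def by (intro add_mono Suc block) simp
    also have "\<dots> = (\<Sum>k<2^m\<^sub>0. w k) + 2 * C\<^sup>2 / c\<^sub>0 * (\<Sum>i<Suc j. q ^ (m\<^sub>0 + i))"
      by (simp add: distrib_left)
    finally show ?case by (simp add: b_def)
  qed simp
  have "(\<Sum>k<n. w k) \<le> K" for n
  proof -
    have "(\<Sum>k<n. w k) \<le> (\<Sum>k<2^(m\<^sub>0 + n). w k)"
    proof (rule sum_mono2)
      have "n \<le> 2 ^ n" using less_exp[of n] by simp
      also have "\<dots> \<le> 2 ^ (m\<^sub>0 + n)" by (intro power_increasing) auto
      finally show "{..<n} \<subseteq> {..<2 ^ (m\<^sub>0 + n)}" by auto
    qed (auto simp: w_def)
    also have "\<dots> \<le> (\<Sum>k<2^m\<^sub>0. w k) + 2 * C\<^sup>2 / c\<^sub>0 * (\<Sum>i<n. q ^ (m\<^sub>0 + i))" by (rule dyadic)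
    also have "(\<Sum>i<n. q ^ (m\<^sub>0 + i)) \<le> (\<Sum>i<n. q ^ i)"
      using q by (intro sum_mono power_decreasing) auto
    also have "(\<Sum>i<n. q ^ i) \<le> 1 / (1 - q)"
      using q by (simp add: sum_gp_strict divide_right_mono)
    finally show ?thesis using c0 by (simp add: K_def mult_left_mono divide_right_mono)
  qed
  then show ?thesis unfolding w_def by blast
qed

text \<open>The weight \<open>k + 1\<close> is the number of entries on the \<open>k\<close>-th antidiagonal of a Hankel matrix. The
  trace needs the Cauchy--Schwarz inequality with the weights \<open>i + 1\<close>.\<close>

lemma hankel_seq_negligible:
  assumes K: "\<And>n. (\<Sum>k<n. real (k + 1) * (cmod (e k))\<^sup>2) \<le> K"
  shows "hs_bounded (hankel_seq e)" "tr (hankel_seq e) \<triangleq> (\<lambda>_. 0)"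
proof -
  show "hs_bounded (hankel_seq e)"
  proof (rule hs_boundedI)
    fix N i j :: nat
    assume "i < N" "j < N"
    then show "(cmod (entry (hankel_seq e) N i j))\<^sup>2 \<le> (cmod (e (i + j)))\<^sup>2" by simp
  next
    fix N :: nat
    have fin: "finite {(i, j). i + j < 2 * N}"
      by (rule finite_subset[of _ "{..<2 * N} \<times> {..<2 * N}"]) auto
    have "(\<Sum>i<N. \<Sum>j<N. (cmod (e (i + j)))\<^sup>2) = (\<Sum>(i, j)\<in>{..<N} \<times> {..<N}. (cmod (e (i + j)))\<^sup>2)"
      by (rule sum.cartesian_product)
    also have "\<dots> \<le> (\<Sum>(i, j)\<in>{(i, j). i + j < 2 * N}. (cmod (e (i + j)))\<^sup>2)"
      by (rule sum_mono2[OF fin]) auto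
    also have "\<dots> = (\<Sum>k<2 * N. \<Sum>i\<le>k. (cmod (e (i + (k - i))))\<^sup>2)"
      by (rule sum.triangle_reindex)
    also have "\<dots> = (\<Sum>k<2 * N. real (k + 1) * (cmod (e k))\<^sup>2)" by (intro sum.cong refl) simp
    finally show "(\<Sum>i<N. \<Sum>j<N. (cmod (e (i + j)))\<^sup>2) \<le> K" using K[of "2 * N"] by linarith
  qed
  have "cmod (tr (hankel_seq e) N - 0) \<le> sqrt K * sqrt (harm N)" for N
  proof -
    have "tr (hankel_seq e) N = (\<Sum>i<N. e (2 * i))" by (simp add: tr_def mult_2)
    also have "cmod \<dots> \<le> (\<Sum>i<N. \<bar>sqrt (real i + 1) * cmod (e (2 * i))\<bar> * \<bar>1 / sqrt (real i + 1)\<bar>)"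
      by (rule sum_norm_le) (simp add: abs_mult)
    also have "\<dots> \<le> L2_set (\<lambda>i. sqrt (real i + 1) * cmod (e (2 * i))) {..<N} * L2_set (\<lambda>i. 1 / sqrt (real i + 1)) {..<N}"
      by (rule L2_set_mult_ineq)
    also have "\<dots> \<le> sqrt K * sqrt (harm N)"
    proof (rule mult_mono)
      have "(\<Sum>i<N. (sqrt (real i + 1) * cmod (e (2 * i)))\<^sup>2) \<le> (\<Sum>i<N. real (2 * i + 1) * (cmod (e (2 * i)))\<^sup>2)"
        by (intro sum_mono) (simp add: power_mult_distrib mult_right_mono)
      also have "\<dots> = (\<Sum>k\<in>(\<lambda>i. 2 * i) ` {..<N}. real (k + 1) * (cmod (e k))\<^sup>2)"
        by (subst sum.reindex) (auto simp: inj_on_def)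
      also have "\<dots> \<le> (\<Sum>k<2 * N. real (k + 1) * (cmod (e k))\<^sup>2)" by (rule sum_mono2) auto
      finally show "L2_set (\<lambda>i. sqrt (real i + 1) * cmod (e (2 * i))) {..<N} \<le> sqrt K"
        unfolding L2_set_def using K[of "2 * N"] by (intro real_sqrt_le_mono) linarith
      show "L2_set (\<lambda>i. 1 / sqrt (real i + 1)) {..<N} \<le> sqrt (harm N)"
        unfolding L2_set_def by (intro real_sqrt_le_mono) (simp add: power_divide harm_eq_sum)
    qed (use K[of 0] in \<open>auto simp: L2_set_nonneg\<close>)
    finally show ?thesis by simp
  qed
  then show "tr (hankel_seq e) \<triangleq> (\<lambda>_. 0)"
    unfolding seq_equiv_def negligible_seq_def by blast
qed

section \<open>The model jump\<close>

text \<open>The jump function at \<open>1\<close> of height \<open>1\<close>, modulated so that its Hankel matrix is exactly a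
  multiple of the Hilbert matrix.\<close>

definition model_jump :: "real \<Rightarrow> complex"
  where "model_jump t = cis (- t) * of_real (1 - 2 * frac (t / (2 * pi)))"

lemma model_jump_bounded: "bounded_symbol model_jump 1"
proof
  show "model_jump \<in> borel_measurable borel"
    unfolding model_jump_def[abs_def] frac_def by measurable
  fix t :: real
  have "\<bar>1 - 2 * frac (t / (2 * pi))\<bar> \<le> 1"
    using frac_ge_0[of "t / (2 * pi)"] frac_lt_1[of "t / (2 * pi)"] by linarith
  then show "cmod (model_jump t) \<le> 1"
    unfolding model_jump_def norm_mult norm_cis norm_of_real by simp
qed

lemma model_jump_periodic: "model_jump (t + 2 * pi) = model_jump t"
proof -
  have "(t + 2 * pi) / (2 * pi) = t / (2 * pi) + 1" by (simp add: field_simps)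
  moreover have "cis (- (t + 2 * pi)) = cis (- t)"
    using cis_mult[of "- t" "- (2 * pi)"] by (simp add: cis_cnj[symmetric])
  ultimately show ?thesis by (simp add: model_jump_def frac_1_eq)
qed

lemma fcoef_model_jump: "fcoef model_jump k = - \<i> / of_real pi * (1 / of_nat (k + 1))"
proof -
  have "((\<lambda>t. - \<i> / of_real pi * (\<i> * of_real (pi - t) * cis (- (real_of_int (int k + 1) * t)))) has_integral
      - \<i> / of_real pi * (2 * of_real pi / of_int (int k + 1))) {0..2 * pi}"
    using sawtooth_coeff[of "int k + 1"] by (intro has_integral_mult_right) simp
  then have "((\<lambda>t. model_jump t * cis (- (real k * t))) has_integral
      - \<i> / of_real pi * (2 * of_real pi / of_int (int k + 1))) {0..2 * pi}"
  proof (rule has_integral_spike_finite[of "{2 * pi}", rotated 2])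
    fix t assume "t \<in> {0..2 * pi} - {2 * pi}"
    then have "frac (t / (2 * pi)) = t / (2 * pi)" by (intro frac_eq_id) auto
    then have "model_jump t * cis (- (real k * t)) = of_real (1 - t / pi) * (cis (- t) * cis (- (real k * t)))"
      by (simp add: model_jump_def mult_ac)
    also have "cis (- t) * cis (- (real k * t)) = cis (- (real_of_int (int k + 1) * t))"
      by (simp add: cis_mult algebra_simps)
    finally show "model_jump t * cis (- (real k * t))
        = - \<i> / of_real pi * (\<i> * of_real (pi - t) * cis (- (real_of_int (int k + 1) * t)))"
      by (simp add: diff_divide_distrib algebra_simps)
  qed simp
  then show ?thesis by (simp add: fcoef_def integral_unique add.commute)
qed

lemma fcoef_model_jump_shift:
  assumes "0 \<le> \<alpha>" "\<alpha> \<le> 2 * pi"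
  shows "fcoef (\<lambda>t. model_jump (t - \<alpha>)) k = cnj (cis \<alpha>) ^ k * fcoef model_jump k"
proof -
  have "bounded_symbol (\<lambda>t. model_jump (t - \<alpha>)) 1"
    using bounded_symbol_shift[OF model_jump_bounded, of "- \<alpha>"] by simp
  then interpret bounded_symbol "\<lambda>t. model_jump (t - \<alpha>)" 1 .
  have "fcoef model_jump k = cis (real k * \<alpha>) * fcoef (\<lambda>t. model_jump (t - \<alpha>)) k"
    using fcoef_shift[of \<alpha> k] assms model_jump_periodic[of "_ - \<alpha>"] by (simp add: diff_add_eq algebra_simps)
  moreover have "cnj (cis \<alpha>) ^ k * cis (real k * \<alpha>) = 1"
    by (simp add: cis_cnj Complex.DeMoivre cis_mult)
  ultimately show ?thesis by (simp add: mult.assoc[symmetric])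
qed

section \<open>Piecewise Hoelder functions\<close>

text \<open>One-sided Hoelder continuity near \<open>\<theta>\<close>, with a jump of size \<open>d\<close> between the one-sided limits. The
  inequalities are strict because \<open>F \<theta>\<close> is arbitrary.\<close>

definition jump_holder :: "real \<Rightarrow> (real \<Rightarrow> complex) \<Rightarrow> real \<Rightarrow> complex \<Rightarrow> bool"
  where "jump_holder \<gamma> F \<theta> d \<longleftrightarrow> (\<exists>\<delta>>0. \<exists>C\<ge>0. \<exists>l r. r - l = d \<and>
    (\<forall>s t. \<theta> < s \<longrightarrow> s < t \<longrightarrow> t < \<theta> + \<delta> \<longrightarrow> cmod (F s - F t) \<le> C * (t - s) powr \<gamma>) \<and>
    (\<forall>s t. \<theta> - \<delta> < s \<longrightarrow> s < t \<longrightarrow> t < \<theta> \<longrightarrow> cmod (F s - F t) \<le> C * (t - s) powr \<gamma>) \<and>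
    (F \<longlongrightarrow> l) (at_left \<theta>) \<and> (F \<longlongrightarrow> r) (at_right \<theta>))"

lemma jump_holder_zero: "jump_holder \<gamma> (\<lambda>_. 0) \<theta> 0"
  unfolding jump_holder_def by (rule exI[of _ 1], simp, rule exI[of _ 0], auto intro!: exI[of _ 0])

lemma jump_holder_combine:
  assumes "jump_holder \<gamma> F \<theta> d" "jump_holder \<gamma> G \<theta> d'"
  shows "jump_holder \<gamma> (\<lambda>t. F t + c * G t) \<theta> (d + c * d')"
proof -
  obtain \<delta> C l r where F: "\<delta> > 0" "C \<ge> 0" "r - l = d"
    "\<And>s t. \<theta> < s \<Longrightarrow> s < t \<Longrightarrow> t < \<theta> + \<delta> \<Longrightarrow> cmod (F s - F t) \<le> C * (t - s) powr \<gamma>"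
    "\<And>s t. \<theta> - \<delta> < s \<Longrightarrow> s < t \<Longrightarrow> t < \<theta> \<Longrightarrow> cmod (F s - F t) \<le> C * (t - s) powr \<gamma>"
    "(F \<longlongrightarrow> l) (at_left \<theta>)" "(F \<longlongrightarrow> r) (at_right \<theta>)"
    using assms(1) unfolding jump_holder_def by metis
  obtain \<delta>' C' l' r' where G: "\<delta>' > 0" "C' \<ge> 0" "r' - l' = d'"
    "\<And>s t. \<theta> < s \<Longrightarrow> s < t \<Longrightarrow> t < \<theta> + \<delta>' \<Longrightarrow> cmod (G s - G t) \<le> C' * (t - s) powr \<gamma>"
    "\<And>s t. \<theta> - \<delta>' < s \<Longrightarrow> s < t \<Longrightarrow> t < \<theta> \<Longrightarrow> cmod (G s - G t) \<le> C' * (t - s) powr \<gamma>"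
    "(G \<longlongrightarrow> l') (at_left \<theta>)" "(G \<longlongrightarrow> r') (at_right \<theta>)"
    using assms(2) unfolding jump_holder_def by metis
  have le: "cmod ((F s + c * G s) - (F t + c * G t)) \<le> (C + cmod c * C') * (t - s) powr \<gamma>"
    if "cmod (F s - F t) \<le> C * (t - s) powr \<gamma>" "cmod (G s - G t) \<le> C' * (t - s) powr \<gamma>" for s t
  proof -
    have "(F s + c * G s) - (F t + c * G t) = (F s - F t) + c * (G s - G t)" by (simp add: algebra_simps)
    then have "cmod ((F s + c * G s) - (F t + c * G t)) \<le> cmod (F s - F t) + cmod c * cmod (G s - G t)"
      by (metis norm_mult norm_triangle_ineq)
    also have "\<dots> \<le> C * (t - s) powr \<gamma> + cmod c * (C' * (t - s) powr \<gamma>)"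
      using that by (intro add_mono mult_left_mono) auto
    finally show ?thesis by (simp add: algebra_simps)
  qed
  show ?thesis
    unfolding jump_holder_def
  proof (intro exI conjI allI impI)
    show "min \<delta> \<delta>' > 0" "C + cmod c * C' \<ge> 0" using F G by auto
    show "(r + c * r') - (l + c * l') = d + c * d'" using F(3) G(3) by (auto simp: algebra_simps)
    show "cmod ((F s + c * G s) - (F t + c * G t)) \<le> (C + cmod c * C') * (t - s) powr \<gamma>"
      if "\<theta> < s" "s < t" "t < \<theta> + min \<delta> \<delta>'" for s t
      using that by (intro le F(4) G(4)) auto
    show "cmod ((F s + c * G s) - (F t + c * G t)) \<le> (C + cmod c * C') * (t - s) powr \<gamma>"
      if "\<theta> - min \<delta> \<delta>' < s" "s < t" "t < \<theta>" for s t
      using that by (intro le F(5) G(5)) auto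
    show "((\<lambda>t. F t + c * G t) \<longlongrightarrow> l + c * l') (at_left \<theta>)"
      "((\<lambda>t. F t + c * G t) \<longlongrightarrow> r + c * r') (at_right \<theta>)"
      by (intro tendsto_intros F G)+
  qed
qed

lemma jump_holder_sum:
  assumes "finite S" "\<And>z. z \<in> S \<Longrightarrow> jump_holder \<gamma> (F z) \<theta> (d z)"
  shows "jump_holder \<gamma> (\<lambda>t. \<Sum>z\<in>S. c z * F z t) \<theta> (\<Sum>z\<in>S. c z * d z)"
  using assms
proof (induction S rule: finite_induct)
  case (insert z S)
  have "jump_holder \<gamma> (\<lambda>t. (\<Sum>z\<in>S. c z * F z t) + c z * F z t) \<theta> ((\<Sum>z\<in>S. c z * d z) + c z * d z)"
    by (intro jump_holder_combine insert) (use insert in auto)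
  then show ?case using insert by (simp add: add.commute)
qed (simp add: jump_holder_zero)

text \<open>Without a jump, the estimates on the two sides combine through the common limit.\<close>

lemma jump_holder_continuous:
  assumes "jump_holder \<gamma> F \<theta> 0" "0 < \<gamma>"
  shows "\<exists>\<delta>>0. \<exists>C\<ge>0. \<forall>s t. \<theta> - \<delta> < s \<longrightarrow> s < t \<longrightarrow> t < \<theta> + \<delta> \<longrightarrow> s \<noteq> \<theta> \<longrightarrow> t \<noteq> \<theta> \<longrightarrow>
    cmod (F s - F t) \<le> C * (t - s) powr \<gamma>"
proof -
  obtain \<delta> C l where F: "\<delta> > 0" "C \<ge> 0"
    "\<And>s t. \<theta> < s \<Longrightarrow> s < t \<Longrightarrow> t < \<theta> + \<delta> \<Longrightarrow> cmod (F s - F t) \<le> C * (t - s) powr \<gamma>"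
    "\<And>s t. \<theta> - \<delta> < s \<Longrightarrow> s < t \<Longrightarrow> t < \<theta> \<Longrightarrow> cmod (F s - F t) \<le> C * (t - s) powr \<gamma>"
    "(F \<longlongrightarrow> l) (at_left \<theta>)" "(F \<longlongrightarrow> l) (at_right \<theta>)"
    using assms(1) unfolding jump_holder_def by (metis eq_iff_diff_eq_0)
  have left: "cmod (F s - l) \<le> C * (\<theta> - s) powr \<gamma>" if s: "\<theta> - \<delta> < s" "s < \<theta>" for s
  proof (rule tendsto_upperbound)
    show "((\<lambda>t. cmod (F s - F t)) \<longlongrightarrow> cmod (F s - l)) (at_left \<theta>)" by (intro tendsto_intros F)
    have "eventually (\<lambda>t. t \<in> {s<..<\<theta>}) (at_left \<theta>)" using s by (simp add: eventually_at_left_field) (metis)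
    then show "\<forall>\<^sub>F t in at_left \<theta>. cmod (F s - F t) \<le> C * (\<theta> - s) powr \<gamma>"
    proof (rule eventually_mono)
      fix t assume t: "t \<in> {s<..<\<theta>}"
      have "cmod (F s - F t) \<le> C * (t - s) powr \<gamma>" using t s by (intro F) auto
      also have "\<dots> \<le> C * (\<theta> - s) powr \<gamma>" using t F(2) assms(2) by (intro mult_left_mono powr_mono2) auto
      finally show "cmod (F s - F t) \<le> C * (\<theta> - s) powr \<gamma>" .
    qed
  qed simp
  have right: "cmod (F t - l) \<le> C * (t - \<theta>) powr \<gamma>" if t: "\<theta> < t" "t < \<theta> + \<delta>" for t
  proof (rule tendsto_upperbound)
    show "((\<lambda>s. cmod (F t - F s)) \<longlongrightarrow> cmod (F t - l)) (at_right \<theta>)" by (intro tendsto_intros F)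
    have "eventually (\<lambda>s. s \<in> {\<theta><..<t}) (at_right \<theta>)" using t by (simp add: eventually_at_right_field) (metis)
    then show "\<forall>\<^sub>F s in at_right \<theta>. cmod (F t - F s) \<le> C * (t - \<theta>) powr \<gamma>"
    proof (rule eventually_mono)
      fix s assume s: "s \<in> {\<theta><..<t}"
      have "cmod (F s - F t) \<le> C * (t - s) powr \<gamma>" using t s by (intro F) auto
      also have "\<dots> \<le> C * (t - \<theta>) powr \<gamma>" using s F(2) assms(2) by (intro mult_left_mono powr_mono2) auto
      finally show "cmod (F t - F s) \<le> C * (t - \<theta>) powr \<gamma>" by (simp add: norm_minus_commute)
    qed
  qed simp
  have "cmod (F s - F t) \<le> (2 * C) * (t - s) powr \<gamma>"
    if st: "\<theta> - \<delta> < s" "s < t" "t < \<theta> + \<delta>" "s \<noteq> \<theta>" "t \<noteq> \<theta>" for s t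
  proof -
    have nonneg: "0 \<le> C * (t - s) powr \<gamma>" using F(2) by simp
    consider "\<theta> < s" | "t < \<theta>" | "s < \<theta>" "\<theta> < t" using st by linarith
    then show ?thesis
    proof cases
      case 1
      then have "cmod (F s - F t) \<le> C * (t - s) powr \<gamma>" using st by (intro F) auto
      then show ?thesis using nonneg by simp
    next
      case 2
      then have "cmod (F s - F t) \<le> C * (t - s) powr \<gamma>" using st by (intro F) auto
      then show ?thesis using nonneg by simp
    next
      case 3
      have "cmod (F s - F t) \<le> cmod (F s - l) + cmod (F t - l)"
        using norm_triangle_ineq4[of "F s - l" "F t - l"] by simp
      also have "\<dots> \<le> C * (\<theta> - s) powr \<gamma> + C * (t - \<theta>) powr \<gamma>"
        using st 3 by (intro add_mono left right) auto
      also have "\<dots> \<le> C * (t - s) powr \<gamma> + C * (t - s) powr \<gamma>"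
        using 3 F(2) assms(2) by (intro add_mono mult_left_mono powr_mono2) auto
      finally show ?thesis by simp
    qed
  qed
  moreover have "2 * C \<ge> 0" using F(2) by simp
  ultimately show ?thesis using F(1) by blast
qed

text \<open>The centres of finitely many intervals that cover \<open>[a, b]\<close> form the exceptional set, and a
  Lebesgue number of the cover serves as \<open>\<epsilon>\<close>.\<close>

lemma uniform_holder:
  assumes "\<And>\<theta>. jump_holder \<gamma> F \<theta> 0" "0 < \<gamma>"
  obtains \<epsilon> C X where "0 < \<epsilon>" "0 \<le> C" "finite X"
    "\<And>s t. s \<in> {a..b} \<Longrightarrow> s \<notin> X \<Longrightarrow> t \<notin> X \<Longrightarrow> s < t \<Longrightarrow> t < s + \<epsilon> \<Longrightarrow> cmod (F s - F t) \<le> C * (t - s) powr \<gamma>"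
proof -
  have "\<forall>\<theta>. \<exists>\<delta> C. \<delta> > 0 \<and> C \<ge> 0 \<and> (\<forall>s t. \<theta> - \<delta> < s \<longrightarrow> s < t \<longrightarrow> t < \<theta> + \<delta> \<longrightarrow> s \<noteq> \<theta> \<longrightarrow> t \<noteq> \<theta> \<longrightarrow>
    cmod (F s - F t) \<le> C * (t - s) powr \<gamma>)"
    using jump_holder_continuous[OF assms] by meson
  then obtain \<delta> C where \<delta>: "\<And>\<theta>. \<delta> \<theta> > 0" and C: "\<And>\<theta>. C \<theta> \<ge> (0::real)"
    and le: "\<And>\<theta> s t. \<theta> - \<delta> \<theta> < s \<Longrightarrow> s < t \<Longrightarrow> t < \<theta> + \<delta> \<theta> \<Longrightarrow> s \<noteq> \<theta> \<Longrightarrow> t \<noteq> \<theta> \<Longrightarrow>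
      cmod (F s - F t) \<le> C \<theta> * (t - s) powr \<gamma>"
    by metis
  have cover: "{a..b} \<subseteq> (\<Union>\<theta>\<in>UNIV. ball \<theta> (\<delta> \<theta>))" using \<delta> centre_in_ball by blast
  obtain X where X: "finite X" "{a..b} \<subseteq> (\<Union>\<theta>\<in>X. ball \<theta> (\<delta> \<theta>))"
  proof (rule compactE_image[OF compact_Icc[of a b] open_ball cover])
    fix Y assume "finite Y" "{a..b} \<subseteq> (\<Union>\<theta>\<in>Y. ball \<theta> (\<delta> \<theta>))"
    then show thesis by (rule that)
  qed
  obtain \<epsilon> where \<epsilon>: "0 < \<epsilon>" "\<And>x. x \<in> {a..b} \<Longrightarrow> \<exists>G \<in> (\<lambda>\<theta>. ball \<theta> (\<delta> \<theta>)) ` X. ball x \<epsilon> \<subseteq> G"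
  proof (rule Heine_Borel_lemma[OF compact_Icc[of a b]])
    show "{a..b} \<subseteq> \<Union>((\<lambda>\<theta>. ball \<theta> (\<delta> \<theta>)) ` X)" using X by simp
    show "open G" if "G \<in> (\<lambda>\<theta>. ball \<theta> (\<delta> \<theta>)) ` X" for G using that by auto
    fix e assume "0 < e" "\<And>x. x \<in> {a..b} \<Longrightarrow> \<exists>G \<in> (\<lambda>\<theta>. ball \<theta> (\<delta> \<theta>)) ` X. ball x e \<subseteq> G"
    then show thesis by (rule that)
  qed
  show ?thesis
  proof (rule that[of \<epsilon> "\<Sum>\<theta>\<in>X. C \<theta>" X])
    show "0 \<le> (\<Sum>\<theta>\<in>X. C \<theta>)" by (intro sum_nonneg C)
    fix s t assume st: "s \<in> {a..b}" "s \<notin> X" "t \<notin> X" "s < t" "t < s + \<epsilon>"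
    obtain \<theta> where \<theta>: "\<theta> \<in> X" "ball s \<epsilon> \<subseteq> ball \<theta> (\<delta> \<theta>)" using \<epsilon>(2)[OF st(1)] by auto
    have "s \<in> ball s \<epsilon>" "t \<in> ball s \<epsilon>" using st \<epsilon>(1) by (auto simp: dist_real_def)
    then have "s \<in> ball \<theta> (\<delta> \<theta>)" "t \<in> ball \<theta> (\<delta> \<theta>)" using \<theta>(2) by blast+
    then have "cmod (F s - F t) \<le> C \<theta> * (t - s) powr \<gamma>"
      using st \<theta>(1) by (intro le) (auto simp: dist_real_def)
    also have "\<dots> \<le> (\<Sum>\<theta>\<in>X. C \<theta>) * (t - s) powr \<gamma>"
      using \<theta>(1) X(1) C by (intro mult_right_mono member_le_sum) auto
    finally show "cmod (F s - F t) \<le> (\<Sum>\<theta>\<in>X. C \<theta>) * (t - s) powr \<gamma>" .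
  qed (use \<epsilon> X in auto)
qed

lemma cmod_cis_diff_le: "cmod (cis s - cis t) \<le> \<bar>s - t\<bar>"
proof -
  have "cis s - cis t = cis t * (exp (\<i> * of_real (s - t)) - 1)"
    unfolding cis_conv_exp[of "s - t", symmetric] by (simp add: right_diff_distrib cis_mult)
  then have "cmod (cis s - cis t) = 2 * \<bar>sin ((s - t) / 2)\<bar>"
    by (simp only: norm_mult norm_cis dist_exp_i_1 mult_1)
  also have "\<dots> \<le> 2 * \<bar>(s - t) / 2\<bar>" by (intro mult_left_mono abs_sin_x_le_abs_x) simp
  finally show ?thesis by simp
qed

lemma cis_eq_cis_iff: "cis s = cis t \<longleftrightarrow> (s - t) / (2 * pi) \<in> \<int>"
proof -
  have "cis s = cis t \<longleftrightarrow> (\<exists>n::int. s = t + 2 * pi * n)"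
    using sin_cos_eq_iff[of s t] by (auto simp: complex_eq_iff)
  also have "\<dots> \<longleftrightarrow> (s - t) / (2 * pi) \<in> \<int>"
    by (auto simp: Ints_def field_simps)
  finally show ?thesis .
qed

text \<open>On every period cell the model jump is an explicit smooth function \<open>Q m\<close>. The cells adjacent to
  \<open>\<theta>\<close> on the left and on the right are different exactly if \<open>\<theta>\<close> is congruent to \<open>\<alpha>\<close>.\<close>

lemma jump_holder_model_jump:
  assumes \<gamma>: "0 < \<gamma>" "\<gamma> \<le> 1"
  shows "jump_holder \<gamma> (\<lambda>t. model_jump (t - \<alpha>)) \<theta> (if cis \<theta> = cis \<alpha> then 2 else 0)"
proof -
  define x where "x = (\<lambda>t. (t - \<alpha>) / (2 * pi))"
  have x_less: "x s < x t \<longleftrightarrow> s < t" for s t by (simp add: x_def field_simps)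
  define Q where "Q = (\<lambda>m::int. \<lambda>t. cis (- (t - \<alpha>)) * of_real (1 - 2 * (x t - of_int m)))"
  define n m where "n = \<lfloor>x \<theta>\<rfloor>" and "m = \<lceil>x \<theta>\<rceil> - 1"
  define \<delta> where "\<delta> = min 1 (min (2 * pi * (n + 1 - x \<theta>)) (2 * pi * (x \<theta> - m)))"
  have "x \<theta> < n + 1" "m < x \<theta>" unfolding n_def m_def by linarith+
  then have \<delta>: "0 < \<delta>" by (simp add: \<delta>_def)
  have x_diff: "x t - x s = (t - s) / (2 * pi)" for s t by (simp add: x_def diff_divide_distrib)
  have x_lt: "x t - x s < c" if "t - s < 2 * pi * c" for s t c
    unfolding x_diff using that by (simp add: field_simps)
  have cell_right: "\<lfloor>x t\<rfloor> = n" if "\<theta> < t" "t < \<theta> + \<delta>" for t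
  proof -
    have "x t - x \<theta> < n + 1 - x \<theta>" using that by (intro x_lt) (auto simp: \<delta>_def)
    moreover have "n \<le> x \<theta>" "x \<theta> < x t" using that by (auto simp: n_def x_less)
    ultimately show ?thesis by linarith
  qed
  have cell_left: "\<lfloor>x t\<rfloor> = m" if "\<theta> - \<delta> < t" "t < \<theta>" for t
  proof -
    have "x \<theta> - x t < x \<theta> - m" using that by (intro x_lt) (auto simp: \<delta>_def)
    moreover have "x \<theta> \<le> m + 1" "x t < x \<theta>" using that by (auto simp: m_def x_less)
    ultimately show ?thesis by linarith
  qed
  have model: "model_jump (t - \<alpha>) = Q \<lfloor>x t\<rfloor> t" for t
    by (simp add: model_jump_def Q_def x_def frac_def)
  have holder: "cmod (model_jump (s - \<alpha>) - model_jump (t - \<alpha>)) \<le> 2 * (t - s) powr \<gamma>"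
    if cell: "\<lfloor>x s\<rfloor> = \<lfloor>x t\<rfloor>" and st: "s < t" "t < s + 1" for s t
  proof -
    define b where "b = (\<lambda>t. 1 - 2 * (x t - of_int \<lfloor>x t\<rfloor>))"
    have b: "\<bar>b t\<bar> \<le> 1" for t
    proof -
      define y where "y = x t - of_int \<lfloor>x t\<rfloor>"
      have "0 \<le> y" "y < 1"
        unfolding y_def using of_int_floor_le[of "x t"] real_of_int_floor_add_one_gt[of "x t"] by linarith+
      then show ?thesis unfolding b_def y_def[symmetric] by (simp add: abs_le_iff)
    qed
    have m: "model_jump (t - \<alpha>) = cis (- (t - \<alpha>)) * of_real (b t)" for t
      by (simp add: model Q_def b_def)
    have "model_jump (s - \<alpha>) - model_jump (t - \<alpha>)
        = (cis (- (s - \<alpha>)) - cis (- (t - \<alpha>))) * of_real (b s) + cis (- (t - \<alpha>)) * of_real (b s - b t)"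
      unfolding m by (simp add: algebra_simps)
    then have "cmod (model_jump (s - \<alpha>) - model_jump (t - \<alpha>))
        \<le> cmod (cis (- (s - \<alpha>)) - cis (- (t - \<alpha>))) * \<bar>b s\<bar> + \<bar>b s - b t\<bar>"
      using norm_triangle_ineq[of "(cis (- (s - \<alpha>)) - cis (- (t - \<alpha>))) * of_real (b s)" "cis (- (t - \<alpha>)) * of_real (b s - b t)"]
      by (simp add: norm_mult del: of_real_diff)
    also have "\<dots> \<le> \<bar>- (s - \<alpha>) - - (t - \<alpha>)\<bar> * 1 + 2 * (x t - x s)"
    proof (rule add_mono)
      show "cmod (cis (- (s - \<alpha>)) - cis (- (t - \<alpha>))) * \<bar>b s\<bar> \<le> \<bar>- (s - \<alpha>) - - (t - \<alpha>)\<bar> * 1"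
        by (intro mult_mono cmod_cis_diff_le b) auto
      have "b s - b t = 2 * (x t - x s)" using cell by (simp add: b_def)
      moreover have "x s < x t" using st by (simp add: x_less)
      ultimately show "\<bar>b s - b t\<bar> \<le> 2 * (x t - x s)" by simp
    qed
    also have "\<dots> = (t - s) + (t - s) / pi" using st by (simp add: x_diff) (simp add: field_simps)
    also have "\<dots> \<le> 2 * (t - s)"
    proof -
      have "(t - s) / pi \<le> (t - s) / 1" using st pi_gt3 by (intro divide_left_mono) auto
      then show ?thesis by simp
    qed
    also have "\<dots> \<le> 2 * (t - s) powr \<gamma>"
      using powr_mono'[of \<gamma> 1 "t - s"] st \<gamma> by simp
    finally show ?thesis .
  qed
  have Q_cont: "isCont (Q k) \<theta>" for k
    unfolding Q_def x_def by (auto intro!: continuous_intros simp: cis_conv_exp)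
  have jump: "Q n \<theta> - Q m \<theta> = (if cis \<theta> = cis \<alpha> then 2 else 0)"
  proof -
    have "Q n \<theta> - Q m \<theta> = cis (- (\<theta> - \<alpha>)) * of_real (2 * (of_int n - of_int m))"
      by (simp add: Q_def algebra_simps)
    moreover have "n - m = (if x \<theta> \<in> \<int> then 1 else 0)"
    proof (cases "x \<theta> \<in> \<int>")
      case True
      then show ?thesis by (auto simp: n_def m_def elim: Ints_cases)
    next
      case False
      then have "x \<theta> \<noteq> of_int \<lfloor>x \<theta>\<rfloor>" by (metis Ints_of_int)
      then have "\<lceil>x \<theta>\<rceil> = \<lfloor>x \<theta>\<rfloor> + 1" by linarith
      then show ?thesis using False by (simp add: n_def m_def)
    qed
    moreover have "cis (- (\<theta> - \<alpha>)) = 1" if "cis \<theta> = cis \<alpha>"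
      using that cis_divide[of \<alpha> \<theta>] by (metis cis_zero divide_self minus_diff_eq norm_cis norm_zero zero_neq_one)
    moreover have "cis \<theta> = cis \<alpha> \<longleftrightarrow> x \<theta> \<in> \<int>" by (simp add: cis_eq_cis_iff x_def)
    ultimately show ?thesis by (auto simp flip: of_int_diff)
  qed
  show ?thesis
    unfolding jump_holder_def
  proof (intro exI conjI allI impI)
    show "Q n \<theta> - Q m \<theta> = (if cis \<theta> = cis \<alpha> then 2 else 0)" by (rule jump)
    show "0 < \<delta>" by (rule \<delta>)
    show "(0::real) \<le> 2" by simp
    have d1: "\<delta> \<le> 1" by (simp add: \<delta>_def)
    show "cmod (model_jump (s - \<alpha>) - model_jump (t - \<alpha>)) \<le> 2 * (t - s) powr \<gamma>"
      if "\<theta> < s" "s < t" "t < \<theta> + \<delta>" for s t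
      using that d1 cell_right[of s] cell_right[of t] by (intro holder) auto
    show "cmod (model_jump (s - \<alpha>) - model_jump (t - \<alpha>)) \<le> 2 * (t - s) powr \<gamma>"
      if "\<theta> - \<delta> < s" "s < t" "t < \<theta>" for s t
      using that d1 cell_left[of s] cell_left[of t] by (intro holder) auto
    show "((\<lambda>t. model_jump (t - \<alpha>)) \<longlongrightarrow> Q m \<theta>) (at_left \<theta>)"
    proof (rule Lim_transform_eventually)
      show "(Q m \<longlongrightarrow> Q m \<theta>) (at_left \<theta>)"
        using Q_cont[of m] by (simp add: isCont_def filterlim_at_split)
      have "eventually (\<lambda>t. t \<in> {\<theta> - \<delta><..<\<theta>}) (at_left \<theta>)"
        using \<delta> by (intro eventually_at_leftI[of "\<theta> - \<delta>"]) auto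
      then show "eventually (\<lambda>t. Q m t = model_jump (t - \<alpha>)) (at_left \<theta>)"
        by eventually_elim (simp add: model cell_left)
    qed
    show "((\<lambda>t. model_jump (t - \<alpha>)) \<longlongrightarrow> Q n \<theta>) (at_right \<theta>)"
    proof (rule Lim_transform_eventually)
      show "(Q n \<longlongrightarrow> Q n \<theta>) (at_right \<theta>)"
        using Q_cont[of n] by (simp add: isCont_def filterlim_at_split)
      have "eventually (\<lambda>t. t \<in> {\<theta><..<\<theta> + \<delta>}) (at_right \<theta>)"
        using \<delta> by (intro eventually_at_rightI[of _ "\<theta> + \<delta>"]) auto
      then show "eventually (\<lambda>t. Q n t = model_jump (t - \<alpha>)) (at_right \<theta>)"
        by eventually_elim (simp add: model cell_right)
    qed
  qed
qed

section \<open>Piecewise Hoelder symbols on the circle\<close>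

lemma PD_limits:
  assumes "f \<in> PD"
  shows "((\<lambda>t. f (cis t)) \<longlongrightarrow> limit_plus f (cis \<theta>)) (at_right \<theta>)"
    and "((\<lambda>t. f (cis t)) \<longlongrightarrow> limit_minus f (cis \<theta>)) (at_left \<theta>)"
proof -
  have "cis \<theta> \<in> unit_circle" by simp
  then obtain l r where l: "((\<lambda>\<epsilon>. f (cis \<epsilon> * cis \<theta>)) \<longlongrightarrow> r) (at_right 0)"
    "((\<lambda>\<epsilon>. f (cis (- \<epsilon>) * cis \<theta>)) \<longlongrightarrow> l) (at_right 0)"
    using assms unfolding PD_def by blast
  have "limit_plus f (cis \<theta>) = r" "limit_minus f (cis \<theta>) = l"
    unfolding limit_plus_def limit_minus_def using l by (auto intro!: tendsto_Lim)
  then show "((\<lambda>t. f (cis t)) \<longlongrightarrow> limit_plus f (cis \<theta>)) (at_right \<theta>)"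
    "((\<lambda>t. f (cis t)) \<longlongrightarrow> limit_minus f (cis \<theta>)) (at_left \<theta>)"
    using l unfolding filterlim_at_right_to_0[of _ _ \<theta>] filterlim_at_left_to_right
    by (simp_all add: filterlim_at_right_to_0[of _ _ "- \<theta>"] cis_mult)
qed

lemma PD_bound: "f \<in> PD \<Longrightarrow> cmod (f (cis t)) \<le> 1"
  unfolding PD_def by simp

lemma PD_finite: "f \<in> PD \<Longrightarrow> finite (jump_set f)"
  unfolding PD_def by simp

lemma cmod_jump_height_le:
  assumes f: "f \<in> PD" and z: "cmod z = 1"
  shows "cmod (jump_height f z) \<le> 1"
proof -
  obtain \<theta> where \<theta>: "z = cis \<theta>" using z complex_norm_eq_1_exp[of z] by (metis cis_conv_exp)
  have bound: "cmod l \<le> 1" if "((\<lambda>t. f (cis t)) \<longlongrightarrow> l) F" "F \<noteq> bot" for l F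
    using that PD_bound[OF f] by (intro tendsto_upperbound[OF tendsto_norm[OF that(1)]]) auto
  have "cmod (limit_plus f z) \<le> 1" "cmod (limit_minus f z) \<le> 1"
    unfolding \<theta> using bound PD_limits[OF f, of \<theta>] by (metis trivial_limit_at_right_real trivial_limit_at_left_real)+
  then show ?thesis
    unfolding jump_height_def using norm_triangle_ineq4[of "limit_plus f z" "limit_minus f z"]
    by (simp add: norm_divide)
qed

lemma jump_height_eq_0: "cmod z = 1 \<Longrightarrow> z \<notin> jump_set f \<Longrightarrow> jump_height f z = 0"
  by (simp add: jump_set_def jump_height_def)

text \<open>An open arc without jumps is connected, hence contained in a single component.\<close>

lemma arc_holder:
  assumes comp: "\<And>A. A \<in> components (unit_circle - jump_set f) \<Longrightarrow> arc_holder_on \<gamma> A f"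
    and free: "\<And>t. a < t \<Longrightarrow> t < b \<Longrightarrow> cis t \<notin> jump_set f"
  shows "\<exists>C\<ge>0. \<forall>s t. a < s \<longrightarrow> s \<le> t \<longrightarrow> t < b \<longrightarrow> cmod (f (cis s) - f (cis t)) \<le> C * (t - s) powr \<gamma>"
proof (cases "a < b")
  case False
  then show ?thesis by (intro exI[of _ 0]) auto
next
  case True
  have sub: "cis ` {a<..<b} \<subseteq> unit_circle - jump_set f" using free by auto
  moreover have "connected (cis ` {a<..<b})"
    by (intro connected_continuous_image continuous_intros) auto
  moreover have "unit_circle - jump_set f \<noteq> {}"
    using sub True dense by fastforce
  ultimately obtain A where A: "A \<in> components (unit_circle - jump_set f)" "cis ` {a<..<b} \<subseteq> A"
    using exists_component_superset by blast
  obtain C where C: "\<And>s t. s \<le> t \<Longrightarrow> cis ` {s..t} \<subseteq> A \<Longrightarrow> cmod (f (cis s) - f (cis t)) \<le> C * (t - s) powr \<gamma>"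
    using comp[OF A(1)] unfolding arc_holder_on_def by blast
  have "cmod (f (cis s) - f (cis t)) \<le> \<bar>C\<bar> * (t - s) powr \<gamma>" if "a < s" "s \<le> t" "t < b" for s t
  proof -
    have "cis ` {s..t} \<subseteq> A" using that A(2) by (auto intro!: subsetD[OF A(2)] imageI)
    then have "cmod (f (cis s) - f (cis t)) \<le> C * (t - s) powr \<gamma>" using that by (intro C)
    also have "\<dots> \<le> \<bar>C\<bar> * (t - s) powr \<gamma>" by (intro mult_right_mono) auto
    finally show ?thesis .
  qed
  then show ?thesis by (intro exI[of _ "\<bar>C\<bar>"]) auto
qed

lemma punctured_arc_avoiding_finite:
  assumes "finite \<Omega>"
  shows "\<exists>\<delta>>0. \<forall>t. t \<noteq> \<theta> \<longrightarrow> \<bar>t - \<theta>\<bar> < \<delta> \<longrightarrow> cis t \<notin> \<Omega>"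
proof -
  define T where "T = {x. -pi < x \<and> x < pi \<and> x \<noteq> 0 \<and> cis (\<theta> + x) \<in> \<Omega>}"
  have "inj_on (\<lambda>x. cis (\<theta> + x)) T"
  proof (rule inj_onI)
    fix x y assume xy: "x \<in> T" "y \<in> T" "cis (\<theta> + x) = cis (\<theta> + y)"
    then have "cis x = cis y" by (simp add: cis_mult[symmetric])
    moreover have "Arg (cis x) = x" "Arg (cis y) = y"
      using xy by (auto intro!: cis_Arg_unique simp: T_def)
    ultimately show "x = y" by metis
  qed
  moreover have "(\<lambda>x. cis (\<theta> + x)) ` T \<subseteq> \<Omega>" by (auto simp: T_def)
  ultimately have T: "finite T" using assms finite_imageD finite_subset by metis
  define \<delta> where "\<delta> = Min (insert pi (abs ` T))"
  have "\<delta> > 0" unfolding \<delta>_def using T by (subst Min_gr_iff) (auto simp: T_def)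
  moreover have "cis t \<notin> \<Omega>" if t: "t \<noteq> \<theta>" "\<bar>t - \<theta>\<bar> < \<delta>" for t
  proof
    assume "cis t \<in> \<Omega>"
    moreover have "\<delta> \<le> pi" unfolding \<delta>_def using T by (intro Min_le) auto
    ultimately have "t - \<theta> \<in> T" using t by (auto simp: T_def)
    then have "\<delta> \<le> \<bar>t - \<theta>\<bar>" unfolding \<delta>_def using T by (intro Min_le) auto
    then show False using t by simp
  qed
  ultimately show ?thesis by blast
qed

lemma PD_jump_holder:
  assumes f: "f \<in> PD"
    and comp: "\<And>A. A \<in> components (unit_circle - jump_set f) \<Longrightarrow> arc_holder_on \<gamma> A f"
  shows "jump_holder \<gamma> (\<lambda>t. f (cis t)) \<theta> (2 * jump_height f (cis \<theta>))"
proof -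
  obtain \<delta> where \<delta>: "\<delta> > 0" "\<And>t. t \<noteq> \<theta> \<Longrightarrow> \<bar>t - \<theta>\<bar> < \<delta> \<Longrightarrow> cis t \<notin> jump_set f"
    using punctured_arc_avoiding_finite[OF PD_finite[OF f]] by metis
  obtain C where C: "C \<ge> 0" "\<And>s t. \<theta> < s \<Longrightarrow> s \<le> t \<Longrightarrow> t < \<theta> + \<delta> \<Longrightarrow>
      cmod (f (cis s) - f (cis t)) \<le> C * (t - s) powr \<gamma>"
    using arc_holder[OF comp, of \<theta> "\<theta> + \<delta>"] \<delta>(2) by auto
  obtain D where D: "D \<ge> 0" "\<And>s t. \<theta> - \<delta> < s \<Longrightarrow> s \<le> t \<Longrightarrow> t < \<theta> \<Longrightarrow>
      cmod (f (cis s) - f (cis t)) \<le> D * (t - s) powr \<gamma>"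
    using arc_holder[OF comp, of "\<theta> - \<delta>" \<theta>] \<delta>(2) by auto
  show ?thesis
    unfolding jump_holder_def
  proof (intro exI conjI allI impI)
    show "limit_plus f (cis \<theta>) - limit_minus f (cis \<theta>) = 2 * jump_height f (cis \<theta>)"
      by (simp add: jump_height_def)
    show "0 \<le> max C D" using C by simp
    show "cmod (f (cis s) - f (cis t)) \<le> max C D * (t - s) powr \<gamma>"
      if "\<theta> < s" "s < t" "t < \<theta> + \<delta>" for s t
      by (rule order.trans[OF C(2) mult_right_mono]) (use that in auto)
    show "cmod (f (cis s) - f (cis t)) \<le> max C D * (t - s) powr \<gamma>"
      if "\<theta> - \<delta> < s" "s < t" "t < \<theta>" for s t
      by (rule order.trans[OF D(2) mult_right_mono]) (use that in auto)
  qed (use \<delta> PD_limits[OF f] in auto)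
qed

lemma countable_cis_eq: "countable {t. cis t \<in> \<Omega>}" if "finite \<Omega>"
proof -
  have "countable {t. cis t = z}" for z
  proof (cases "\<exists>a. cis a = z")
    case True
    then obtain a where a: "cis a = z" by blast
    have "{t. cis t = z} \<subseteq> range (\<lambda>n::int. a + 2 * pi * n)"
    proof
      fix t assume "t \<in> {t. cis t = z}"
      then have "(t - a) / (2 * pi) \<in> \<int>" using a cis_eq_cis_iff[of t a] by simp
      then obtain n where "(t - a) / (2 * pi) = of_int n" by (auto elim: Ints_cases)
      then have "t = a + 2 * pi * of_int n" by (simp add: field_simps)
      then show "t \<in> range (\<lambda>n::int. a + 2 * pi * n)" by blast
    qed
    then show ?thesis by (rule countable_subset) simp
  qed simp
  then have "countable (\<Union>z\<in>\<Omega>. {t. cis t = z})" using that by (intro countable_UN) (auto simp: countable_finite)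
  moreover have "{t. cis t \<in> \<Omega>} = (\<Union>z\<in>\<Omega>. {t. cis t = z})" by auto
  ultimately show ?thesis by simp
qed

lemma PD_bounded_symbol:
  assumes f: "f \<in> PD"
    and comp: "\<And>A. A \<in> components (unit_circle - jump_set f) \<Longrightarrow> arc_holder_on \<gamma> A f"
    and \<gamma>: "0 < \<gamma>"
  shows "bounded_symbol (\<lambda>t. f (cis t)) 1"
proof
  show "cmod (f (cis t)) \<le> 1" for t by (rule PD_bound[OF f])
  show "(\<lambda>t. f (cis t)) \<in> borel_measurable borel"
  proof (rule borel_measurable_continuous_countable_exceptions[OF countable_cis_eq[OF PD_finite[OF f]]])
    show "continuous_on (- {t. cis t \<in> jump_set f}) (\<lambda>t. f (cis t))"
    proof (rule continuous_at_imp_continuous_on, rule ballI)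
      fix \<theta> assume \<theta>: "\<theta> \<in> - {t. cis t \<in> jump_set f}"
      obtain \<delta> where \<delta>: "\<delta> > 0" "\<And>t. t \<noteq> \<theta> \<Longrightarrow> \<bar>t - \<theta>\<bar> < \<delta> \<Longrightarrow> cis t \<notin> jump_set f"
        using punctured_arc_avoiding_finite[OF PD_finite[OF f]] by metis
      have "cis t \<notin> jump_set f" if "\<theta> - \<delta> < t" "t < \<theta> + \<delta>" for t
        using \<delta>(2)[of t] \<theta> that by (cases "t = \<theta>") auto
      then obtain C where C: "C \<ge> 0" "\<And>s t. \<theta> - \<delta> < s \<Longrightarrow> s \<le> t \<Longrightarrow> t < \<theta> + \<delta> \<Longrightarrow>
          cmod (f (cis s) - f (cis t)) \<le> C * (t - s) powr \<gamma>"
        using arc_holder[OF comp, of "\<theta> - \<delta>" "\<theta> + \<delta>"] by auto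
      have "eventually (\<lambda>t. t \<in> {\<theta> - \<delta><..<\<theta> + \<delta>}) (at \<theta>)"
        using \<delta>(1) by (intro eventually_at_in_open') auto
      then have "eventually (\<lambda>t. cmod (f (cis t) - f (cis \<theta>)) \<le> C * \<bar>t - \<theta>\<bar> powr \<gamma>) (at \<theta>)"
      proof (rule eventually_mono)
        fix t assume t: "t \<in> {\<theta> - \<delta><..<\<theta> + \<delta>}"
        then show "cmod (f (cis t) - f (cis \<theta>)) \<le> C * \<bar>t - \<theta>\<bar> powr \<gamma>"
          using C(2)[of t \<theta>] C(2)[of \<theta> t] \<delta>(1)
          by (cases "t \<le> \<theta>") (auto simp: abs_if norm_minus_commute)
      qed
      moreover have "((\<lambda>t. C * \<bar>t - \<theta>\<bar> powr \<gamma>) \<longlongrightarrow> 0) (at \<theta>)"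
      proof -
        have "((\<lambda>t. \<bar>t - \<theta>\<bar>) \<longlongrightarrow> \<bar>\<theta> - \<theta>\<bar>) (at \<theta>)" by (intro tendsto_intros)
        then have "((\<lambda>t. \<bar>t - \<theta>\<bar> powr \<gamma>) \<longlongrightarrow> 0) (at \<theta>)"
          using \<gamma> by (intro tendsto_zero_powrI[OF _ tendsto_const]) auto
        then show ?thesis by (rule tendsto_mult_right_zero)
      qed
      ultimately have "((\<lambda>t. f (cis t) - f (cis \<theta>)) \<longlongrightarrow> 0) (at \<theta>)" by (rule Lim_null_comparison)
      then show "isCont (\<lambda>t. f (cis t)) \<theta>" by (simp add: isCont_def LIM_zero_iff)
    qed
  qed
qed

text \<open>The factor \<open>- \<i> / \<pi>\<close> is the ratio between the Fourier coefficients of the model jump and the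
  entries of the Hilbert matrix.\<close>

definition jump_coeff :: "(complex \<Rightarrow> complex) \<Rightarrow> complex \<Rightarrow> complex"
  where "jump_coeff f z = - \<i> / of_real pi * jump_height f z"

text \<open>Closed under conjugation, as required of the words \<open>z, cnj z, \<dots>\<close>; at the added points the jump
  height is zero.\<close>

definition sym_jump_set :: "(complex \<Rightarrow> complex) \<Rightarrow> complex set"
  where "sym_jump_set f = jump_set f \<union> cnj ` jump_set f"

lemma sym_jump_set:
  assumes "f \<in> PD"
  shows "finite (sym_jump_set f)" "z \<in> sym_jump_set f \<Longrightarrow> cmod z = 1"
    "z \<in> sym_jump_set f \<Longrightarrow> cnj z \<in> sym_jump_set f"
  using PD_finite[OF assms] by (auto simp: sym_jump_set_def jump_set_def)

lemma fcoef_fourier_coeff: "fcoef (\<lambda>t. f (cis t)) = fourier_coeff f"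
  by (simp add: fun_eq_iff fcoef_def fourier_coeff_def)

text \<open>Subtracting the model jumps leaves a function without jumps and with the same Hoelder exponent. The
  Fourier coefficients of the remainder are so small that its Hankel matrix is Hilbert--Schmidt.\<close>

lemma PD_hankel:
  assumes f: "f \<in> PD"
  defines "B \<equiv> hankel_seq (fourier_coeff f)"
    and "A \<equiv> jump_hankel (sym_jump_set f) (jump_coeff f)"
  shows "op_le B 1" and "B \<doteq> A" and "tr B \<triangleq> tr A"
proof -
  obtain \<gamma> where \<gamma>: "1/2 < \<gamma>" "\<gamma> \<le> 1"
    and comp: "\<And>A. A \<in> components (unit_circle - jump_set f) \<Longrightarrow> arc_holder_on \<gamma> A f"
    using f unfolding PD_def by blast
  let ?F = "\<lambda>t. f (cis t)" and ?S = "sym_jump_set f" and ?\<kappa> = "jump_height f"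
  note S = sym_jump_set[OF f]
  have F: "bounded_symbol ?F 1" using \<gamma> by (intro PD_bounded_symbol[OF f comp]) auto
  interpret F: bounded_symbol ?F 1 by (rule F)
  show "op_le B 1" using F.op_le_hankel by (simp add: B_def fcoef_fourier_coeff)
  define J where "J = (\<lambda>z t. model_jump (t - Arg2pi z))"
  define G where "G = (\<lambda>t. ?F t - (\<Sum>z\<in>?S. ?\<kappa> z * J z t))"
  have J: "bounded_symbol (J z) 1" for z
    using bounded_symbol_shift[OF model_jump_bounded, of "- Arg2pi z"] by (simp add: J_def)
  have cis_Arg2pi: "cis (Arg2pi z) = z" if "z \<in> ?S" for z
    using S(2)[OF that] complex_norm_eq_1_exp[of z] by (simp add: cis_conv_exp)
  have sum: "bounded_symbol (\<lambda>t. \<Sum>z\<in>?S. ?\<kappa> z * J z t) (\<Sum>z\<in>?S. cmod (?\<kappa> z) * 1)"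
    by (rule bounded_symbol_sum[OF S(1) bounded_symbol_cmult[OF J]])
  have G: "bounded_symbol G (1 + (\<Sum>z\<in>?S. cmod (?\<kappa> z) * 1))"
    unfolding G_def by (rule bounded_symbol_diff[OF F sum])
  have G_per: "G (t + 2 * pi) = G t" for t
  proof -
    have "cis (t + 2 * pi) = cis t" using cis_mult[of t "2 * pi"] by simp
    moreover have "J z (t + 2 * pi) = J z t" for z
      using model_jump_periodic[of "t - Arg2pi z"] by (simp add: J_def algebra_simps)
    ultimately show ?thesis by (simp add: G_def)
  qed
  have G_holder: "jump_holder \<gamma> G \<theta> 0" for \<theta>
  proof -
    have "jump_holder \<gamma> (\<lambda>t. \<Sum>z\<in>?S. ?\<kappa> z * J z t) \<theta> (\<Sum>z\<in>?S. ?\<kappa> z * (if cis \<theta> = cis (Arg2pi z) then 2 else 0))"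
      using \<gamma> unfolding J_def
      by (intro jump_holder_sum[OF S(1), of \<gamma> "\<lambda>z t. model_jump (t - Arg2pi z)" \<theta>] jump_holder_model_jump) auto
    also have "(\<Sum>z\<in>?S. ?\<kappa> z * (if cis \<theta> = cis (Arg2pi z) then 2 else 0))
        = (\<Sum>z\<in>?S. if cis \<theta> = z then 2 * ?\<kappa> z else 0)"
      by (intro sum.cong) (auto simp: cis_Arg2pi)
    also have "\<dots> = 2 * ?\<kappa> (cis \<theta>)"
      using S(1) jump_height_eq_0[of "cis \<theta>" f] by (auto simp: sym_jump_set_def)
    finally have J_jump: "jump_holder \<gamma> (\<lambda>t. \<Sum>z\<in>?S. ?\<kappa> z * J z t) \<theta> (2 * ?\<kappa> (cis \<theta>))" .
    have "jump_holder \<gamma> (\<lambda>t. ?F t + (-1) * (\<Sum>z\<in>?S. ?\<kappa> z * J z t)) \<theta> (2 * ?\<kappa> (cis \<theta>) + (-1) * (2 * ?\<kappa> (cis \<theta>)))"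
      by (rule jump_holder_combine[OF PD_jump_holder[OF f] J_jump]) (rule comp)
    then show ?thesis by (simp add: G_def)
  qed
  have "0 < \<gamma>" using \<gamma> by simp
  obtain \<epsilon> C X where X: "0 < \<epsilon>" "0 \<le> C" "finite X"
    "\<And>s t. s \<in> {0..2 * pi} \<Longrightarrow> s \<notin> X \<Longrightarrow> t \<notin> X \<Longrightarrow> s < t \<Longrightarrow> t < s + \<epsilon> \<Longrightarrow> cmod (G s - G t) \<le> C * (t - s) powr \<gamma>"
  proof (rule uniform_holder[OF G_holder \<open>0 < \<gamma>\<close>, of 0 "2 * pi"])
    fix \<epsilon> C X
    assume "0 < \<epsilon>" "0 \<le> C" "finite X"
      "\<And>s t. s \<in> {0..2 * pi} \<Longrightarrow> s \<notin> X \<Longrightarrow> t \<notin> X \<Longrightarrow> s < t \<Longrightarrow> t < s + \<epsilon> \<Longrightarrow> cmod (G s - G t) \<le> C * (t - s) powr \<gamma>"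
    then show thesis by (rule that)
  qed
  have "\<exists>K. \<forall>n. (\<Sum>k<n. real (k + 1) * (cmod (fcoef G k))\<^sup>2) \<le> K"
    by (rule weighted_coefficients_of_holder[OF G G_per \<gamma>(1) X])
  then obtain K where K: "\<And>n. (\<Sum>k<n. real (k + 1) * (cmod (fcoef G k))\<^sup>2) \<le> K" by blast
  have coef: "fcoef G k = fourier_coeff f k - (\<Sum>z\<in>?S. jump_coeff f z * (cnj z ^ k * (1 / of_nat (k + 1))))" for k
  proof -
    have "fcoef G k = fourier_coeff f k - fcoef (\<lambda>t. \<Sum>z\<in>?S. ?\<kappa> z * J z t) k"
      unfolding G_def by (simp add: fcoef_diff[OF F sum] fcoef_fourier_coeff)
    also have "fcoef (\<lambda>t. \<Sum>z\<in>?S. ?\<kappa> z * J z t) k = (\<Sum>z\<in>?S. ?\<kappa> z * fcoef (J z) k)"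
      using fcoef_sum[OF S(1) bounded_symbol_cmult[OF J]] by (simp add: fcoef_cmult)
    also have "\<dots> = (\<Sum>z\<in>?S. jump_coeff f z * (cnj z ^ k * (1 / of_nat (k + 1))))"
    proof (intro sum.cong refl)
      fix z assume z: "z \<in> ?S"
      have "fcoef (J z) k = cnj z ^ k * (- \<i> / of_real pi * (1 / of_nat (k + 1)))"
        unfolding J_def using Arg2pi_ge_0[of z] Arg2pi_lt_2pi[of z]
        by (subst fcoef_model_jump_shift) (auto simp: cis_Arg2pi[OF z] fcoef_model_jump)
      then show "?\<kappa> z * fcoef (J z) k = jump_coeff f z * (cnj z ^ k * (1 / of_nat (k + 1)))"
        by (simp add: jump_coeff_def)
    qed
    finally show ?thesis .
  qed
  have diff: "B - A = hankel_seq (fcoef G)"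
  proof (rule mseq_eqI)
    fix N i j :: nat
    assume ij: "i < N" "j < N"
    have "entry A N i j = (\<Sum>z\<in>?S. jump_coeff f z * (cnj z ^ i * (1 / of_nat (i + j + 1)) * cnj z ^ j))"
      using ij by (simp add: A_def jump_hankel_def[OF S] mult.assoc add_ac)
    also have "\<dots> = (\<Sum>z\<in>?S. jump_coeff f z * (cnj z ^ (i + j) * (1 / of_nat (i + j + 1))))"
      by (simp add: power_add mult_ac)
    finally show "entry (B - A) N i j = entry (hankel_seq (fcoef G)) N i j"
      using ij by (simp add: B_def coef)
  qed
  show "B \<doteq> A"
    unfolding hs_equiv_def diff by (rule hankel_seq_negligible(1)[OF K])
  show "tr B \<triangleq> tr A"
    using hankel_seq_negligible(2)[OF K] unfolding diff[symmetric] seq_equiv_def by (simp add: tr_diff)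
qed

lemma tr_hankel_power:
  assumes f: "f \<in> PD" and k: "0 < k"
  shows "tr (hankel_seq (fourier_coeff f) ^ k)
    \<triangleq> (\<lambda>N. jump_trace (sym_jump_set f) (jump_coeff f) k * tr (hilb ^ k) N)"
proof -
  have "op_bounded (hankel_seq (fourier_coeff f))"
    using PD_hankel(1)[OF f] by (auto simp: op_bounded_def)
  then show ?thesis
    using tr_perturbed_jump_hankel_power[OF sym_jump_set[OF f] PD_hankel(2,3)[OF f]] k by blast
qed

section \<open>The generating function of the moments\<close>

lemma sech_moment_bounds: "0 \<le> sech_moment k \<and> sech_moment k \<le> pi"
proof (induction k rule: sech_moment.induct)
  case (4 k)
  have "real (Suc k) / real (Suc (Suc k)) * sech_moment (Suc k) \<le> 1 * sech_moment (Suc k)"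
    using 4 by (intro mult_right_mono) auto
  then show ?case using 4 by (auto simp del: of_nat_Suc)
qed (use pi_gt3 in auto)

lemma sech_moment_rec: "0 < k \<Longrightarrow> real (Suc k) * sech_moment (Suc (Suc k)) = real k * sech_moment k"
  by (cases k) (auto simp del: of_nat_Suc)

text \<open>The recursion of the moments is the differential equation \<open>(1 - x\<^sup>2) F'' = x F' + 2\<close>. In the
  variable \<open>w\<close> with \<open>x = sin w\<close> it says that the second derivative of \<open>F\<close> is the constant \<open>2\<close>, so that
  \<open>F = w\<^sup>2 + \<pi> w\<close>.\<close>

lemma sech_moment_generating_function:
  fixes x :: complex
  assumes "cmod x < 1"
  shows "(\<lambda>k. of_real (sech_moment k / real k) * x ^ k) sums ((Arcsin x)\<^sup>2 + of_real pi * Arcsin x)"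
proof -
  define a where "a = (\<lambda>k. complex_of_real (sech_moment k / real k))"
  define F F' F'' where "F = (\<lambda>x. \<Sum>k. a k * x ^ k)" and "F' = (\<lambda>x. \<Sum>k. diffs a k * x ^ k)"
    and "F'' = (\<lambda>x. \<Sum>k. diffs (diffs a) k * x ^ k)"
  have diffs_a: "diffs a k = of_real (sech_moment (Suc k))" for k
    by (simp add: diffs_def a_def del: of_nat_Suc)
  have diffs_diffs_a: "diffs (diffs a) k = of_real (real (Suc k) * sech_moment (Suc (Suc k)))" for k
    by (simp add: diffs_def[of "diffs a"] diffs_a del: of_nat_Suc sech_moment.simps)
  have geo: "summable (\<lambda>k. pi * cmod x ^ k)" if "cmod x < 1" for x :: complex
    using that by (intro summable_mult summable_geometric) simp
  have sum_a: "summable (\<lambda>k. a k * x ^ k)" if "cmod x < 1" for x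
  proof (rule summable_comparison_test'[OF geo[OF that], of 1])
    fix k :: nat assume "1 \<le> k"
    have "sech_moment k / real k \<le> pi / 1"
      using sech_moment_bounds[of k] \<open>1 \<le> k\<close> by (intro frac_le) auto
    then show "norm (a k * x ^ k) \<le> pi * cmod x ^ k"
      using sech_moment_bounds[of k] unfolding norm_mult norm_power a_def norm_of_real
      by (intro mult_right_mono) (auto simp del: of_real_divide)
  qed
  have sum_da: "summable (\<lambda>k. diffs a k * x ^ k)" if "cmod x < 1" for x
    using sech_moment_bounds unfolding diffs_a
    by (intro summable_comparison_test'[OF geo[OF that], of 0])
      (auto simp: norm_mult norm_power intro!: mult_right_mono)
  have sum_dda: "summable (\<lambda>k. diffs (diffs a) k * x ^ k)" if "cmod x < 1" for x
    using sum_da that by (rule termdiff_converges[where K = 1, rotated])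
  have F: "(F has_field_derivative F' x) (at x)" if "cmod x < 1" for x
    unfolding F_def F'_def using sum_a that by (rule termdiffs_strong')
  have F': "(F' has_field_derivative F'' x) (at x)" if "cmod x < 1" for x
    unfolding F''_def F'_def using sum_da that by (rule termdiffs_strong')
  have ode: "(1 - x\<^sup>2) * F'' x = x * F' x + 2" if x: "cmod x < 1" for x
  proof -
    define b where "b = (\<lambda>k. diffs (diffs a) k * x ^ k)"
    have b: "summable b" using sum_dda[OF x] by (simp add: b_def)
    have "b (Suc k) = x * (diffs a k * x ^ k) + (if k = 0 then 0 else x\<^sup>2 * b (k - 1))" for k
    proof (cases k)
      case 0
      then show ?thesis by (simp add: b_def diffs_diffs_a diffs_a numeral_2_eq_2)
    next
      case (Suc l)
      have "real (Suc (Suc k)) * sech_moment (Suc (Suc (Suc k))) = real (Suc k) * sech_moment (Suc k)"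
        by (rule sech_moment_rec) simp
      also have "\<dots> = sech_moment (Suc k) + real (Suc l) * sech_moment (Suc (Suc l))"
        by (simp add: Suc algebra_simps del: sech_moment.simps)
      finally have "diffs (diffs a) (Suc k) = diffs a k + diffs (diffs a) l"
        unfolding diffs_diffs_a diffs_a by (simp only: of_real_add)
      then show ?thesis by (simp add: b_def Suc algebra_simps power2_eq_square)
    qed
    then have "(\<Sum>k. b (Suc k)) = (\<Sum>k. x * (diffs a k * x ^ k) + (if k = 0 then 0 else x\<^sup>2 * b (k - 1)))"
      by simp
    also have "\<dots> = x * F' x + x\<^sup>2 * F'' x"
    proof -
      have "(\<lambda>k. x\<^sup>2 * b k) sums (x\<^sup>2 * F'' x)"
        unfolding F''_def b_def by (intro sums_mult summable_sums sum_dda x)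
      then have "(\<lambda>k. if k = 0 then 0 else x\<^sup>2 * b (k - 1)) sums (x\<^sup>2 * F'' x)"
        by (subst sums_Suc_iff[symmetric, where f = "\<lambda>k. if k = 0 then 0 else x\<^sup>2 * b (k - 1)", simplified]) simp
      moreover have "(\<lambda>k. x * (diffs a k * x ^ k)) sums (x * F' x)"
        unfolding F'_def by (intro sums_mult summable_sums sum_da x)
      ultimately show ?thesis by (intro sums_unique[symmetric] sums_add)
    qed
    also have "(\<Sum>k. b (Suc k)) = F'' x - b 0"
      using suminf_split_head[OF b] by (simp add: F''_def b_def)
    also have "b 0 = 2" by (simp add: b_def diffs_diffs_a numeral_2_eq_2)
    finally show ?thesis by (simp add: algebra_simps)
  qed
  have Arcsin: "(Arcsin has_field_derivative inverse (cos (Arcsin x))) (at x)"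
    and cos: "cos (Arcsin x) \<noteq> 0" "(cos (Arcsin x))\<^sup>2 = 1 - x\<^sup>2" if x: "cmod x < 1" for x
  proof -
    have "\<bar>Re x\<bar> < 1" using x abs_Re_le_cmod[of x] by linarith
    then show "(Arcsin has_field_derivative inverse (cos (Arcsin x))) (at x)"
      by (rule has_field_derivative_Arcsin)
    have "x\<^sup>2 \<noteq> 1" using x by (auto simp: power2_eq_1_iff)
    then show "cos (Arcsin x) \<noteq> 0" by (rule cos_Arcsin_nonzero)
    show "(cos (Arcsin x))\<^sup>2 = 1 - x\<^sup>2" using sin_cos_squared_add2[of "Arcsin x"] by (simp add: algebra_simps)
  qed
  have "\<exists>c. \<forall>x\<in>ball 0 1. cos (Arcsin x) * F' x - 2 * Arcsin x = c"
  proof (rule has_field_derivative_zero_constant)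
    fix x :: complex assume "x \<in> ball 0 1"
    then have x: "cmod x < 1" by simp
    have "((\<lambda>x. cos (Arcsin x) * F' x - 2 * Arcsin x) has_field_derivative
        (- sin (Arcsin x) * inverse (cos (Arcsin x))) * F' x + F'' x * cos (Arcsin x)
        - 2 * inverse (cos (Arcsin x))) (at x)"
      by (intro DERIV_diff DERIV_mult DERIV_cmult DERIV_chain2[OF DERIV_cos] Arcsin F' x)
    moreover have "(- sin (Arcsin x) * inverse (cos (Arcsin x))) * F' x + F'' x * cos (Arcsin x)
        - 2 * inverse (cos (Arcsin x)) = (((cos (Arcsin x))\<^sup>2 * F'' x) - (x * F' x + 2)) * inverse (cos (Arcsin x))"
      using cos(1)[OF x] by (simp add: field_simps power2_eq_square)
    moreover have "\<dots> = 0" using ode[OF x] by (simp add: cos(2)[OF x])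
    ultimately show "((\<lambda>x. cos (Arcsin x) * F' x - 2 * Arcsin x) has_field_derivative 0) (at x within ball 0 1)"
      by (auto intro: has_field_derivative_at_within)
  qed simp
  then obtain c where c: "\<And>x. cmod x < 1 \<Longrightarrow> cos (Arcsin x) * F' x - 2 * Arcsin x = c" by auto
  have "F' 0 = of_real pi" by (simp add: F'_def diffs_a powser_zero)
  then have c_pi: "c = of_real pi" using c[of 0] by simp
  have "\<exists>d. \<forall>x\<in>ball 0 1. F x - ((Arcsin x)\<^sup>2 + of_real pi * Arcsin x) = d"
  proof (rule has_field_derivative_zero_constant)
    fix x :: complex assume "x \<in> ball 0 1"
    then have x: "cmod x < 1" by simp
    have "((\<lambda>x. F x - ((Arcsin x)\<^sup>2 + of_real pi * Arcsin x)) has_field_derivative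
        F' x - (inverse (cos (Arcsin x)) * Arcsin x + inverse (cos (Arcsin x)) * Arcsin x
          + of_real pi * inverse (cos (Arcsin x)))) (at x)"
      unfolding power2_eq_square by (intro DERIV_diff DERIV_add DERIV_cmult DERIV_mult Arcsin F x)
    moreover have "F' x - (inverse (cos (Arcsin x)) * Arcsin x + inverse (cos (Arcsin x)) * Arcsin x
          + of_real pi * inverse (cos (Arcsin x)))
        = (cos (Arcsin x) * F' x - 2 * Arcsin x - of_real pi) * inverse (cos (Arcsin x))"
      using cos(1)[OF x] by (simp add: field_simps)
    ultimately show "((\<lambda>x. F x - ((Arcsin x)\<^sup>2 + of_real pi * Arcsin x)) has_field_derivative 0) (at x within ball 0 1)"
      by (auto simp: c[OF x] c_pi intro: has_field_derivative_at_within)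
  qed simp
  then obtain d where d: "\<And>x. cmod x < 1 \<Longrightarrow> F x - ((Arcsin x)\<^sup>2 + of_real pi * Arcsin x) = d" by auto
  have "a 0 = 0" by (simp add: a_def)
  then have "F 0 = 0" using powser_zero[of a] by (simp add: F_def)
  then have "d = 0" using d[of 0] by simp
  then have "F x = (Arcsin x)\<^sup>2 + of_real pi * Arcsin x" using d[OF assms] by simp
  then show ?thesis
    using summable_sums[OF sum_a[OF assms]] by (simp add: F_def a_def)
qed

lemma Arcsin_minus: "cmod x < 1 \<Longrightarrow> Arcsin (- x) = - Arcsin x"
proof -
  assume x: "cmod x < 1"
  then have "\<bar>Re x\<bar> < 1" using abs_Re_le_cmod[of x] by linarith
  then have "\<bar>Re (Arcsin x)\<bar> < pi / 2" by (rule Arcsin_bounds)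
  then have "Arcsin (sin (- Arcsin x)) = - Arcsin x" by (intro Arcsin_sin) auto
  then show ?thesis by simp
qed

lemma sech_moment_series_odd:
  assumes "cmod x < 1"
  shows "(\<lambda>k. if odd k then of_real (sech_moment k / real k) * x ^ k else 0) sums (of_real pi * Arcsin x)"
proof -
  have "cmod (- x) < 1" using assms by simp
  note * = sech_moment_generating_function[OF assms] sech_moment_generating_function[OF this]
  have "(\<lambda>k. 1/2 * (of_real (sech_moment k / real k) * x ^ k - of_real (sech_moment k / real k) * (- x) ^ k))
      sums (1/2 * (((Arcsin x)\<^sup>2 + of_real pi * Arcsin x) - ((Arcsin (- x))\<^sup>2 + of_real pi * Arcsin (- x))))"
    by (intro sums_mult sums_diff *)
  moreover have "1/2 * (of_real (sech_moment k / real k) * x ^ k - of_real (sech_moment k / real k) * (- x) ^ k)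
      = (if odd k then of_real (sech_moment k / real k) * x ^ k else 0)" for k
    by (simp add: power_minus_odd)
  ultimately show ?thesis by (simp add: Arcsin_minus[OF assms] mult.commute)
qed

lemma sech_moment_series_even:
  assumes "cmod x < 1"
  shows "(\<lambda>k. if even k then of_real (sech_moment k / real k) * x ^ k else 0) sums ((Arcsin x)\<^sup>2)"
proof -
  have "(\<lambda>k. of_real (sech_moment k / real k) * x ^ k
      - (if odd k then of_real (sech_moment k / real k) * x ^ k else 0))
      sums ((Arcsin x)\<^sup>2 + of_real pi * Arcsin x - of_real pi * Arcsin x)"
    by (intro sums_diff sech_moment_generating_function sech_moment_series_odd assms)
  moreover have "of_real (sech_moment k / real k) * x ^ k
      - (if odd k then of_real (sech_moment k / real k) * x ^ k else 0)
      = (if even k then of_real (sech_moment k / real k) * x ^ k else 0)" for k by simp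
  ultimately show ?thesis by simp
qed

lemma orbit_parity: "orbit k z = (if even k then z else cnj z)"
  by (induction k) auto

lemma orbit_weight_even: "orbit_weight c (2 * j) z = (c z * c (cnj z)) ^ j"
  by (induction j) (simp_all add: orbit_weight_def orbit_parity mult_ac)

lemma orbit_weight_self_conj: "cnj z = z \<Longrightarrow> orbit_weight c k z = c z ^ k"
  by (induction k) (simp_all add: orbit_weight_def orbit_parity)

lemma jump_trace_sym_jump_set:
  assumes "f \<in> PD"
  shows "jump_trace (sym_jump_set f) c k
    = (\<Sum>z\<in>sym_jump_set f. if orbit k z = z then orbit_weight c k z else 0)"
  by (rule jump_trace_def) (use sym_jump_set[OF assms] in blast)+

lemma jump_trace_odd:
  assumes f: "f \<in> PD" and k: "odd k"
  shows "jump_trace (sym_jump_set f) (jump_coeff f) k = jump_coeff f 1 ^ k + jump_coeff f (-1) ^ k"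
proof -
  let ?S = "sym_jump_set f"
  have k0: "0 < k" using k by (rule odd_pos)
  have zero: "jump_coeff f z = 0" if "cmod z = 1" "z \<notin> ?S" for z
    using that jump_height_eq_0[of z f] by (auto simp: jump_coeff_def sym_jump_set_def)
  have fixed: "cnj z = z \<longleftrightarrow> z \<in> {1, -1}" if "z \<in> ?S" for z
  proof -
    have "cmod z = 1" using sym_jump_set[OF f] that by blast
    then have "z * cnj z = 1" by (rule cnj_eq_inverse_unit)
    then have "z = 1 \<or> z = -1" if "cnj z = z"
      using that by (simp add: power2_eq_1_iff[symmetric] power2_eq_square)
    then show ?thesis by auto
  qed
  have "jump_trace ?S (jump_coeff f) k = (\<Sum>z\<in>?S. if z \<in> {1, -1} then jump_coeff f z ^ k else 0)"
    unfolding jump_trace_sym_jump_set[OF f]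
    using k fixed by (intro sum.cong refl) (auto simp: orbit_parity orbit_weight_self_conj)
  also have "\<dots> = (\<Sum>z\<in>?S \<inter> {1, -1}. jump_coeff f z ^ k)"
    using sym_jump_set(1)[OF f] by (simp add: sum.inter_restrict)
  also have "\<dots> = (\<Sum>z\<in>{1, -1}. jump_coeff f z ^ k)"
    using zero[of 1] zero[of "-1"] k0 by (intro sum.mono_neutral_left) auto
  finally show ?thesis by simp
qed

lemma jump_trace_even:
  assumes f: "f \<in> PD" and j: "0 < j"
  shows "jump_trace (sym_jump_set f) (jump_coeff f) (2 * j)
    = (\<Sum>z\<in>jump_set f. (jump_coeff f z * jump_coeff f (cnj z)) ^ j)"
proof -
  let ?S = "sym_jump_set f"
  have "jump_trace ?S (jump_coeff f) (2 * j) = (\<Sum>z\<in>?S. (jump_coeff f z * jump_coeff f (cnj z)) ^ j)"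
    unfolding jump_trace_sym_jump_set[OF f]
    by (intro sum.cong refl) (simp add: orbit_parity orbit_weight_even)
  also have "\<dots> = (\<Sum>z\<in>jump_set f. (jump_coeff f z * jump_coeff f (cnj z)) ^ j)"
  proof (rule sum.mono_neutral_right)
    show "\<forall>z\<in>?S - jump_set f. (jump_coeff f z * jump_coeff f (cnj z)) ^ j = 0"
    proof
      fix z assume z: "z \<in> ?S - jump_set f"
      then have "cmod z = 1" using sym_jump_set(2)[OF f] by blast
      then have "jump_coeff f z = 0" using z jump_height_eq_0[of z f] by (simp add: jump_coeff_def)
      then show "(jump_coeff f z * jump_coeff f (cnj z)) ^ j = 0" using j by simp
    qed
  qed (use sym_jump_set[OF f] in \<open>auto simp: sym_jump_set_def\<close>)
  finally show ?thesis .
qed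

definition trace_limit :: "(complex \<Rightarrow> complex) \<Rightarrow> nat \<Rightarrow> complex"
  where "trace_limit f k = jump_trace (sym_jump_set f) (jump_coeff f) k
    * of_real (pi ^ k * sech_moment k / (2 * pi\<^sup>2))"

text \<open>With \<open>x = - \<i> \<beta> \<kappa>\<close> every factor \<open>\<beta> \<pi>\<close> is absorbed by a jump coefficient \<open>- \<i> \<kappa> / \<pi>\<close>, so that the odd
  and even terms become the series of \<open>\<pi> arcsin\<close> and \<open>arcsin\<^sup>2\<close>.\<close>

lemma trace_limit_series:
  assumes f: "f \<in> PD" and \<beta>: "cmod \<beta> < 1"
  shows "(\<lambda>k. \<beta> ^ k * trace_limit f k / of_nat k) sums (gamma_coeff f \<beta> / (2 * of_real pi ^ 2))"
proof -
  define x where "x = (\<lambda>z. - \<i> * \<beta> * jump_height f z)"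
  define y where "y = (\<lambda>z. - \<i> * \<beta> * csqrt (jump_height f z * jump_height f (cnj z)))"
  define w where "w = (\<lambda>k. complex_of_real (sech_moment k / real k))"
  have x: "cmod (x z) < 1" if "cmod z = 1" for z
  proof -
    have "cmod (x z) \<le> cmod \<beta> * 1"
      unfolding x_def norm_mult using cmod_jump_height_le[OF f that] by (auto intro!: mult_left_le)
    then show ?thesis using \<beta> by simp
  qed
  have y: "cmod (y z) < 1" if "z \<in> jump_set f" for z
  proof -
    have "cmod z = 1" using that by (simp add: jump_set_def)
    then have "cmod (jump_height f z * jump_height f (cnj z)) \<le> 1 * 1"
      unfolding norm_mult by (intro mult_mono cmod_jump_height_le[OF f]) auto
    then have "cmod (csqrt (jump_height f z * jump_height f (cnj z))) \<le> 1"
      by (simp add: norm_csqrt)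
    then have "cmod (y z) \<le> cmod \<beta> * 1"
      unfolding y_def norm_mult by (auto intro!: mult_left_le)
    then show ?thesis using \<beta> by simp
  qed
  have "(\<lambda>k. 1 / (2 * of_real pi ^ 2) * ((if odd k then w k * x 1 ^ k else 0) + (if odd k then w k * x (-1) ^ k else 0)
      + (\<Sum>z\<in>jump_set f. if even k then w k * y z ^ k else 0)))
    sums (1 / (2 * of_real pi ^ 2) * (of_real pi * Arcsin (x 1) + of_real pi * Arcsin (x (-1))
      + (\<Sum>z\<in>jump_set f. (Arcsin (y z))\<^sup>2)))"
    unfolding w_def
    by (intro sums_mult sums_add sums_sum sech_moment_series_odd sech_moment_series_even x y) auto
  moreover have "1 / (2 * of_real pi ^ 2) * (of_real pi * Arcsin (x 1) + of_real pi * Arcsin (x (-1))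
      + (\<Sum>z\<in>jump_set f. (Arcsin (y z))\<^sup>2)) = gamma_coeff f \<beta> / (2 * of_real pi ^ 2)"
    by (simp add: gamma_coeff_def x_def y_def distrib_left add_divide_distrib)
  moreover have "1 / (2 * of_real pi ^ 2) * ((if odd k then w k * x 1 ^ k else 0) + (if odd k then w k * x (-1) ^ k else 0)
      + (\<Sum>z\<in>jump_set f. if even k then w k * y z ^ k else 0)) = \<beta> ^ k * trace_limit f k / of_nat k" for k
  proof (cases "k = 0")
    case True
    then show ?thesis by (simp add: w_def)
  next
    case k0: False
    define P :: complex where "P = 1 / (2 * of_real pi ^ 2)"
    have tl: "trace_limit f k = jump_trace (sym_jump_set f) (jump_coeff f) k
        * (P * (of_real pi ^ k * of_real (sech_moment k)))"
      by (simp add: trace_limit_def P_def)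
    have w: "w k = of_real (sech_moment k) / of_nat k" by (simp add: w_def)
    show ?thesis
    proof (cases "odd k")
      case True
      have xk: "x z ^ k = \<beta> ^ k * of_real pi ^ k * jump_coeff f z ^ k" for z
      proof -
        have "x z = \<beta> * of_real pi * jump_coeff f z" by (simp add: x_def jump_coeff_def)
        then show ?thesis by (simp add: power_mult_distrib)
      qed
      show ?thesis
        unfolding tl jump_trace_odd[OF f True] P_def[symmetric] xk w using True
        by (simp add: algebra_simps add_divide_distrib)
    next
      case False
      then obtain j where j: "k = 2 * j" by auto
      have yk: "y z ^ k = \<beta> ^ k * of_real pi ^ k * (jump_coeff f z * jump_coeff f (cnj z)) ^ j" for z
      proof -
        have "(y z)\<^sup>2 = - (\<beta>\<^sup>2 * (jump_height f z * jump_height f (cnj z)))"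
          by (simp add: y_def power_mult_distrib)
        also have "\<dots> = \<beta>\<^sup>2 * of_real pi ^ 2 * (jump_coeff f z * jump_coeff f (cnj z))"
          by (simp add: jump_coeff_def power2_eq_square mult.left_commute[of "jump_height f z" "\<i>"])
        finally show ?thesis by (simp add: j power_mult power_mult_distrib)
      qed
      have jt: "jump_trace (sym_jump_set f) (jump_coeff f) k
          = (\<Sum>z\<in>jump_set f. (jump_coeff f z * jump_coeff f (cnj z)) ^ j)"
        using k0 unfolding j by (intro jump_trace_even[OF f]) simp
      show ?thesis
        unfolding tl jt P_def[symmetric] yk w using False
        by (simp add: sum_distrib_left sum_distrib_right sum_divide_distrib mult_ac)
    qed
  qed
  ultimately show ?thesis by simp
qed

section \<open>Summation over the powers\<close>

lemma tr_hankel_power_asymptotics: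
  assumes "f \<in> PD" "0 < k"
  shows "tr (hankel_seq (fourier_coeff f) ^ k) \<triangleq> (\<lambda>N. trace_limit f k * of_real (harm N))"
proof -
  note tr_hankel_power[OF assms]
  also note seq_equiv_cmult[OF tr_hilb_power[OF assms(2)], of "jump_trace (sym_jump_set f) (jump_coeff f) k"]
  finally show ?thesis by (simp only: trace_limit_def mult.assoc)
qed

lemma seq_equiv_div_harm:
  assumes "a \<triangleq> (\<lambda>N. c * of_real (harm N))"
  shows "(\<lambda>N. a N / of_real (harm N)) \<longlonglongrightarrow> c"
proof -
  obtain C where C: "\<And>N. cmod (a N - c * of_real (harm N)) \<le> C * sqrt (harm N)"
    using assms unfolding seq_equiv_def negligible_seq_def by blast
  have "((\<lambda>N. a N / of_real (harm N) - c) \<longlongrightarrow> 0) sequentially"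
  proof (rule Lim_null_comparison)
    show "eventually (\<lambda>N. norm (a N / of_real (harm N) - c) \<le> C * inverse (sqrt (harm N))) sequentially"
      using eventually_gt_at_top[of 0]
    proof eventually_elim
      case (elim N)
      then have h: "0 < (harm N :: real)" by simp
      then have "complex_of_real (harm N) \<noteq> 0" by (simp only: of_real_eq_0_iff)
      then have "a N / of_real (harm N) - c = (a N - c * of_real (harm N)) / of_real (harm N)"
        by (simp add: diff_divide_distrib)
      then have "norm (a N / of_real (harm N) - c) = cmod (a N - c * of_real (harm N)) / harm N"
        using h by (simp add: norm_divide)
      also have "\<dots> \<le> C * sqrt (harm N) / harm N" by (intro divide_right_mono C harm_nonneg)
      also have "\<dots> = C * inverse (sqrt (harm N))"
      proof -
        define s where "s = sqrt (harm N :: real)"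
        have "harm N = s * s" using h by (simp only: s_def real_sqrt_mult_self abs_of_pos)
        moreover have "0 < s" using h by (simp only: s_def real_sqrt_gt_0_iff)
        ultimately show ?thesis unfolding s_def[symmetric] by (simp add: inverse_eq_divide)
      qed
      finally show ?case .
    qed
    have "filterlim (\<lambda>N. sqrt (harm N :: real)) at_top sequentially"
      by (rule filterlim_compose[OF sqrt_at_top harm_at_top])
    then have "(\<lambda>N. inverse (sqrt (harm N :: real))) \<longlonglongrightarrow> 0"
      by (rule tendsto_inverse_0_at_top)
    then show "((\<lambda>N. C * inverse (sqrt (harm N))) \<longlongrightarrow> 0) sequentially"
      by (rule tendsto_mult_right_zero)
  qed
  then show ?thesis by (simp add: LIM_zero_iff)
qed

text \<open>Since the Hankel matrices are contractions, the Hilbert--Schmidt norm of one factor already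
  bounds the traces of all powers.\<close>

lemma tr_hankel_power_bound:
  assumes f: "f \<in> PD"
  shows "\<exists>C. \<forall>k N. cmod (tr (hankel_seq (fourier_coeff f) ^ Suc k) N) \<le> C * harm N"
proof -
  let ?B = "hankel_seq (fourier_coeff f)"
  obtain C where C: "\<And>N. hs ?B N \<le> C * sqrt (harm N)"
    using hs_equiv_hs_log[OF PD_hankel(2)[OF f] hs_log_jump_hankel[OF sym_jump_set[OF f]]]
    unfolding hs_log_def by blast
  obtain D where D: "\<And>N. cmod (tr ?B N - trace_limit f 1 * of_real (harm N)) \<le> D * sqrt (harm N)"
    using tr_hankel_power_asymptotics[OF f, of 1] unfolding seq_equiv_def negligible_seq_def by auto
  define K where "K = max (C\<^sup>2) (\<bar>D\<bar> + cmod (trace_limit f 1))"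
  have "cmod (tr (?B ^ Suc k) N) \<le> K * harm N" for k N
  proof (cases "k = 0")
    case True
    have "cmod (tr ?B N) \<le> D * sqrt (harm N) + cmod (trace_limit f 1) * harm N"
      using norm_triangle_ineq[of "tr ?B N - trace_limit f 1 * of_real (harm N)" "trace_limit f 1 * of_real (harm N)"] D[of N]
      by (simp add: norm_mult norm_harm harm_nonneg of_real_harm)
    also have "D * sqrt (harm N) \<le> \<bar>D\<bar> * harm N"
    proof (cases "N = 0")
      case False
      then have h: "1 \<le> (harm N :: real)" by (intro harm_ge_1) auto
      then have "sqrt (harm N) * 1 \<le> sqrt (harm N) * sqrt (harm N)" by (intro mult_left_mono) auto
      then have "sqrt (harm N) \<le> (harm N :: real)" using h by simp
      then show ?thesis using h by (intro mult_mono) auto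
    qed (simp add: harm_def)
    also have "\<bar>D\<bar> * harm N + cmod (trace_limit f 1) * harm N \<le> K * harm N"
      unfolding distrib_right[symmetric] by (intro mult_right_mono) (auto simp: K_def harm_nonneg)
    finally show ?thesis using True by simp
  next
    case False
    then obtain l where k: "k = Suc l" by (cases k) auto
    have "op_le (?B ^ l) 1" using op_le_power[OF PD_hankel(1)[OF f], of l] by simp
    then have "hs (?B ^ k) N \<le> hs ?B N"
      using hs_op_left[of "?B ^ l" 1 ?B N] by (simp add: k power_commutes)
    then have "cmod (tr (?B ^ Suc k) N) \<le> hs ?B N * hs ?B N"
      using tr_le_hs[of "?B ^ k" ?B N] mult_right_mono[of "hs (?B ^ k) N" "hs ?B N" "hs ?B N"]
      by (simp add: power_commutes)
    also have "\<dots> \<le> (C * sqrt (harm N)) * (C * sqrt (harm N))"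
      by (intro mult_mono C) (auto intro: order.trans[OF hs_nonneg C])
    also have "\<dots> = C\<^sup>2 * harm N"
      using real_sqrt_mult_self[of "harm N"] by (simp add: power2_eq_square harm_nonneg algebra_simps)
    also have "\<dots> \<le> K * harm N" by (intro mult_right_mono) (auto simp: K_def harm_nonneg)
    finally show ?thesis .
  qed
  then show ?thesis by blast
qed

lemma hankel_mat_power_entry:
  assumes "i < N" "j < N"
  shows "(hankel_mat N f ^\<^sub>m k) $$ (i, j) = entry (hankel_seq (fourier_coeff f) ^ k) N i j"
  using assms
proof (induction k arbitrary: i j)
  case 0
  then show ?case by (simp add: hankel_mat_def one_mat_def)
next
  case (Suc k)
  have dim: "hankel_mat N f \<in> carrier_mat N N" by (simp add: hankel_mat_def)
  have dimk: "hankel_mat N f ^\<^sub>m k \<in> carrier_mat N N" by (rule pow_carrier_mat[OF dim])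
  have "(hankel_mat N f ^\<^sub>m Suc k) $$ (i, j)
      = (\<Sum>t<N. (hankel_mat N f ^\<^sub>m k) $$ (i, t) * hankel_mat N f $$ (t, j))"
    using Suc(2,3) dim dimk by (simp add: scalar_prod_def lessThan_atLeast0)
  also have "\<dots> = (\<Sum>t<N. entry (hankel_seq (fourier_coeff f) ^ k) N i t * entry (hankel_seq (fourier_coeff f)) N t j)"
    using Suc by (intro sum.cong refl) (simp add: hankel_mat_def)
  finally show ?case unfolding power_Suc2 entry_mult .
qed

lemma mat_trace_hankel_power:
  "mat_trace (hankel_mat N f ^\<^sub>m k) = tr (hankel_seq (fourier_coeff f) ^ k) N"
proof -
  have "hankel_mat N f ^\<^sub>m k \<in> carrier_mat N N" by (rule pow_carrier_mat) (simp add: hankel_mat_def)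
  moreover have "dim_row (hankel_mat N f) = N" by (simp add: hankel_mat_def)
  ultimately show ?thesis by (simp add: mat_trace_def tr_def hankel_mat_power_entry)
qed

theorem log_det_limit:
  assumes f: "f \<in> PD" and \<beta>: "cmod \<beta> < 1"
  shows "(\<lambda>N. log_det_one_minus \<beta> (hankel_mat N f) / of_real (harm N)) \<longlonglongrightarrow> - (gamma_coeff f \<beta> / (2 * of_real pi ^ 2))"
proof -
  let ?B = "hankel_seq (fourier_coeff f)"
  define a where "a = (\<lambda>k N. \<beta> ^ Suc k * (tr (?B ^ Suc k) N / of_real (harm N)) / of_nat (Suc k))"
  define b where "b = (\<lambda>k. \<beta> ^ Suc k * trace_limit f (Suc k) / of_nat (Suc k))"
  obtain C where C: "\<And>k N. cmod (tr (?B ^ Suc k) N) \<le> C * harm N"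
    using tr_hankel_power_bound[OF f] by blast
  have C0: "0 \<le> C" using order.trans[OF norm_ge_zero C[of 0 1]] by (simp add: harm_expand)
  have bound: "cmod (a k N) \<le> C * cmod \<beta> ^ Suc k" for k N
  proof -
    have "cmod (tr (?B ^ Suc k) N / of_real (harm N)) \<le> C"
    proof (cases "N = 0")
      case False
      then have h: "0 < (harm N :: real)" by simp
      then show ?thesis using C[of k N] by (simp add: norm_divide pos_divide_le_eq del: power_Suc)
    qed (simp add: harm_def C0)
    then have "cmod \<beta> ^ Suc k * cmod (tr (?B ^ Suc k) N / of_real (harm N)) / real (Suc k) \<le> cmod \<beta> ^ Suc k * C / 1"
      using C0 by (intro frac_le mult_left_mono) auto
    then show ?thesis by (simp add: a_def norm_mult norm_divide norm_power mult.commute del: power_Suc of_nat_Suc)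
  qed
  have "summable (\<lambda>k. cmod \<beta> ^ k)" using \<beta> by (intro summable_geometric) simp
  then have geo: "summable (\<lambda>k. C * cmod \<beta> ^ Suc k)"
    by (intro summable_mult) (simp only: summable_Suc_iff)
  have "(\<lambda>N. \<Sum>k. a k N) \<longlonglongrightarrow> (\<Sum>k. b k)"
  proof (rule tannerys_theorem[THEN conjunct2, THEN conjunct2])
    show "(\<lambda>N. a k N) \<longlonglongrightarrow> b k" for k
      unfolding a_def b_def
      by (intro tendsto_intros seq_equiv_div_harm tr_hankel_power_asymptotics[OF f]) (auto simp del: of_nat_Suc)
    show "\<forall>\<^sub>F (k, N) in at_top \<times>\<^sub>F sequentially. norm (a k N) \<le> C * cmod \<beta> ^ Suc k"
      by (rule always_eventually) (auto intro: bound simp del: power_Suc)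
    show "summable (\<lambda>k. C * cmod \<beta> ^ Suc k)" by (rule geo)
  qed simp
  moreover have "log_det_one_minus \<beta> (hankel_mat N f) / of_real (harm N) = - (\<Sum>k. a k N)" for N
  proof (cases "N = 0")
    case True
    then show ?thesis by (simp add: a_def harm_def)
  next
    case False
    then have "0 < (harm N :: real)" by simp
    then have h: "complex_of_real (harm N) \<noteq> 0" by (simp only: of_real_eq_0_iff)
    have "\<beta> ^ Suc k * mat_trace (hankel_mat N f ^\<^sub>m Suc k) / of_nat (Suc k) = of_real (harm N) * a k N" for k
    proof -
      have cancel: "h * (b * (t / h) / n) = b * t / n" if "h \<noteq> 0" for h b t n :: complex
        using that by simp
      show ?thesis unfolding a_def mat_trace_hankel_power cancel[OF h] by (rule refl)
    qed
    moreover have "summable (\<lambda>k. a k N)"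
      by (rule summable_comparison_test'[OF geo, of 0]) (rule bound)
    ultimately have "log_det_one_minus \<beta> (hankel_mat N f) = - (of_real (harm N) * (\<Sum>k. a k N))"
      unfolding log_det_one_minus_def by (simp only: suminf_mult)
    then show ?thesis using h by simp
  qed
  moreover have "(\<Sum>k. b k) = gamma_coeff f \<beta> / (2 * of_real pi ^ 2)"
  proof (rule sums_unique[symmetric])
    show "b sums (gamma_coeff f \<beta> / (2 * of_real pi ^ 2))"
      unfolding b_def using trace_limit_series[OF f \<beta>]
      by (subst sums_Suc_iff) simp
  qed
  ultimately show ?thesis by (simp add: tendsto_minus)
qed

lemma harm_over_ln: "(\<lambda>N. harm N / ln (real N) :: real) \<longlonglongrightarrow> 1"
proof -
  have "(\<lambda>N. (harm N - ln (real N)) * inverse (ln (real N)) + 1) \<longlonglongrightarrow> euler_mascheroni * 0 + 1"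
  proof (intro tendsto_intros euler_mascheroni_LIMSEQ tendsto_inverse_0_at_top)
    show "filterlim (\<lambda>N. ln (real N)) at_top sequentially"
      by (rule filterlim_compose[OF ln_at_top filterlim_real_sequentially])
  qed
  then have "(\<lambda>N. (harm N - ln (real N)) * inverse (ln (real N)) + 1) \<longlonglongrightarrow> 1" by simp
  then show ?thesis
  proof (rule Lim_transform_eventually)
    show "eventually (\<lambda>N. (harm N - ln (real N)) * inverse (ln (real N)) + 1 = harm N / ln (real N)) sequentially"
      using eventually_gt_at_top[of 1]
    proof eventually_elim
      case (elim N)
      then have "ln (real N) \<noteq> 0" by simp
      then show ?case by (simp add: field_simps)
    qed
  qed
qed

theorem theorem1p3:
  fixes f :: "complex \<Rightarrow> complex" and \<beta> :: complex
  assumes "f \<in> PD"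
    and "norm \<beta> < 1"
  shows "(\<lambda>N. log_det_one_minus \<beta> (hankel_mat N f)
             - (- (gamma_coeff f \<beta> / (2 * of_real pi ^ 2)) * of_real (ln (real N))))
         \<in> o(\<lambda>N. of_real (ln (real N)))"
proof (rule smalloI_tendsto)
  let ?D = "\<lambda>N. log_det_one_minus \<beta> (hankel_mat N f)"
  let ?g = "gamma_coeff f \<beta> / (2 * of_real pi ^ 2)"
  show nz: "eventually (\<lambda>N. complex_of_real (ln (real N)) \<noteq> 0) sequentially"
    using eventually_gt_at_top[of 1] by eventually_elim simp
  have "(\<lambda>N. ?D N / of_real (harm N) * of_real (harm N / ln (real N)) + ?g) \<longlonglongrightarrow> - ?g * of_real 1 + ?g"
    by (intro tendsto_intros log_det_limit[OF assms] harm_over_ln)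
  then have "(\<lambda>N. ?D N / of_real (harm N) * of_real (harm N / ln (real N)) + ?g) \<longlonglongrightarrow> 0" by simp
  then show "((\<lambda>N. (?D N - (- ?g * of_real (ln (real N)))) / of_real (ln (real N))) \<longlongrightarrow> 0) sequentially"
  proof (rule Lim_transform_eventually)
    show "eventually (\<lambda>N. ?D N / of_real (harm N) * of_real (harm N / ln (real N)) + ?g
        = (?D N - (- ?g * of_real (ln (real N)))) / of_real (ln (real N))) sequentially"
      using eventually_gt_at_top[of 1] nz
    proof eventually_elim
      case (elim N)
      have "0 < (harm N :: real)" using elim by simp
      then have "complex_of_real (harm N) \<noteq> 0" by (simp only: of_real_eq_0_iff)
      then show ?case using elim by (simp add: add_divide_distrib)
    qed
  qed
qed

end
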